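(* Let $H$, $f$, $r$, $q$ satisfy the standing assumptions listed in the context. There exists at least one weak solution $(\lambda,\phi,m)$ (as defined in the context) of the ergodic mean field game system $$\lambda+H(x,D\phi)=f(x,m(x)),\qquad -\mathrm{div}(mD_pH(x,D\phi))=0,\qquad m\ge0,\ \int_{\mathbb{T}^d}m=1\qquad\text{on }\mathbb{T}^d.$$ Moreover, the pair $(\lambda,m)$ is unique, i.e. it is the same for all weak solutions.
   Context: **Standing assumptions.** $\mathbb{T}^d=\mathbb{R}^d/\mathbb{Z}^d$ is the flat torus, and: 1. $H:\mathbb{T}^d\times\mathbb{R}^d\to\mathbb{R}$ is continuous, convex and differentiable in the second variable, $D_pH$ is continuous in both variables, and there are $r>1$, $C>0$ with $\frac{1}{rC}|p|^r-C\le H(x,p)\le\frac{C}{r}|p|^r+C$. 2. $f:\mathbb{T}^d\times(0,\infty)\to\mathbb{R}$ is continuous, strictly increasing in the second variable, and for some $q>1$, $C>0$, $\frac1C m^{q-1}-C\le f(x,m)\le Cm^{q-1}+C$ for all $m\ge1$. We write $f(x,0)=\lim_{m\to0^+}f(x,m)\in[-\infty,\infty)$. 3. $r>\max\{d(q-1),1\}$. $p=q/(q-1)$ is the conjugate exponent of $q$ (the letter $p$ also denotes the gradient variable of $H$). **Weak solution of the ergodic system.** A triple $(\lambda,\phi,m)\in\mathbb{R}\times W^{1,pr}(\mathbb{T}^d)\times L^q(\mathbb{T}^d)$ such that (i) $m\ge0$, $\int_{\mathbb{T}^d}m=1$ and $mD_pH(x,D\phi)\in L^1(\mathbb{T}^d)$;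 (ii) $\lambda+H(x,D\phi(x))=f(x,m(x))$ a.e. in $\{m>0\}$, and $\lambda+H(x,D\phi(x))\le f(x,m(x))$ a.e. in $\mathbb{T}^d$; (iii) $\mathrm{div}(mD_pH(x,D\phi))=0$ in $\mathbb{T}^d$ in the sense of distributions. *)

theory Defs
  imports "HOL-Analysis.Analysis"
begin

(* Functions on the torus R^d/Z^d are Z^d-periodic functions on R^d, where R^d is real ^ 'n
   and d = CARD('n). They are integrated over the unit cube, whose closed version contains
   representatives of all points and double counts only the faces, a null set. *)

definition periodic :: "(real ^ 'n \<Rightarrow> 'b) \<Rightarrow> bool" where
  "periodic g \<longleftrightarrow> (\<forall>x k. (\<forall>i. k $ i \<in> \<int>) \<longrightarrow> g (x + k) = g x)"

definition torus :: "(real ^ 'n) measure" where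
  "torus = lebesgue_on (cbox 0 One)"

definition partial :: "'n \<Rightarrow> (real ^ 'n \<Rightarrow> real) \<Rightarrow> real ^ 'n \<Rightarrow> real" where
  "partial i g x = frechet_derivative g (at x) (axis i 1)"

definition gradient :: "(real ^ 'n \<Rightarrow> real) \<Rightarrow> real ^ 'n \<Rightarrow> real ^ 'n" where
  "gradient g x = (\<chi> i. partial i g x)"

(* C-infinity on the torus: every iterated partial derivative is differentiable everywhere,
   hence also continuous. These are the test functions, as the torus is compact. *)
definition smooth_periodic :: "(real ^ 'n \<Rightarrow> real) \<Rightarrow> bool" where
  "smooth_periodic \<psi> \<longleftrightarrow>
     periodic \<psi> \<and> (\<forall>js :: 'n list. \<forall>x. foldr partial js \<psi> differentiable (at x))"

definition torus_Lp :: "real \<Rightarrow> (real ^ 'n \<Rightarrow> 'b :: euclidean_space) \<Rightarrow> bool" where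
  "torus_Lp s g \<longleftrightarrow>
     periodic g \<and> g \<in> borel_measurable torus \<and> integrable torus (\<lambda>x. norm (g x) powr s)"

definition weak_gradient :: "(real ^ 'n \<Rightarrow> real) \<Rightarrow> (real ^ 'n \<Rightarrow> real ^ 'n) \<Rightarrow> bool" where
  "weak_gradient \<phi> V \<longleftrightarrow> torus_Lp 1 \<phi> \<and> torus_Lp 1 V \<and>
     (\<forall>\<psi>. smooth_periodic \<psi> \<longrightarrow> (\<forall>i.
        (LINT x|torus. \<phi> x * partial i \<psi> x) = - (LINT x|torus. V x $ i * \<psi> x)))"

definition torus_W1p :: "real \<Rightarrow> (real ^ 'n \<Rightarrow> real) \<Rightarrow> bool" where
  "torus_W1p s \<phi> \<longleftrightarrow> torus_Lp s \<phi> \<and> (\<exists>V. weak_gradient \<phi> V \<and> torus_Lp s V)"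

definition divergence_free :: "(real ^ 'n \<Rightarrow> real ^ 'n) \<Rightarrow> bool" where
  "divergence_free w \<longleftrightarrow>
     (\<forall>\<psi>. smooth_periodic \<psi> \<longrightarrow> (LINT x|torus. w x \<bullet> gradient \<psi> x) = 0)"

definition hamiltonian :: "real \<Rightarrow> (real ^ 'n \<Rightarrow> real ^ 'n \<Rightarrow> real) \<Rightarrow> bool" where
  "hamiltonian r H \<longleftrightarrow> r > 1 \<and>
     (\<forall>p. periodic (\<lambda>x. H x p)) \<and>
     continuous_on UNIV (\<lambda>(x, p). H x p) \<and>
     (\<forall>x. convex_on UNIV (H x)) \<and>
     (\<forall>x p. H x differentiable (at p)) \<and>
     continuous_on UNIV (\<lambda>(x, p). gradient (H x) p) \<and>
     (\<exists>C>0. \<forall>x p. 1 / (r * C) * norm p powr r - C \<le> H x p \<and>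
                   H x p \<le> C / r * norm p powr r + C)"

(* Only the values f x m with m > 0 are meaningful. *)
definition coupling :: "real \<Rightarrow> (real ^ 'n \<Rightarrow> real \<Rightarrow> real) \<Rightarrow> bool" where
  "coupling q f \<longleftrightarrow> q > 1 \<and>
     (\<forall>m>0. periodic (\<lambda>x. f x m)) \<and>
     continuous_on (UNIV \<times> {0<..}) (\<lambda>(x, m). f x m) \<and>
     (\<forall>x. strict_mono_on {0<..} (f x)) \<and>
     (\<exists>C>0. \<forall>x. \<forall>m\<ge>1. 1 / C * m powr (q - 1) - C \<le> f x m \<and>
                        f x m \<le> C * m powr (q - 1) + C)"

(* f on [0,\<infinity>), with f(x,0) the limit at 0+, possibly -\<infinity>. Negative m is never used. *)
definition coupling_ext :: "(real ^ 'n \<Rightarrow> real \<Rightarrow> real) \<Rightarrow> real ^ 'n \<Rightarrow> real \<Rightarrow> ereal" where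
  "coupling_ext f x m =
     (if m > 0 then ereal (f x m) else Lim (at_right 0) (\<lambda>s. ereal (f x s)))"

(* c is the ergodic constant \<lambda>. The weak gradient of \<phi> is determined up to null sets, so the
   choice of D\<phi> is immaterial. *)
definition weak_solution ::
  "real \<Rightarrow> real \<Rightarrow> (real ^ 'n \<Rightarrow> real ^ 'n \<Rightarrow> real) \<Rightarrow> (real ^ 'n \<Rightarrow> real \<Rightarrow> real) \<Rightarrow>
   real \<Rightarrow> (real ^ 'n \<Rightarrow> real) \<Rightarrow> (real ^ 'n \<Rightarrow> real) \<Rightarrow> bool" where
  "weak_solution r q H f c \<phi> m \<longleftrightarrow>
     torus_W1p (q / (q - 1) * r) \<phi> \<and> torus_Lp q m \<and>
     (\<exists>D\<phi>. weak_gradient \<phi> D\<phi> \<and>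
        (AE x in torus. m x \<ge> 0) \<and>
        (LINT x|torus. m x) = 1 \<and>
        integrable torus (\<lambda>x. m x *\<^sub>R gradient (H x) (D\<phi> x)) \<and>
        (AE x in torus. m x > 0 \<longrightarrow> ereal (c + H x (D\<phi> x)) = coupling_ext f x (m x)) \<and>
        (AE x in torus. ereal (c + H x (D\<phi> x)) \<le> coupling_ext f x (m x)) \<and>
        divergence_free (\<lambda>x. m x *\<^sub>R gradient (H x) (D\<phi> x)))"

end

theory Submission
  imports Defs
begin

text \<open>
  Let F be the potential of f in m and F* its convex conjugate in m. A weak solution is a critical point of the
  convex functional J(c, V) = \<integral> F*(x, c + H(x, V)) dx - c over constants c and gradients V: with
  m = \<partial>F*(x, c + H(x, V)), which is the generalised inverse of f(x, \<cdot>), the variation in c is the mass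
  constraint and the variation in V is the continuity equation. The growth conditions make J coercive in
  L^s for s = qr/(q-1) \<ge> 2, so uniform convexity of L^s replaces weak compactness: almost norm-minimal
  elements of the sublevel sets of J form a strongly convergent minimizing sequence of smooth gradients, and
  the Poincare inequality yields a potential for the limit.

  Uniqueness is the Lasry--Lions monotonicity argument. It needs the continuity equation tested with
  Sobolev functions, which are approximated by convolution with the trigonometric kernels
  c_n \<Prod>_i ((1 + cos 2\<pi>z_i)/2)^n; such a convolution is a finite sum of products of functions
  of x and functions of y, so differentiating it and exchanging integrals reduce to linearity.
\<close>

section \<open>Integration over the torus\<close>

text \<open>The exponent s is forced: F* grows like the power p = q/(q-1) and H like |V|^r, so F*(x,
  c + H) has order |V|^(pr), and Young's inequality makes m H and m DH integrable for m in L^q. The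
  bound s \<ge> 2 is where r > d(q-1) enters; in this range Clarkson's inequality follows from the
  parallelogram law. J need not be strictly convex, so an arbitrary minimizing sequence may fail to
  converge; hence the selection by norm. The slope of F* takes values on both sides of 1, which is
  why the term -c does not destroy coercivity in c. Minimality at the limit is not formulated in a
  Sobolev space: a smooth perturbation of the limit is a limit of the same perturbation of smooth
  gradients, where the infimum is a lower bound by definition. The limits rest on one device, a
  subsequence converging almost everywhere below a single integrable majorant. Since m is defined
  pointwise from c + H(x, V), the first equation and the inequality on {m = 0} hold by construction;
  only the mass and the divergence need the variation.\<close>

lemma One_nth [simp]: "(One :: real ^ 'n) $ i = 1"
proof -
  have "(One :: real ^ 'n) \<bullet> axis i 1 = 1"
    by (intro inner_sum_Basis) auto
  then show ?thesis by (simp add: inner_axis)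
qed

lemma space_torus [simp]: "space torus = cbox 0 One"
  by (simp add: torus_def)

lemma finite_measure_torus: "finite_measure torus"
  unfolding torus_def by (rule finite_measure_lebesgue_on) simp

interpretation torus: finite_measure torus
  by (rule finite_measure_torus)

lemma measure_torus [simp]: "measure torus (cbox 0 One) = 1"
  by (simp add: torus_def measure_restrict_space content_cbox_if)

lemma torus_continuous:
  fixes g :: "real ^ 'n \<Rightarrow> 'b :: euclidean_space"
  assumes "continuous_on UNIV g"
  shows "integrable torus g" "(LINT x|torus. g x) = integral (cbox 0 One) g"
proof -
  have "continuous_on (cbox 0 One) g"
    using assms continuous_on_subset by blast
  then show "integrable torus g"
    unfolding torus_def by (rule continuous_imp_integrable)
  then show "(LINT x|torus. g x) = integral (cbox 0 One) g"
    unfolding torus_def by (rule lebesgue_integral_eq_integral) simp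
qed

lemma continuous_torus_measurable:
  fixes g :: "real ^ 'n \<Rightarrow> 'b :: euclidean_space"
  shows "continuous_on UNIV g \<Longrightarrow> g \<in> borel_measurable torus"
  using torus_continuous(1) borel_measurable_integrable by blast

lemma continuous_bounded_on_cube:
  fixes g :: "real ^ 'n \<Rightarrow> real"
  assumes "continuous_on UNIV g"
  obtains B where "\<And>y. y \<in> cbox 0 One \<Longrightarrow> \<bar>g y\<bar> \<le> B"
proof -
  have "compact (g ` cbox 0 One)"
    using assms continuous_on_subset by (intro compact_continuous_image) auto
  then show ?thesis
    using that compact_imp_bounded bounded_iff by (metis image_eqI real_norm_def)
qed

text \<open>The two boxes are the lower and the upper end of one box of length 1 + t along axis i.
  Cutting it at height 1 or at height t leaves remainders of length t that differ by one period, so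
  they contribute equally.\<close>

lemma integral_cbox_axis_shift:
  fixes v :: "real ^ 'n \<Rightarrow> real"
  assumes cont: "continuous_on UNIV v" and per: "periodic v" and t: "t \<ge> 0"
  shows "integral (cbox (a + t *\<^sub>R axis i 1) (a + t *\<^sub>R axis i 1 + One)) v = integral (cbox a (a + One)) v"
proof -
  define k :: "real ^ 'n" where "k = axis i 1"
  have k: "k \<in> Basis" "k $ i = 1" "\<And>j. j \<noteq> i \<Longrightarrow> k $ j = 0" "\<And>x. x \<bullet> k = x $ i"
    by (auto simp: k_def inner_axis axis_in_Basis_iff) (auto simp: axis_def)
  have int: "v integrable_on cbox b c" for b c
    using cont continuous_on_subset integrable_continuous by blast
  let ?B = "cbox a (a + One + t *\<^sub>R k)"
  have box: "x \<in> cbox b c \<longleftrightarrow> b $ i \<le> x $ i \<and> x $ i \<le> c $ i \<and> (\<forall>j. j \<noteq> i \<longrightarrow> b $ j \<le> x $ j \<and> x $ j \<le> c $ j)"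
    for x b c :: "real ^ 'n"
    unfolding mem_box_cart by metis
  have One_eq: "(One :: real ^ 'n) = 1"
    by (simp only: vec_eq_iff One_nth one_index simp_thms)
  note simps = One_eq one_index set_eq_iff Int_iff mem_Collect_eq box k(2,3,4) vector_add_component
    vector_minus_component vector_scaleR_component
  have s1: "?B \<inter> {x. x \<bullet> k \<le> a \<bullet> k + 1} = cbox a (a + One)"
    using t by (simp add: simps) auto
  have s2: "?B \<inter> {x. x \<bullet> k \<ge> a \<bullet> k + 1} = cbox (a + k) (a + One + t *\<^sub>R k)"
    using t by (simp add: simps) auto
  have s3: "?B \<inter> {x. x \<bullet> k \<le> a \<bullet> k + t} = cbox a (a + One + t *\<^sub>R k - k)"
    using t by (simp add: simps) auto
  have s4: "?B \<inter> {x. x \<bullet> k \<ge> a \<bullet> k + t} = cbox (a + t *\<^sub>R k) (a + One + t *\<^sub>R k)"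
    using t by (simp add: simps) auto
  have per_k: "v (x + k) = v x" for x
    using per unfolding periodic_def by (auto simp: k_def axis_def)
  have "integral (cbox (a + k) (a + One + t *\<^sub>R k)) v =
      integral (cbox a (a + One + t *\<^sub>R k - k)) (\<lambda>x. v (x + k))"
    using integral_shift_cbox[of "a + k" k "a + One + t *\<^sub>R k" v] by simp
  then have "integral (cbox (a + k) (a + One + t *\<^sub>R k)) v = integral (cbox a (a + One + t *\<^sub>R k - k)) v"
    by (simp add: per_k)
  moreover have "integral ?B v = integral (cbox a (a + One)) v + integral (cbox (a + k) (a + One + t *\<^sub>R k)) v"
    using integral_split[OF int k(1), of a "a + One + t *\<^sub>R k" "a \<bullet> k + 1"] by (simp only: s1 s2)
  moreover have "integral ?B v = integral (cbox a (a + One + t *\<^sub>R k - k)) v + integral (cbox (a + t *\<^sub>R k) (a + One + t *\<^sub>R k)) v"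
    using integral_split[OF int k(1), of a "a + One + t *\<^sub>R k" "a \<bullet> k + t"] by (simp only: s3 s4)
  ultimately show ?thesis
    by (simp add: k_def algebra_simps)
qed

text \<open>Periodicity replaces h by its fractional part e, whose entries are nonnegative as the
  axis shift demands. The cube is then moved one coordinate at a time, by induction over the set of
  axes already moved.\<close>

lemma torus_translation:
  fixes v :: "real ^ 'n \<Rightarrow> real"
  assumes cont: "continuous_on UNIV v" and per: "periodic v"
  shows "(LINT x|torus. v (x + h)) = (LINT x|torus. v x)"
proof -
  define e :: "real ^ 'n" where "e = (\<chi> i. frac (h $ i))"
  have "integral (cbox (\<Sum>i\<in>S. e $ i *\<^sub>R axis i 1) ((\<Sum>i\<in>S. e $ i *\<^sub>R axis i 1) + One)) v = integral (cbox 0 One) v"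
    if "finite S" for S
    using that
  proof (induction S rule: finite_induct)
    case (insert j S)
    then show ?case
      using integral_cbox_axis_shift[OF cont per, of "e $ j" "\<Sum>i\<in>S. e $ i *\<^sub>R axis i 1" j]
      by (simp add: add_ac e_def)
  qed simp
  from this[of UNIV] have "integral (cbox e (e + One)) v = integral (cbox 0 One) v"
    using basis_expansion[of e] by (simp add: scalar_mult_eq_scaleR)
  moreover have "integral (cbox 0 One) (\<lambda>x. v (x + e)) = integral (cbox e (e + One)) v"
    using integral_shift_cbox[of e e "e + One" v] by simp
  moreover have "v (x + h) = v (x + e)" for x
  proof -
    have "\<forall>i. (h - e) $ i \<in> \<int>" by (simp add: e_def frac_def)
    then have "v ((x + e) + (h - e)) = v (x + e)"
      using per unfolding periodic_def by blast
    then show ?thesis by simp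
  qed
  moreover have "continuous_on UNIV (\<lambda>x. v (x + e))"
    by (intro continuous_on_compose2[OF cont] continuous_intros) auto
  ultimately show ?thesis
    using torus_continuous(2)[OF cont] torus_continuous(2)[of "\<lambda>x. v (x + e)"] by simp
qed

text \<open>The second conclusion supplies integrability of the outer integrand whenever the
  exchange is used inside an estimate.\<close>

lemma torus_swap:
  fixes F :: "real ^ 'n \<Rightarrow> real ^ 'n \<Rightarrow> real"
  assumes "continuous_on UNIV (\<lambda>(x, y). F x y)"
  shows "(LINT x|torus. LINT y|torus. F x y) = (LINT y|torus. LINT x|torus. F x y)"
    and "continuous_on UNIV (\<lambda>x. LINT y|torus. F x y)"
proof -
  have c1: "continuous_on UNIV (F x)" for x
    using continuous_on_compose2[OF assms, of UNIV "\<lambda>y. (x, y)"]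
    by (simp add: continuous_intros)
  have c2: "continuous_on UNIV (\<lambda>x. F x y)" for y
    using continuous_on_compose2[OF assms, of UNIV "\<lambda>x. (x, y)"]
    by (simp add: continuous_intros)
  have "continuous_on UNIV (\<lambda>x. integral (cbox 0 One) (F x))"
    by (rule integral_continuous_on_param) (use assms continuous_on_subset in blast)
  then show c3: "continuous_on UNIV (\<lambda>x. LINT y|torus. F x y)"
    by (simp add: torus_continuous(2)[OF c1])
  have sw: "continuous_on UNIV (\<lambda>(y, x). F x y)"
    using continuous_on_compose2[OF assms, of UNIV "\<lambda>z. (snd z, fst z)"]
    by (simp add: continuous_intros case_prod_unfold)
  have "continuous_on UNIV (\<lambda>y. integral (cbox 0 One) (\<lambda>x. F x y))"
    by (rule integral_continuous_on_param) (use sw continuous_on_subset in blast)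
  then have c4: "continuous_on UNIV (\<lambda>y. LINT x|torus. F x y)"
    by (simp add: torus_continuous(2)[OF c2])
  show "(LINT x|torus. LINT y|torus. F x y) = (LINT y|torus. LINT x|torus. F x y)"
    unfolding torus_continuous(2)[OF c3] torus_continuous(2)[OF c4]
    unfolding torus_continuous(2)[OF c1] torus_continuous(2)[OF c2]
    by (rule integral_swap_continuous) (use assms continuous_on_subset in blast)
qed

lemma torus_swap_interval:
  fixes F :: "real ^ 'n \<Rightarrow> real \<Rightarrow> real"
  assumes "continuous_on UNIV (\<lambda>(x, y). F x y)"
  shows "(LINT x|torus. integral {0..1} (F x)) = integral {0..1} (\<lambda>y. LINT x|torus. F x y)"
    and "continuous_on UNIV (\<lambda>x. integral {0..1} (F x))"
proof -
  have c2: "continuous_on UNIV (\<lambda>x. F x y)" for y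
    using continuous_on_compose2[OF assms, of UNIV "\<lambda>x. (x, y)"]
    by (simp add: continuous_intros)
  have "continuous_on UNIV (\<lambda>x. integral (cbox 0 1) (F x))"
    by (rule integral_continuous_on_param) (use assms continuous_on_subset in blast)
  then show c3: "continuous_on UNIV (\<lambda>x. integral {0..1} (F x))"
    by simp
  show "(LINT x|torus. integral {0..1} (F x)) = integral {0..1} (\<lambda>y. LINT x|torus. F x y)"
    unfolding torus_continuous(2)[OF c3] torus_continuous(2)[OF c2]
    using integral_swap_continuous[of 0 0 One 1 F] assms continuous_on_subset by fastforce
qed

section \<open>Smooth periodic functions\<close>

lemma has_derivative_gradient:
  fixes g :: "real ^ 'n \<Rightarrow> real"
  assumes "g differentiable (at x)"
  shows "(g has_derivative (\<lambda>h. gradient g x \<bullet> h)) (at x)"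
proof -
  have d: "(g has_derivative frechet_derivative g (at x)) (at x)"
    using assms frechet_derivative_works by blast
  then interpret bounded_linear "frechet_derivative g (at x)"
    by (rule has_derivative_bounded_linear)
  have "frechet_derivative g (at x) h = gradient g x \<bullet> h" for h
  proof -
    have "frechet_derivative g (at x) h = frechet_derivative g (at x) (\<Sum>i\<in>UNIV. h $ i *\<^sub>R axis i 1)"
      using basis_expansion[of h] by (simp add: scalar_mult_eq_scaleR)
    also have "\<dots> = (\<Sum>i\<in>UNIV. h $ i * partial i g x)"
      by (simp add: sum scaleR partial_def)
    also have "\<dots> = gradient g x \<bullet> h"
      by (simp add: inner_vec_def gradient_def mult.commute)
    finally show ?thesis .
  qed
  then have "frechet_derivative g (at x) = (\<lambda>h. gradient g x \<bullet> h)" by blast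
  with d show ?thesis by simp
qed

lemma partial_eqI:
  assumes "(g has_derivative D) (at x)"
  shows "partial i g x = D (axis i 1)"
  using assms by (simp add: partial_def frechet_derivative_at[symmetric])

lemma partial_nth: "gradient g x $ i = partial i g x"
  by (simp add: gradient_def)

lemma gradient_eqI:
  fixes g :: "real ^ 'n \<Rightarrow> real"
  assumes "(g has_derivative (\<lambda>h. D \<bullet> h)) (at x)"
  shows "gradient g x = D"
  by (simp add: vec_eq_iff partial_nth partial_eqI[OF assms] inner_axis)

lemma has_derivative_shift:
  fixes g :: "real ^ 'n \<Rightarrow> real"
  assumes "(g has_derivative D) (at (x + k))"
  shows "((\<lambda>y. g (y + k)) has_derivative D) (at x)"
proof -
  have "((\<lambda>y. y + k) has_derivative (\<lambda>h. h)) (at x)"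
    by (auto intro!: derivative_eq_intros)
  from has_derivative_compose[OF this, of g D] assms show ?thesis by simp
qed

lemma smooth_periodicD:
  assumes "smooth_periodic \<psi>"
  shows "periodic \<psi>" "\<psi> differentiable (at x)" "smooth_periodic (partial i \<psi>)"
    "continuous_on UNIV \<psi>" "continuous_on UNIV (partial i \<psi>)" "continuous_on UNIV (gradient \<psi>)"
    "(\<psi> has_derivative (\<lambda>h. gradient \<psi> x \<bullet> h)) (at x)"
proof -
  have all: "foldr partial js \<psi> differentiable (at x)" for js x
    using assms by (auto simp: smooth_periodic_def)
  show per: "periodic \<psi>" using assms by (auto simp: smooth_periodic_def)
  show d: "\<psi> differentiable (at x)" for x using all[of "[]"] by simp
  show hd: "(\<psi> has_derivative (\<lambda>h. gradient \<psi> x \<bullet> h)) (at x)" for x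
    by (rule has_derivative_gradient[OF d])
  show "continuous_on UNIV \<psi>"
    using d by (simp add: continuous_at_imp_continuous_on differentiable_imp_continuous_within)
  have pd: "partial i \<psi> differentiable (at x)" for i x using all[of "[i]"] by simp
  then show cp: "continuous_on UNIV (partial i \<psi>)" for i
    by (simp add: continuous_at_imp_continuous_on differentiable_imp_continuous_within)
  then show "continuous_on UNIV (gradient \<psi>)"
    unfolding gradient_def by (intro continuous_on_vec_lambda)
  have "periodic (partial i \<psi>)"
    unfolding periodic_def
  proof (intro allI impI)
    fix x k :: "real ^ 'a" assume "\<forall>i. k $ i \<in> \<int>"
    then have "\<psi> (y + k) = \<psi> y" for y using per by (auto simp: periodic_def)
    then have "(\<psi> has_derivative (\<lambda>h. gradient \<psi> (x + k) \<bullet> h)) (at x)"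
      using has_derivative_shift[OF hd[of "x + k"]] by simp
    from partial_eqI[OF this, of i] partial_eqI[OF hd[of "x + k"], of i]
    show "partial i \<psi> (x + k) = partial i \<psi> x" by simp
  qed
  \<comment> \<open>\<open>foldr\<close> applies the last list entry first, so appending i
    differentiates in direction i before all of \<open>js\<close>.\<close>
  moreover have "foldr partial js (partial i \<psi>) differentiable (at x)" for js x
    using all[of "js @ [i]"] by simp
  ultimately show "smooth_periodic (partial i \<psi>)"
    by (simp add: smooth_periodic_def)
qed

text \<open>One form serves midpoints, differences and multiples of potentials, and, through the
  constant \<open>c\<close>, the normalisation of the mean.\<close>

lemma smooth_periodic_lincomb:
  assumes "smooth_periodic \<psi>" "smooth_periodic \<eta>"
  shows "smooth_periodic (\<lambda>x. a * \<psi> x + b * \<eta> x + c)"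
    and "gradient (\<lambda>x. a * \<psi> x + b * \<eta> x + c) x = a *\<^sub>R gradient \<psi> x + b *\<^sub>R gradient \<eta> x"
proof -
  have P: "partial i (\<lambda>x. a * \<psi> x + b * \<eta> x + c) = (\<lambda>x. a * partial i \<psi> x + b * partial i \<eta> x + 0)"
    if "smooth_periodic \<psi>" "smooth_periodic \<eta>" for \<psi> \<eta> c i
  proof
    fix x
    have "((\<lambda>x. a * \<psi> x + b * \<eta> x + c) has_derivative (\<lambda>h. a * (gradient \<psi> x \<bullet> h) + b * (gradient \<eta> x \<bullet> h))) (at x)"
      by (auto intro!: derivative_eq_intros smooth_periodicD(7) that)
    from partial_eqI[OF this, of i] show "partial i (\<lambda>x. a * \<psi> x + b * \<eta> x + c) x = a * partial i \<psi> x + b * partial i \<eta> x + 0"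
      by (simp add: inner_axis partial_nth)
  qed
  have sm: "smooth_periodic \<psi> \<Longrightarrow> smooth_periodic (foldr partial js \<psi>)" for js and \<psi> :: "real ^ 'a \<Rightarrow> real"
    by (induction js) (auto intro: smooth_periodicD(3))
  \<comment> \<open>The constant survives only for the empty list and is 0 after one derivative;
    keeping some constant in the formula makes the induction uniform.\<close>
  have F: "\<exists>c'. foldr partial js (\<lambda>x. a * \<psi> x + b * \<eta> x + c) = (\<lambda>x. a * foldr partial js \<psi> x + b * foldr partial js \<eta> x + c')"
    for js
  proof (induction js)
    case (Cons i js)
    then obtain c' where "foldr partial js (\<lambda>x. a * \<psi> x + b * \<eta> x + c) = (\<lambda>x. a * foldr partial js \<psi> x + b * foldr partial js \<eta> x + c')"
      by blast
    then show ?case using P[OF sm[OF assms(1)] sm[OF assms(2)]] by (intro exI[of _ 0]) simp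
  qed auto
  show "smooth_periodic (\<lambda>x. a * \<psi> x + b * \<eta> x + c)"
    unfolding smooth_periodic_def
  proof (intro conjI allI)
    show "periodic (\<lambda>x. a * \<psi> x + b * \<eta> x + c)"
      using smooth_periodicD(1)[OF assms(1)] smooth_periodicD(1)[OF assms(2)] by (auto simp: periodic_def)
    fix js x
    show "foldr partial js (\<lambda>x. a * \<psi> x + b * \<eta> x + c) differentiable at x"
      using F[of js] smooth_periodicD(2)[OF sm[OF assms(1)]] smooth_periodicD(2)[OF sm[OF assms(2)]]
      by (auto intro!: derivative_intros)
  qed
  show "gradient (\<lambda>x. a * \<psi> x + b * \<eta> x + c) x = a *\<^sub>R gradient \<psi> x + b *\<^sub>R gradient \<eta> x"
    by (simp add: vec_eq_iff partial_nth P[OF assms])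
qed

lemma smooth_segment_FTC:
  assumes "smooth_periodic \<psi>"
  shows "\<psi> (x + h) - \<psi> x = integral {0..1} (\<lambda>t. gradient \<psi> (x + t *\<^sub>R h) \<bullet> h)"
proof -
  have "((\<lambda>t. gradient \<psi> (x + t *\<^sub>R h) \<bullet> h) has_integral (\<psi> (x + 1 *\<^sub>R h) - \<psi> (x + 0 *\<^sub>R h))) {0..1}"
  proof (rule fundamental_theorem_of_calculus)
    fix t :: real
    have "((\<lambda>t. x + t *\<^sub>R h) has_derivative (\<lambda>s. s *\<^sub>R h)) (at t within {0..1})"
      by (auto intro!: derivative_eq_intros)
    from has_derivative_compose[OF this smooth_periodicD(7)[OF assms]]
    show "((\<lambda>t. \<psi> (x + t *\<^sub>R h)) has_vector_derivative gradient \<psi> (x + t *\<^sub>R h) \<bullet> h) (at t within {0..1})"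
      by (simp add: has_vector_derivative_def)
  qed simp
  then show ?thesis by (simp add: integral_unique)
qed

text \<open>Averaging over the translates by t along axis i does not change the integral, and by
  \<open>FTC\<close> the average of the derivative over t in [0,1] is an increment of
  \<open>\<psi>\<close> over one period, whose integral vanishes. \<open>FTC\<close> is an
  assumption so that the lemma applies to a product of two smooth functions without a Leibniz rule
  for iterated partials.\<close>

lemma integral_partial_eq_0:
  assumes "continuous_on UNIV (partial i \<psi>)" "periodic (partial i \<psi>)" "continuous_on UNIV \<psi>" "periodic \<psi>"
    and FTC: "\<And>x. \<psi> (x + axis i 1) - \<psi> x = integral {0..1} (\<lambda>t. partial i \<psi> (x + t *\<^sub>R axis i 1))"
  shows "(LINT x|torus. partial i \<psi> x) = 0"
proof -
  have c: "continuous_on UNIV (\<lambda>(x, t). partial i \<psi> (x + t *\<^sub>R axis i 1))"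
    unfolding case_prod_unfold by (intro continuous_on_compose2[OF assms(1)] continuous_intros) auto
  have "(LINT x|torus. partial i \<psi> x) = integral {0..1::real} (\<lambda>t. LINT x|torus. partial i \<psi> (x + t *\<^sub>R axis i 1))"
    using torus_translation[OF assms(1,2)] by simp
  also have "\<dots> = (LINT x|torus. \<psi> (x + axis i 1) - \<psi> x)"
    using torus_swap_interval(1)[OF c] FTC by simp
  also have "\<dots> = 0"
    using torus_translation[OF assms(3,4)] assms(4)
    by (subst Bochner_Integration.integral_diff)
      (auto intro!: torus_continuous continuous_on_compose2[OF assms(3)] continuous_intros assms)
  finally show ?thesis .
qed

lemma integration_by_parts:
  assumes "smooth_periodic \<phi>" "smooth_periodic \<psi>"
  shows "(LINT x|torus. \<phi> x * partial i \<psi> x) = - (LINT x|torus. partial i \<phi> x * \<psi> x)"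
proof -
  let ?u = "\<lambda>x. \<phi> x * \<psi> x"
  have d: "(?u has_derivative (\<lambda>h. \<phi> x * (gradient \<psi> x \<bullet> h) + (gradient \<phi> x \<bullet> h) * \<psi> x)) (at x)" for x
    by (intro has_derivative_mult smooth_periodicD(7) assms)
  have p: "partial i ?u = (\<lambda>x. \<phi> x * partial i \<psi> x + partial i \<phi> x * \<psi> x)"
    using partial_eqI[OF d] by (auto simp: inner_axis partial_nth)
  have "(LINT x|torus. partial i ?u x) = 0"
  proof (rule integral_partial_eq_0)
    show "continuous_on UNIV (partial i ?u)"
      unfolding p by (intro continuous_intros smooth_periodicD(4,5) assms)
    show "periodic (partial i ?u)" "periodic ?u"
      using smooth_periodicD(1)[OF assms(1)] smooth_periodicD(1)[OF assms(2)]
       smooth_periodicD(1)[OF smooth_periodicD(3)[OF assms(1), of i]] 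
       smooth_periodicD(1)[OF smooth_periodicD(3)[OF assms(2), of i]]
      unfolding p by (auto simp: periodic_def)
    show "continuous_on UNIV ?u" by (intro continuous_intros smooth_periodicD(4) assms)
    fix x
    have "((\<lambda>t. partial i ?u (x + t *\<^sub>R axis i 1)) has_integral (?u (x + 1 *\<^sub>R axis i 1) - ?u (x + 0 *\<^sub>R axis i 1))) {0..1}"
    proof (rule fundamental_theorem_of_calculus)
      fix t :: real
      have "((\<lambda>t. x + t *\<^sub>R axis i (1::real)) has_derivative (\<lambda>s. s *\<^sub>R axis i 1)) (at t within {0..1})"
        by (auto intro!: derivative_eq_intros)
      from has_derivative_compose[OF this d]
      show "((\<lambda>t. ?u (x + t *\<^sub>R axis i 1)) has_vector_derivative partial i ?u (x + t *\<^sub>R axis i 1)) (at t within {0..1})"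
        by (simp add: has_vector_derivative_def p inner_axis partial_nth algebra_simps)
    qed simp
    then show "?u (x + axis i 1) - ?u x = integral {0..1} (\<lambda>t. partial i ?u (x + t *\<^sub>R axis i 1))"
      by (simp add: integral_unique)
  qed
  moreover have "continuous_on UNIV (\<lambda>x. \<phi> x * partial i \<psi> x)" "continuous_on UNIV (\<lambda>x. partial i \<phi> x * \<psi> x)"
    by (intro continuous_intros smooth_periodicD(4,5) assms)+
  ultimately show ?thesis
    unfolding p by (subst (asm) Bochner_Integration.integral_add) (auto intro: torus_continuous)
qed

section \<open>Powers, Jensen's inequality and the Poincare inequality\<close>

lemma powr_tangent_nonneg:
  fixes a b s :: real
  assumes "s \<ge> 1" "a \<ge> 0" "b \<ge> 0"
  shows "a powr s + s * a powr (s - 1) * (b - a) \<le> b powr s"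
proof (cases "a = 0 \<or> b = 0")
  \<comment> \<open>The boundary is checked by hand. Since \<open>0 powr y = 0\<close> for every y,
    also for y = 0, the left side is 0 when a = 0.\<close>
  case True
  show ?thesis
  proof (cases "a = 0")
    case False
    then have b: "b = 0" and a: "a > 0" using True assms by auto
    have "a powr (s - 1) * a = a powr s"
      using a by (simp add: powr_diff)
    then have "a powr s + s * a powr (s - 1) * (b - a) = a powr s * (1 - s)"
      using b by (simp add: algebra_simps)
    also have "\<dots> \<le> 0" using assms by (simp add: mult_nonneg_nonpos)
    finally show ?thesis using b by simp
  qed simp
next
  case False
  then have "a > 0" "b > 0" using assms by auto
  have "s * a powr (s - 1) * (b - a) \<le> b powr s - a powr s"
  proof (rule convex_on_imp_above_tangent[OF powr_convex[OF assms(1)]])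
    show "((\<lambda>x. x powr s) has_real_derivative s * a powr (s - 1)) (at a within {0<..})"
      using \<open>a > 0\<close> by (auto intro!: derivative_eq_intros has_real_derivative_powr' simp: field_simps)
  qed (use \<open>a > 0\<close> \<open>b > 0\<close> in \<open>auto simp: interior_open\<close>)
  then show ?thesis by simp
qed

lemma powr_abs_tangent:
  fixes a b s :: real
  assumes "s \<ge> 1"
  shows "\<bar>a\<bar> powr s + s * \<bar>a\<bar> powr (s - 1) * sgn a * (b - a) \<le> \<bar>b\<bar> powr s"
proof -
  have "sgn a * (b - a) \<le> \<bar>b\<bar> - \<bar>a\<bar>"
    by (auto simp: sgn_if abs_if)
  then have "s * \<bar>a\<bar> powr (s - 1) * (sgn a * (b - a)) \<le> s * \<bar>a\<bar> powr (s - 1) * (\<bar>b\<bar> - \<bar>a\<bar>)"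
    using assms by (intro mult_left_mono) auto
  with powr_tangent_nonneg[OF assms, of "\<bar>a\<bar>" "\<bar>b\<bar>"] show ?thesis by (simp add: mult.assoc)
qed

text \<open>The tangent to |.|^s at the mean \<open>a\<close> is integrated against the probability
  weight \<open>k\<close>; its linear term integrates to 0.\<close>

lemma weighted_jensen:
  fixes v k :: "'a \<Rightarrow> real"
  assumes s: "s \<ge> 1" and k: "AE x in M. k x \<ge> 0" and intk: "integrable M k" and k1: "(LINT x|M. k x) = 1"
    and intv: "integrable M (\<lambda>x. v x * k x)" and ints: "integrable M (\<lambda>x. \<bar>v x\<bar> powr s * k x)"
  shows "\<bar>LINT x|M. v x * k x\<bar> powr s \<le> (LINT x|M. \<bar>v x\<bar> powr s * k x)"
proof -
  define a where "a = (LINT x|M. v x * k x)"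
  define c where "c = s * \<bar>a\<bar> powr (s - 1) * sgn a"
  have "(LINT x|M. \<bar>a\<bar> powr s * k x + c * (v x * k x) - c * a * k x) \<le> (LINT x|M. \<bar>v x\<bar> powr s * k x)"
  proof (rule integral_mono_AE)
    show "AE x in M. \<bar>a\<bar> powr s * k x + c * (v x * k x) - c * a * k x \<le> \<bar>v x\<bar> powr s * k x"
      using k
    proof eventually_elim
      case (elim x)
      have "(\<bar>a\<bar> powr s + c * (v x - a)) * k x \<le> \<bar>v x\<bar> powr s * k x"
        using powr_abs_tangent[OF s, of a "v x"] elim unfolding c_def by (intro mult_right_mono) auto
      then show ?case by (simp add: algebra_simps)
    qed
  qed (use intk intv ints in auto)
  also have "(LINT x|M. \<bar>a\<bar> powr s * k x + c * (v x * k x) - c * a * k x) = \<bar>a\<bar> powr s"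
    using intk intv by (simp add: k1 a_def)
  finally show ?thesis by (simp add: a_def)
qed

text \<open>The increment is the integral of the directional derivative along the segment. Jensen in
  the segment parameter, then Fubini, and translation invariance removes the parameter
  again.\<close>

lemma poincare_shift:
  fixes u :: "real ^ 'n \<Rightarrow> real"
  assumes u: "smooth_periodic u" and s: "s \<ge> 1" and h: "norm h \<le> N"
  shows "(LINT x|torus. \<bar>u (x + h) - u x\<bar> powr s) \<le> N powr s * (LINT x|torus. norm (gradient u x) powr s)"
proof -
  have N: "N \<ge> 0" using h norm_ge_zero order_trans by blast
  note c = smooth_periodicD(4)[OF u] and cg = smooth_periodicD(6)[OF u]
  define F where "F x t = norm (gradient u (x + t *\<^sub>R h)) powr s * N powr s" for x t
  have cF: "continuous_on UNIV (\<lambda>(x, t). F x t)"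
    unfolding F_def case_prod_unfold using s
    by (intro continuous_intros continuous_on_powr' continuous_on_compose2[OF cg]) auto
  have cDu: "continuous_on UNIV (\<lambda>t. gradient u (x + t *\<^sub>R h))" for x
    by (intro continuous_on_compose2[OF cg] continuous_intros) auto
  have cFx: "continuous_on UNIV (F x)" for x
    unfolding F_def using s by (intro continuous_intros continuous_on_powr' cDu) auto
  have "\<bar>u (x + h) - u x\<bar> powr s \<le> integral {0..1} (F x)" for x
  proof -
    let ?D = "\<lambda>t. gradient u (x + t *\<^sub>R h) \<bullet> h"
    let ?I = "lebesgue_on {0..1::real}"
    have cD: "continuous_on UNIV ?D" by (intro continuous_intros cDu)
    have i1: "integrable ?I f" if "continuous_on UNIV f" for f :: "real \<Rightarrow> real"
      using that continuous_on_subset by (intro continuous_imp_integrable_real) blast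
    have cp: "continuous_on UNIV (\<lambda>t. \<bar>?D t\<bar> powr s)"
      using s by (intro continuous_intros continuous_on_powr' cD) auto
    have "\<bar>u (x + h) - u x\<bar> powr s = \<bar>LINT t|?I. ?D t * 1\<bar> powr s"
      unfolding smooth_segment_FTC[OF u] using lebesgue_integral_eq_integral[OF i1[OF cD]] by simp
    also have "\<dots> \<le> (LINT t|?I. \<bar>?D t\<bar> powr s * 1)"
      by (rule weighted_jensen[OF s]) (use i1[OF cD] i1[OF cp] in \<open>auto simp: measure_restrict_space\<close>)
    also have "\<dots> \<le> (LINT t|?I. F x t)"
    proof (rule integral_mono)
      fix t
      have "\<bar>?D t\<bar> \<le> norm (gradient u (x + t *\<^sub>R h)) * N"
        using Cauchy_Schwarz_ineq2[of "gradient u (x + t *\<^sub>R h)" h] h mult_left_mono[OF h norm_ge_zero]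
        by (meson order_trans)
      then have "\<bar>?D t\<bar> powr s \<le> (norm (gradient u (x + t *\<^sub>R h)) * N) powr s"
        using s by (intro powr_mono2) auto
      then show "\<bar>?D t\<bar> powr s * 1 \<le> F x t" using N by (simp add: F_def powr_mult)
    qed (use i1[OF cp] i1[OF cFx] in auto)
    also have "\<dots> = integral {0..1} (F x)"
      using lebesgue_integral_eq_integral[OF i1[OF cFx]] by simp
    finally show ?thesis .
  qed
  moreover have "continuous_on UNIV (\<lambda>x. \<bar>u (x + h) - u x\<bar> powr s)"
    using s by (intro continuous_intros continuous_on_powr' continuous_on_compose2[OF c]) auto
  ultimately have "(LINT x|torus. \<bar>u (x + h) - u x\<bar> powr s) \<le> (LINT x|torus. integral {0..1} (F x))"
    by (intro integral_mono torus_continuous torus_swap_interval(2) cF) auto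
  also have "\<dots> = integral {0..1} (\<lambda>t. LINT x|torus. F x t)"
    by (rule torus_swap_interval(1)[OF cF])
  also have "\<dots> = (LINT x|torus. norm (gradient u x) powr s * N powr s)"
  proof -
    have "(LINT x|torus. F x t) = (LINT x|torus. norm (gradient u x) powr s * N powr s)" for t
      unfolding F_def
    proof (rule torus_translation[of "\<lambda>x. norm (gradient u x) powr s * N powr s"])
      show "continuous_on UNIV (\<lambda>x. norm (gradient u x) powr s * N powr s)"
        using s by (intro continuous_intros continuous_on_powr' cg) auto
      show "periodic (\<lambda>x. norm (gradient u x) powr s * N powr s)"
        using smooth_periodicD(1)[OF smooth_periodicD(3)[OF u]] by (simp add: periodic_def gradient_def)
    qed
    then show ?thesis by simp
  qed
  finally show ?thesis by (simp add: mult.commute)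
qed

text \<open>Zero mean makes -u(x) the average of u(x+h) - u(x) over h in the unit cube. Jensen moves
  the power inside the average, and after exchanging the integrals each h costs at most the diagonal
  of the cube, \<open>norm One\<close>.\<close>

lemma poincare:
  fixes u :: "real ^ 'n \<Rightarrow> real"
  assumes u: "smooth_periodic u" and s: "s \<ge> 1" and mean: "(LINT x|torus. u x) = 0"
  shows "(LINT x|torus. \<bar>u x\<bar> powr s) \<le> norm (One :: real ^ 'n) powr s * (LINT x|torus. norm (gradient u x) powr s)"
proof -
  note c = smooth_periodicD(4)[OF u]
  have cxh: "continuous_on UNIV (\<lambda>(x, h). \<bar>u (x + h) - u x\<bar> powr s)"
    unfolding case_prod_unfold
    using s by (intro continuous_intros continuous_on_powr' continuous_on_compose2[OF c]) auto
  have swapped: "continuous_on UNIV (\<lambda>(h, x). \<bar>u (x + h) - u x\<bar> powr s)"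
    unfolding case_prod_unfold
    using s by (intro continuous_intros continuous_on_powr' continuous_on_compose2[OF c]) auto
  have "(LINT x|torus. \<bar>u x\<bar> powr s) \<le> (LINT x|torus. LINT h|torus. \<bar>u (x + h) - u x\<bar> powr s)"
  proof (rule integral_mono)
    show "integrable torus (\<lambda>x. \<bar>u x\<bar> powr s)"
      using s by (intro torus_continuous continuous_intros continuous_on_powr' c) auto
    show "integrable torus (\<lambda>x. LINT h|torus. \<bar>u (x + h) - u x\<bar> powr s)"
      by (intro torus_continuous torus_swap(2) cxh)
    fix x :: "real ^ 'n"
    have c1: "continuous_on UNIV (\<lambda>h. u (x + h))"
      by (intro continuous_on_compose2[OF c] continuous_intros) auto
    have "(LINT h|torus. u (h + x)) = 0"
      using torus_translation[OF c smooth_periodicD(1)[OF u], of x] mean by simp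
    then have "(LINT h|torus. u (x + h) - u x) = - u x"
      using torus_continuous(1)[OF c1] by (simp add: add.commute)
    then have "\<bar>u x\<bar> powr s = \<bar>LINT h|torus. (u (x + h) - u x) * 1\<bar> powr s"
      by simp
    also have "\<dots> \<le> (LINT h|torus. \<bar>u (x + h) - u x\<bar> powr s * 1)"
    proof (rule weighted_jensen[OF s])
      show "integrable torus (\<lambda>h. (u (x + h) - u x) * 1)"
        by (intro torus_continuous continuous_intros c1)
      show "integrable torus (\<lambda>h. \<bar>u (x + h) - u x\<bar> powr s * 1)"
        using s by (intro torus_continuous continuous_intros continuous_on_powr' c1) auto
    qed auto
    finally show "\<bar>u x\<bar> powr s \<le> (LINT h|torus. \<bar>u (x + h) - u x\<bar> powr s)" by simp
  qed
  also have "\<dots> = (LINT h|torus. LINT x|torus. \<bar>u (x + h) - u x\<bar> powr s)"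
    by (rule torus_swap(1)[OF cxh])
  also have "\<dots> \<le> (LINT h|(torus :: (real ^ 'n) measure). norm (One :: real ^ 'n) powr s * (LINT x|torus. norm (gradient u x) powr s))"
  proof (rule integral_mono)
    show "integrable torus (\<lambda>h. LINT x|torus. \<bar>u (x + h) - u x\<bar> powr s)"
      by (intro torus_continuous torus_swap(2) swapped)
    fix h :: "real ^ 'n" assume "h \<in> space torus"
    then have "norm h \<le> norm (One :: real ^ 'n)"
      by (intro norm_le_componentwise_cart) (auto simp: mem_box_cart simp del: sum_component)
    then show "(LINT x|torus. \<bar>u (x + h) - u x\<bar> powr s) \<le> norm (One :: real ^ 'n) powr s * (LINT x|torus. norm (gradient u x) powr s)"
      by (rule poincare_shift[OF u s])
  qed simp
  finally show ?thesis by simp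
qed

section \<open>Completeness of Lebesgue spaces and minimizing sequences\<close>

lemma powr_sum_le_max:
  fixes x y s :: real
  assumes "x \<ge> 0" "y \<ge> 0" "s \<ge> 0"
  shows "(x + y) powr s \<le> 2 powr s * (x powr s + y powr s)"
proof -
  have "(x + y) powr s \<le> (2 * max x y) powr s"
    using assms by (intro powr_mono2) auto
  also have "\<dots> = 2 powr s * max x y powr s"
    using assms by (simp add: powr_mult)
  also have "\<dots> \<le> 2 powr s * (x powr s + y powr s)"
    by (intro mult_left_mono) (auto simp: max_def)
  finally show ?thesis .
qed

lemma norm_add_powr_le:
  fixes x y :: "'b :: real_normed_vector"
  assumes "s \<ge> 0"
  shows "norm (x + y) powr s \<le> 2 powr s * (norm x powr s + norm y powr s)"
proof -
  have "norm (x + y) powr s \<le> (norm x + norm y) powr s"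
    using assms by (intro powr_mono2 norm_triangle_ineq) auto
  also have "\<dots> \<le> 2 powr s * (norm x powr s + norm y powr s)"
    using assms by (intro powr_sum_le_max) auto
  finally show ?thesis .
qed

lemma norm_minus_powr_le:
  fixes x y :: "'b :: real_normed_vector"
  assumes "s \<ge> 0"
  shows "norm (x - y) powr s \<le> 2 powr s * (norm x powr s + norm y powr s)"
  using norm_add_powr_le[OF assms, of x "- y"] by simp

lemma geometric_increments_convergent:
  fixes X :: "nat \<Rightarrow> 'b :: banach"
  assumes inc: "\<And>n. norm (X (Suc n) - X n) \<le> w * (1/2) ^ n" and w: "w \<ge> 0"
  shows "convergent X" "norm (X n) \<le> norm (X 0) + 2 * w"
proof -
  have dist: "norm (X (n + k) - X n) \<le> 2 * w * (1/2) ^ n" for n k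
  proof -
    \<comment> \<open>The subtracted tail lets the induction close: each increment w (1/2)^j is
      exactly the drop of 2 w (1/2)^j from j to j + 1.\<close>
    have "norm (X (n + k) - X n) \<le> 2 * w * (1/2) ^ n - 2 * w * (1/2) ^ (n + k)"
    proof (induction k)
      case (Suc k)
      have "norm (X (n + Suc k) - X n) \<le> norm (X (Suc (n + k)) - X (n + k)) + norm (X (n + k) - X n)"
        using norm_triangle_ineq[of "X (Suc (n + k)) - X (n + k)" "X (n + k) - X n"] by simp
      also have "\<dots> \<le> w * (1/2) ^ (n + k) + (2 * w * (1/2) ^ n - 2 * w * (1/2) ^ (n + k))"
        using inc[of "n + k"] Suc by simp
      finally show ?case by simp
    qed simp
    moreover have "2 * w * (1/2) ^ (n + k) \<ge> 0" using w by simp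
    ultimately show ?thesis by linarith
  qed
  show "norm (X n) \<le> norm (X 0) + 2 * w"
    using dist[of 0 n] norm_triangle_ineq2[of "X n" "X 0"] by simp
  have "Cauchy X"
  proof (rule CauchyI')
    fix e :: real assume "e > 0"
    have "(\<lambda>n. 2 * w * (1/2) ^ n) \<longlonglongrightarrow> 2 * w * 0"
      by (intro tendsto_intros LIMSEQ_power_zero) auto
    then have "eventually (\<lambda>n. 2 * w * (1/2) ^ n < e) sequentially"
      using \<open>e > 0\<close> by (intro order_tendstoD(2)[where y = "2 * w * 0"]) auto
    then obtain M where M: "2 * w * (1/2) ^ M < e / 1" "\<And>n. n \<ge> M \<Longrightarrow> 2 * w * (1/2) ^ n < e"
      unfolding eventually_sequentially by auto
    show "\<exists>M. \<forall>m\<ge>M. \<forall>n>m. dist (X m) (X n) < e"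
    proof (intro exI allI impI)
      fix m n assume "M \<le> m" "m < n"
      then show "dist (X m) (X n) < e"
        using dist[of m "n - m"] M(2)[of m] by (simp add: dist_norm norm_minus_commute)
    qed
  qed
  then show "convergent X" by (simp add: Cauchy_convergent_iff)
qed

text \<open>Riesz-Fischer together with one integrable bound for all s-th powers, which is what the
  later dominated convergence arguments need. The limit is written with \<open>lim\<close> so that
  it has a value at every point.\<close>

lemma Lp_Cauchy_subsequence:
  fixes u :: "nat \<Rightarrow> 'a \<Rightarrow> 'b :: euclidean_space"
  assumes s: "s \<ge> 1" and meas: "\<And>n. u n \<in> borel_measurable M"
    and int: "\<And>n. integrable M (\<lambda>x. norm (u n x) powr s)"
    and cauchy: "\<And>e. e > 0 \<Longrightarrow> \<exists>N. \<forall>n\<ge>N. \<forall>m\<ge>N. (LINT x|M. norm (u n x - u m x) powr s) < e"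
  obtains k h where "strict_mono (k :: nat \<Rightarrow> nat)" "integrable M (h :: 'a \<Rightarrow> real)"
    "AE x in M. (\<lambda>n. u (k n) x) \<longlonglongrightarrow> lim (\<lambda>n. u (k n) x)"
    "AE x in M. \<forall>n. norm (u (k n) x) powr s \<le> h x"
proof -
  \<comment> \<open>The s-th root of c is 2, so a weight c^i on the s-th power of the i-th increment
    turns a bound on the weighted sum into increments of size (1/2)^i.\<close>
  define c where "c = 2 powr s"
  have c: "c > 0" "c powr (1 / s) = 2" using s by (auto simp: c_def powr_powr)
  have "\<exists>N. \<forall>n\<ge>N. \<forall>m\<ge>N. (LINT x|M. norm (u n x - u m x) powr s) < 1 / (2 * c) ^ i" for i
    using c by (intro cauchy) auto
  then obtain N where N: "\<And>i n m. n \<ge> N i \<Longrightarrow> m \<ge> N i \<Longrightarrow> (LINT x|M. norm (u n x - u m x) powr s) < 1 / (2 * c) ^ i"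
    by metis
  \<comment> \<open>The summand i forces strict growth, and the sum contains the threshold
    \<open>N i\<close>.\<close>
  define k where "k i = i + (\<Sum>j\<le>i. N j)" for i
  have k: "strict_mono k"
    by (intro strict_monoI_Suc) (simp add: k_def)
  have kN: "k i \<ge> N i" for i
    unfolding k_def using member_le_sum[of i "{..i}" N] by simp
  have kN': "k (Suc i) \<ge> N i" for i
    using kN[of i] strict_mono_less[OF k, of i "Suc i"] by simp
  define D where "D i x = c ^ i * norm (u (k (Suc i)) x - u (k i) x) powr s" for i x
  have [measurable]: "u n \<in> borel_measurable M" for n by (rule meas)
  have Dnn: "D i x \<ge> 0" for i x using c by (simp add: D_def)
  have intdiff: "integrable M (\<lambda>x. norm (u n x - u m x) powr s)" for n m
  proof (rule Bochner_Integration.integrable_bound)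
    show "integrable M (\<lambda>x. 2 powr s * (norm (u n x) powr s + norm (u m x) powr s))"
      by (intro integrable_mult_right Bochner_Integration.integrable_add int)
    show "AE x in M. norm (norm (u n x - u m x) powr s) \<le> norm (2 powr s * (norm (u n x) powr s + norm (u m x) powr s))"
      using s by (auto intro!: AE_I2 norm_minus_powr_le simp: abs_mult)
  qed measurable
  have intD: "integrable M (D i)" for i
    unfolding D_def by (intro integrable_mult_right intdiff)
  have "(LINT x|M. D i x) \<le> (1/2) ^ i" for i
  proof -
    have "(LINT x|M. D i x) = c ^ i * (LINT x|M. norm (u (k (Suc i)) x - u (k i) x) powr s)"
      unfolding D_def by simp
    also have "\<dots> \<le> c ^ i * (1 / (2 * c) ^ i)"
      using N[OF kN'[of i] kN[of i]] c by (intro mult_left_mono) auto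
    also have "\<dots> = (1/2) ^ i" using c by (simp add: power_mult_distrib field_simps)
    finally show ?thesis .
  qed
  then have sumD: "summable (\<lambda>i. LINT x|M. D i x)"
    by (intro summable_comparison_test[OF _ summable_geometric[of "1/2::real"]])
      (auto intro!: exI[of _ 0] simp: Dnn)
  have "(\<Sum>i. ennreal (LINT x|M. D i x)) < \<infinity>"
    using sumD Dnn by (subst suminf_ennreal2) auto
  then have "(\<integral>\<^sup>+x. (\<Sum>i. ennreal (D i x)) \<partial>M) < \<infinity>"
    using intD Dnn by (subst nn_integral_suminf) (auto simp: nn_integral_eq_integral)
  then have "AE x in M. (\<Sum>i. ennreal (D i x)) \<noteq> \<infinity>"
    using intD by (intro nn_integral_noteq_infinite) auto
  then have AEsum: "AE x in M. summable (\<lambda>i. D i x)"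
    by eventually_elim (use Dnn in \<open>auto intro: summable_suminf_not_top\<close>)
  \<comment> \<open>Integrable, and a bound for all increments at once:
    \<open>D i x \<le> W x\<close> says that the i-th one is at most W^(1/s) (1/2)^i.\<close>
  define W where "W x = (\<Sum>i. D i x)" for x
  have intW: "integrable M W"
    unfolding W_def
    by (rule integrable_suminf[OF intD]) (use AEsum sumD Dnn in \<open>auto elim: eventually_mono\<close>)
  define h where "h x = 2 powr s * (norm (u (k 0) x) powr s + 2 powr s * \<bar>W x\<bar>)" for x
  have pt: "convergent (\<lambda>n. u (k n) x) \<and> (\<forall>n. norm (u (k n) x) powr s \<le> h x)" if sm: "summable (\<lambda>i. D i x)" for x
  proof -
    have Wnn: "W x \<ge> 0" unfolding W_def using sm Dnn by (intro suminf_nonneg) auto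
    have "norm (u (k (Suc i)) x - u (k i) x) \<le> W x powr (1 / s) * (1/2) ^ i" for i
    proof -
      have "D i x \<le> W x"
        unfolding W_def using sum_le_suminf[OF sm, of "{i}"] Dnn by simp
      then have "norm (u (k (Suc i)) x - u (k i) x) powr s \<le> W x * (1 / c ^ i)"
        using c by (simp add: D_def field_simps)
      then have "(norm (u (k (Suc i)) x - u (k i) x) powr s) powr (1 / s) \<le> (W x * (1 / c ^ i)) powr (1 / s)"
        using s by (intro powr_mono2) auto
      also have "\<dots> = W x powr (1 / s) * (1/2) ^ i"
      proof -
        have "c ^ i = 2 powr (s * real i)"
          by (simp add: c_def powr_realpow[symmetric] powr_powr)
        then have "(1 / c ^ i) powr (1 / s) = 1 / 2 ^ i"
          using s by (simp add: powr_divide powr_powr powr_realpow)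
        then have "(1 / c ^ i) powr (1 / s) = (1/2) ^ i"
          by (simp add: power_divide)
        then show ?thesis using Wnn c powr_mult[of "W x" "1 / c ^ i" "1 / s"] by simp
      qed
      finally show ?thesis using s by (simp add: powr_powr)
    qed
    note g = geometric_increments_convergent[of "\<lambda>n. u (k n) x", OF this powr_ge_zero]
    have "norm (u (k n) x) powr s \<le> h x" for n
    proof -
      have "norm (u (k n) x) powr s \<le> (norm (u (k 0) x) + 2 * W x powr (1 / s)) powr s"
        using s by (intro powr_mono2 g(2)) auto
      also have "\<dots> \<le> 2 powr s * (norm (u (k 0) x) powr s + (2 * W x powr (1 / s)) powr s)"
        using s by (intro powr_sum_le_max) auto
      also have "(2 * W x powr (1 / s)) powr s = 2 powr s * W x"
        using s Wnn by (simp add: powr_mult powr_powr)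
      finally show ?thesis using Wnn by (simp add: h_def)
    qed
    then show ?thesis using g(1) by simp
  qed
  show ?thesis
  proof
    show "strict_mono k" by (rule k)
    show "integrable M h"
      unfolding h_def by (intro integrable_mult_right Bochner_Integration.integrable_add int integrable_abs intW)
    show "AE x in M. (\<lambda>n. u (k n) x) \<longlonglongrightarrow> lim (\<lambda>n. u (k n) x)"
      using AEsum by eventually_elim (use pt convergent_LIMSEQ_iff in blast)
    show "AE x in M. \<forall>n. norm (u (k n) x) powr s \<le> h x"
      using AEsum by eventually_elim (use pt in blast)
  qed
qed

text \<open>The parallelogram law is the case s = 2. Superadditivity (\<open>add\<close>) and
  midpoint convexity (\<open>half\<close>) of the power s/2 \<ge> 1 transfer it to s.\<close>

lemma clarkson:
  fixes a b :: "'b :: real_inner"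
  assumes s: "s \<ge> 2"
  shows "norm ((a + b) /\<^sub>R 2) powr s + norm ((a - b) /\<^sub>R 2) powr s \<le> (norm a powr s + norm b powr s) / 2"
proof -
  have add: "x powr t + y powr t \<le> (x + y) powr t" if "t \<ge> 1" "x \<ge> 0" "y \<ge> 0" for x y t :: real
  proof -
    have *: "z powr t = z * z powr (t - 1)" if "z \<ge> 0" for z
      using that \<open>t \<ge> 1\<close> by (cases "z = 0") (auto simp: powr_diff)
    have "x powr t + y powr t = x * x powr (t - 1) + y * y powr (t - 1)"
      using * that by simp
    also have "\<dots> \<le> x * (x + y) powr (t - 1) + y * (x + y) powr (t - 1)"
      using that by (intro add_mono mult_left_mono powr_mono2) auto
    also have "\<dots> = (x + y) powr t" using *[of "x + y"] that by (simp add: algebra_simps)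
    finally show ?thesis .
  qed
  have half: "((x + y) / 2) powr t \<le> (x powr t + y powr t) / 2" if "t \<ge> 1" "x \<ge> 0" "y \<ge> 0" for x y t :: real
    using powr_tangent_nonneg[of t "(x + y) / 2" x] powr_tangent_nonneg[of t "(x + y) / 2" y] that
    by (simp add: field_simps)
  have sq: "norm v powr s = ((norm v)\<^sup>2) powr (s / 2)" for v :: 'b
    by (cases "v = 0") (auto simp: powr_powr simp flip: powr_numeral)
  have par: "(norm ((a + b) /\<^sub>R 2))\<^sup>2 + (norm ((a - b) /\<^sub>R 2))\<^sup>2 = ((norm a)\<^sup>2 + (norm b)\<^sup>2) / 2"
    by (simp add: power2_norm_eq_inner inner_simps algebra_simps inner_commute) 
  have "norm ((a + b) /\<^sub>R 2) powr s + norm ((a - b) /\<^sub>R 2) powr s \<le> (((norm a)\<^sup>2 + (norm b)\<^sup>2) / 2) powr (s / 2)"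
    unfolding sq par[symmetric] using s by (intro add) auto
  also have "\<dots> \<le> (norm a powr s + norm b powr s) / 2"
    unfolding sq using s by (intro half) auto
  finally show ?thesis .
qed

text \<open>In place of weak compactness: almost minimal norm elements of the sublevel sets of J are
  Cauchy, because N is uniformly convex.\<close>

lemma uniformly_convex_minimizing_sequence:
  fixes J N :: "'v \<Rightarrow> real" and mid :: "'v \<Rightarrow> 'v \<Rightarrow> 'v" and D :: "'v \<Rightarrow> 'v \<Rightarrow> real"
  assumes X: "X \<noteq> {}" "\<And>v w. v \<in> X \<Longrightarrow> w \<in> X \<Longrightarrow> mid v w \<in> X"
    and J: "\<And>v. v \<in> X \<Longrightarrow> l \<le> J v" "\<And>v w. v \<in> X \<Longrightarrow> w \<in> X \<Longrightarrow> J (mid v w) \<le> (J v + J w) / 2"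
    and N: "\<And>v. v \<in> X \<Longrightarrow> N v \<ge> 0" "\<And>v. v \<in> X \<Longrightarrow> J v \<le> Inf (J ` X) + 1 \<Longrightarrow> N v \<le> B"
    and D: "\<And>v w. v \<in> X \<Longrightarrow> w \<in> X \<Longrightarrow> N (mid v w) + D v w \<le> (N v + N w) / 2"
  obtains v where "\<And>n. v n \<in> X" "(\<lambda>n. J (v n)) \<longlonglongrightarrow> Inf (J ` X)"
    "\<And>e. e > 0 \<Longrightarrow> \<exists>M. \<forall>n\<ge>M. \<forall>m\<ge>M. D (v n) (v m) < (e :: real)"
proof -
  define I where "I = Inf (J ` X)"
  define \<epsilon> where "\<epsilon> n = 1 / real (Suc n)" for n
  have \<epsilon>: "0 < \<epsilon> n" "\<epsilon> n \<le> 1" for n by (auto simp: \<epsilon>_def)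
  have \<epsilon>_mono: "n \<le> m \<Longrightarrow> \<epsilon> m \<le> \<epsilon> n" for n m by (simp add: \<epsilon>_def frac_le)
  have \<epsilon>_lim: "\<epsilon> \<longlonglongrightarrow> 0" unfolding \<epsilon>_def by (rule LIMSEQ_Suc[OF lim_1_over_n])
  have bdd: "bdd_below (J ` X)" using J(1) by (auto intro!: bdd_belowI)
  have I_le: "I \<le> J v" if "v \<in> X" for v
    unfolding I_def using bdd that by (intro cInf_lower) auto
  define K where "K n = {v \<in> X. J v \<le> I + \<epsilon> n}" for n
  have K_ne: "K n \<noteq> {}" for n
  proof -
    have "Inf (J ` X) < I + \<epsilon> n" using \<epsilon> by (simp add: I_def)
    then obtain y where "y \<in> J ` X" "y < I + \<epsilon> n"
      using cInf_lessD[of "J ` X"] X(1) by blast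
    then show ?thesis by (auto simp: K_def intro!: less_imp_le)
  qed
  have K_mono: "K m \<subseteq> K n" if "n \<le> m" for n m
    using \<epsilon>_mono[OF that] by (auto simp: K_def)
  have bddN: "bdd_below (N ` K n)" for n using N(1) by (auto intro!: bdd_belowI simp: K_def)
  \<comment> \<open>The sublevel sets shrink with n, so these infima increase; B bounds them, hence
    they converge.\<close>
  define d where "d n = Inf (N ` K n)" for n
  have d_le: "d n \<le> N v" if "v \<in> K n" for n v
    unfolding d_def using bddN that by (intro cInf_lower) auto
  have d_mono: "d n \<le> d m" if "n \<le> m" for n m
    unfolding d_def using K_ne bddN K_mono[OF that] by (intro cInf_superset_mono) auto
  have d_B: "d n \<le> B" for n
  proof -
    obtain v where "v \<in> K n" using K_ne by blast
    moreover then have "N v \<le> B" using N(2)[of v] \<epsilon>(2)[of n] by (auto simp: K_def I_def)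
    ultimately show ?thesis using d_le by (meson order_trans)
  qed
  have "\<exists>v. v \<in> K n \<and> N v \<le> d n + \<epsilon> n" for n
  proof -
    have "Inf (N ` K n) < d n + \<epsilon> n" using \<epsilon> by (simp add: d_def)
    then obtain y where "y \<in> N ` K n" "y < d n + \<epsilon> n"
      using cInf_lessD[of "N ` K n" "d n + \<epsilon> n"] K_ne[of n] by auto
    then obtain w where "w \<in> K n" "N w < d n + \<epsilon> n" by auto
    then show ?thesis by (intro exI[of _ w]) auto
  qed
  then obtain v where v: "\<And>n. v n \<in> K n" "\<And>n. N (v n) \<le> d n + \<epsilon> n" by metis
  have "incseq d" using d_mono by (auto simp: incseq_def)
  then obtain dl where dl: "d \<longlonglongrightarrow> dl" using incseq_convergent[of d B] d_B by blast
  have d_dl: "d n \<le> dl" for n using incseq_le[OF \<open>incseq d\<close> dl] .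
  \<comment> \<open>The midpoint of two almost minimal elements stays in \<open>K M\<close>, so its
    N is at least \<open>d M\<close>; the convexity defect D must then fit into the gap
    \<open>dl - d M\<close> plus the tolerance.\<close>
  have key: "D (v n) (v m) \<le> (dl - d M) + \<epsilon> M" if "M \<le> n" "M \<le> m" for n m M
  proof -
    have vn: "v n \<in> K M" "v m \<in> K M" using v(1) K_mono that by blast+
    then have XX: "v n \<in> X" "v m \<in> X" "J (v n) \<le> I + \<epsilon> M" "J (v m) \<le> I + \<epsilon> M" by (auto simp: K_def)
    have "J (mid (v n) (v m)) \<le> I + \<epsilon> M" using J(2)[OF XX(1,2)] XX(3,4) by simp
    then have "mid (v n) (v m) \<in> K M" using X(2) XX by (auto simp: K_def)
    then have "d M \<le> N (mid (v n) (v m))" by (rule d_le)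
    moreover have "N (v n) \<le> dl + \<epsilon> M" using v(2)[of n] d_dl[of n] \<epsilon>_mono[OF that(1)] by linarith
    moreover have "N (v m) \<le> dl + \<epsilon> M" using v(2)[of m] d_dl[of m] \<epsilon>_mono[OF that(2)] by linarith
    moreover have "N (mid (v n) (v m)) + D (v n) (v m) \<le> (N (v n) + N (v m)) / 2" using D[OF XX(1,2)] .
    ultimately show ?thesis by argo
  qed
  show ?thesis
  proof
    show "v n \<in> X" for n using v(1)[of n] by (simp add: K_def)
    show "(\<lambda>n. J (v n)) \<longlonglongrightarrow> Inf (J ` X)"
      unfolding I_def[symmetric]
    proof (rule tendsto_sandwich[OF _ _ tendsto_const])
      show "(\<lambda>n. I + \<epsilon> n) \<longlonglongrightarrow> I" using tendsto_add[OF tendsto_const \<epsilon>_lim, of I] by simp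
    qed (use v(1) I_le in \<open>auto simp: K_def\<close>)
    fix e :: real assume "e > 0"
    have "(\<lambda>M. (dl - d M) + \<epsilon> M) \<longlonglongrightarrow> (dl - dl) + 0"
      by (intro tendsto_intros dl \<epsilon>_lim)
    then have "eventually (\<lambda>M. (dl - d M) + \<epsilon> M < e) sequentially"
      using \<open>e > 0\<close> by (intro order_tendstoD(2)) auto
    then obtain M where "(dl - d M) + \<epsilon> M < e" by (auto simp: eventually_sequentially)
    then show "\<exists>M. \<forall>n\<ge>M. \<forall>m\<ge>M. D (v n) (v m) < e"
      using key by (meson le_less_trans)
  qed
qed

section \<open>Mollification by trigonometric polynomials\<close>

text \<open>Closed under sums and products, hence under \<open>partial\<close>; smoothness of every
  order then reduces to first-order facts proved by one induction.\<close>

inductive_set trig :: "(real ^ 'n \<Rightarrow> real) set" where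
  trig_const: "(\<lambda>x. c) \<in> trig"
| trig_cos: "(\<lambda>x. cos (2 * pi * x $ i)) \<in> trig"
| trig_sin: "(\<lambda>x. sin (2 * pi * x $ i)) \<in> trig"
| trig_add: "a \<in> trig \<Longrightarrow> b \<in> trig \<Longrightarrow> (\<lambda>x. a x + b x) \<in> trig"
| trig_mult: "a \<in> trig \<Longrightarrow> b \<in> trig \<Longrightarrow> (\<lambda>x. a x * b x) \<in> trig"

lemma trig_periodic_partial:
  fixes \<psi> :: "real ^ 'n \<Rightarrow> real"
  shows "\<psi> \<in> trig \<Longrightarrow> periodic \<psi> \<and> (\<forall>x. \<psi> differentiable (at x)) \<and> (\<forall>i. partial i \<psi> \<in> trig)"
proof (induction rule: trig.induct)
  case (trig_const c)
  have "partial i (\<lambda>x :: real ^ 'n. c) = (\<lambda>x. 0)" for i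
    by (rule ext) (simp add: partial_eqI[OF has_derivative_const])
  then show ?case by (auto simp: periodic_def intro: trig.intros)
next
  case (trig_cos j)
  have l: "((\<lambda>x :: real ^ 'n. 2 * pi * x $ j) has_derivative (\<lambda>h. 2 * pi * h $ j)) (at x)" for x
    by (intro has_derivative_mult_right bounded_linear_imp_has_derivative bounded_linear_vec_nth)
  have d: "((\<lambda>x :: real ^ 'n. cos (2 * pi * x $ j)) has_derivative (\<lambda>h. - (2 * pi) * sin (2 * pi * x $ j) * h $ j)) (at x)" for x
    by (rule has_derivative_eq_rhs[OF has_derivative_cos[OF l]]) (simp add: fun_eq_iff)
  have "partial i (\<lambda>x :: real ^ 'n. cos (2 * pi * x $ j)) = (\<lambda>x. (- (2 * pi) * axis i 1 $ j) * sin (2 * pi * x $ j))" for i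
    by (rule ext) (simp add: partial_eqI[OF d])
  moreover have "cos (2 * pi * (x $ j + k $ j)) = cos (2 * pi * x $ j)" if k: "\<forall>i. k $ i \<in> \<int>" for x k :: "real ^ 'n"
  proof -
    obtain l :: int where "k $ j = of_int l" using spec[OF k, of j] by (rule Ints_cases)
    then show ?thesis by (simp add: distrib_left cos_add cos_int_2pin sin_int_2pin)
  qed
  moreover have "(\<lambda>x :: real ^ 'n. (- (2 * pi) * axis i 1 $ j) * sin (2 * pi * x $ j)) \<in> trig" for i
    by (intro trig.intros)
  ultimately show ?case using differentiableI[OF d] by (simp add: periodic_def)
next
  case (trig_sin j)
  have l: "((\<lambda>x :: real ^ 'n. 2 * pi * x $ j) has_derivative (\<lambda>h. 2 * pi * h $ j)) (at x)" for x
    by (intro has_derivative_mult_right bounded_linear_imp_has_derivative bounded_linear_vec_nth)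
  have d: "((\<lambda>x :: real ^ 'n. sin (2 * pi * x $ j)) has_derivative (\<lambda>h. (2 * pi) * cos (2 * pi * x $ j) * h $ j)) (at x)" for x
    by (rule has_derivative_eq_rhs[OF has_derivative_sin[OF l]]) (simp add: fun_eq_iff)
  have "partial i (\<lambda>x :: real ^ 'n. sin (2 * pi * x $ j)) = (\<lambda>x. ((2 * pi) * axis i 1 $ j) * cos (2 * pi * x $ j))" for i
    by (rule ext) (simp add: partial_eqI[OF d])
  moreover have "sin (2 * pi * (x $ j + k $ j)) = sin (2 * pi * x $ j)" if k: "\<forall>i. k $ i \<in> \<int>" for x k :: "real ^ 'n"
  proof -
    obtain l :: int where "k $ j = of_int l" using spec[OF k, of j] by (rule Ints_cases)
    then show ?thesis by (simp add: distrib_left sin_add cos_int_2pin sin_int_2pin)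
  qed
  moreover have "(\<lambda>x :: real ^ 'n. ((2 * pi) * axis i 1 $ j) * cos (2 * pi * x $ j)) \<in> trig" for i
    by (intro trig.intros)
  ultimately show ?case using differentiableI[OF d] by (simp add: periodic_def)
next
  case (trig_add a b)
  then have d: "((\<lambda>x. a x + b x) has_derivative (\<lambda>h. gradient a x \<bullet> h + gradient b x \<bullet> h)) (at x)" for x
    by (intro has_derivative_add has_derivative_gradient) auto
  have "partial i (\<lambda>x. a x + b x) = (\<lambda>x. partial i a x + partial i b x)" for i
    by (rule ext) (simp add: partial_eqI[OF d] inner_axis partial_nth)
  with trig_add show ?case using differentiableI[OF d]
    by (simp add: periodic_def trig.trig_add)
next
  case (trig_mult a b)
  then have d: "((\<lambda>x. a x * b x) has_derivative (\<lambda>h. a x * (gradient b x \<bullet> h) + (gradient a x \<bullet> h) * b x)) (at x)" for x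
    by (intro has_derivative_mult has_derivative_gradient) auto
  have "partial i (\<lambda>x. a x * b x) = (\<lambda>x. a x * partial i b x + partial i a x * b x)" for i
    by (rule ext) (simp add: partial_eqI[OF d] inner_axis partial_nth)
  with trig_mult show ?case using differentiableI[OF d]
    by (simp add: periodic_def trig.trig_add trig.trig_mult)
qed

lemma trig_smooth_periodic: "\<psi> \<in> trig \<Longrightarrow> smooth_periodic \<psi>"
proof -
  assume "\<psi> \<in> trig"
  then have "foldr partial js \<psi> \<in> trig" for js
    by (induction js) (auto simp: trig_periodic_partial)
  then show ?thesis
    using \<open>\<psi> \<in> trig\<close> by (auto simp: smooth_periodic_def trig_periodic_partial)
qed

lemmas trig_continuous = smooth_periodicD(4)[OF trig_smooth_periodic]

text \<open>Degenerate kernels: statements about integrating against them are linear in the products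
  a(x) b(y), for which the variables separate.\<close>

inductive_set sep :: "(real ^ 'n \<Rightarrow> real ^ 'n \<Rightarrow> real) set" where
  sep_prod: "a \<in> trig \<Longrightarrow> b \<in> trig \<Longrightarrow> (\<lambda>x y. a x * b y) \<in> sep"
| sep_add: "P \<in> sep \<Longrightarrow> Q \<in> sep \<Longrightarrow> (\<lambda>x y. P x y + Q x y) \<in> sep"

lemma sep_mult:
  assumes "P \<in> sep" "Q \<in> sep"
  shows "(\<lambda>x y. P x y * Q x y) \<in> sep"
  using assms(1)
proof (induction rule: sep.induct)
  case (sep_prod a b)
  show ?case using assms(2)
  proof (induction rule: sep.induct)
    case (sep_prod c d)
    have "(\<lambda>x y. (a x * c x) * (b y * d y)) \<in> sep"
      by (intro sep.intros trig_mult sep_prod \<open>a \<in> trig\<close> \<open>b \<in> trig\<close>)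
    then show ?case by (simp add: mult_ac)
  qed (simp add: distrib_left sep.intros)
qed (simp add: distrib_right sep.intros)

text \<open>The addition theorems for sine and cosine separate x from y; sums and products are
  inherited.\<close>

lemma trig_diff_sep:
  fixes \<kappa> :: "real ^ 'n \<Rightarrow> real"
  shows "\<kappa> \<in> trig \<Longrightarrow> (\<lambda>x y. \<kappa> (x - y)) \<in> sep"
proof (induction rule: trig.induct)
  case (trig_const c)
  show ?case using sep_prod[OF trig.trig_const[of c] trig.trig_const[of 1]] by simp
next
  case (trig_cos i)
  have "(\<lambda>x y :: real ^ 'n. cos (2 * pi * x $ i) * cos (2 * pi * y $ i) + sin (2 * pi * x $ i) * sin (2 * pi * y $ i)) \<in> sep"
    by (intro sep.intros trig.intros)
  then show ?case by (simp add: right_diff_distrib cos_diff)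
next
  case (trig_sin i)
  have "(\<lambda>x y :: real ^ 'n. sin (2 * pi * x $ i) * cos (2 * pi * y $ i) + cos (2 * pi * x $ i) * (-1 * sin (2 * pi * y $ i))) \<in> sep"
    by (intro sep.intros trig.intros)
  then show ?case by (simp add: right_diff_distrib sin_diff)
qed (auto intro: sep.intros sep_mult)

lemma sep_section1: "P \<in> sep \<Longrightarrow> (\<lambda>x. P x y) \<in> trig"
  by (induction rule: sep.induct) (auto intro: trig.intros)

lemma sep_section2: "P \<in> sep \<Longrightarrow> P x \<in> trig"
  by (induction rule: sep.induct) (auto intro: trig.intros)

section \<open>Integration against separable kernels\<close>

lemma torus_integrable_mult_continuous:
  fixes v g :: "real ^ 'n \<Rightarrow> real"
  assumes "integrable torus v" "continuous_on UNIV g"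
  shows "integrable torus (\<lambda>y. v y * g y)"
proof -
  obtain B where B: "\<And>y. y \<in> cbox 0 One \<Longrightarrow> \<bar>g y\<bar> \<le> B"
    using continuous_bounded_on_cube[OF assms(2)] by metis
  show ?thesis
  proof (rule Bochner_Integration.integrable_bound)
    show "integrable torus (\<lambda>y. B * \<bar>v y\<bar>)" using assms by simp
    show "(\<lambda>y. v y * g y) \<in> borel_measurable torus"
      using assms continuous_torus_measurable by (intro borel_measurable_times) auto
    show "AE y in torus. norm (v y * g y) \<le> norm (B * \<bar>v y\<bar>)"
    proof (rule AE_I2)
      fix y :: "real ^ 'n" assume "y \<in> space torus"
      then have "\<bar>g y\<bar> \<le> B" using B by simp
      then have "\<bar>v y\<bar> * \<bar>g y\<bar> \<le> \<bar>v y\<bar> * \<bar>B\<bar>" by (intro mult_left_mono) auto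
      then show "norm (v y * g y) \<le> norm (B * \<bar>v y\<bar>)" by (simp add: abs_mult mult.commute)
    qed
  qed
qed

lemma sep_integrable:
  assumes "P \<in> sep" "integrable torus v"
  shows "integrable torus (\<lambda>y. v y * P x y)"
  by (intro torus_integrable_mult_continuous assms trig_continuous sep_section2)

text \<open>For a product a(x) b(y) the integral is a constant times a(x), so differentiation under
  the integral and Fubini hold for every integrable v by linearity alone. The five claims share one
  induction because the step for a sum needs several of them at once.\<close>

lemma sep_integral_trig:
  fixes v :: "real ^ 'n \<Rightarrow> real"
  assumes "P \<in> sep" and v: "integrable torus v"
  shows "(\<lambda>x. LINT y|torus. v y * P x y) \<in> trig"
    and "integrable torus (\<lambda>y. v y * partial i (\<lambda>x. P x y) x)"
    and "partial i (\<lambda>x. LINT y|torus. v y * P x y) x = (LINT y|torus. v y * partial i (\<lambda>x. P x y) x)"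
    and "(LINT x|torus. LINT y|torus. v y * P x y) = (LINT y|torus. v y * (LINT x|torus. P x y))"
    and "integrable torus (\<lambda>y. v y * (LINT x|torus. P x y))"
  using assms(1)
proof (induction arbitrary: x rule: sep.inducts)
  case (sep_prod a b)
  have int: "integrable torus (\<lambda>y. v y * b y)"
    using sep_prod v by (intro torus_integrable_mult_continuous trig_continuous)
  have eq: "(\<lambda>x. LINT y|torus. v y * (a x * b y)) = (\<lambda>x. (LINT y|torus. v y * b y) * a x)"
    using int by (simp add: mult.left_commute mult.commute)
  have pa: "partial i (\<lambda>x. c * a x) x = c * partial i a x" for c x
  proof -
    have "((\<lambda>x. c * a x) has_derivative (\<lambda>h. c * (gradient a x \<bullet> h))) (at x)"
      using sep_prod by (intro has_derivative_mult_right has_derivative_gradient) (auto simp: trig_periodic_partial)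
    from partial_eqI[OF this, of i] show ?thesis by (simp add: inner_axis partial_nth)
  qed
  have pa': "partial i (\<lambda>x. a x * c) x = c * partial i a x" for c x
    using pa[of c x] by (simp add: mult.commute)
  have eq2: "(\<lambda>y. v y * partial i (\<lambda>x. a x * b y) x) = (\<lambda>y. partial i a x * (v y * b y))" for x
    by (rule ext) (simp add: pa')
  have eq3: "(\<lambda>y. v y * (LINT x|torus. a x * b y)) = (\<lambda>y. (LINT x|torus. a x) * (v y * b y))"
    by (rule ext) simp
  {
    case 1 show ?case unfolding eq by (intro trig.intros sep_prod)
  next
    case 2 then show ?case unfolding eq2 using int by simp
  next
    case 3 then show ?case unfolding eq eq2 pa by simp
  next
    case 4 then show ?case unfolding eq eq3 by simp
  next
    case 5 then show ?case unfolding eq3 using int by simp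
  }
next
  case (sep_add P Q)
  note iP = sep_integrable[OF sep_add(1) v] and iQ = sep_integrable[OF sep_add(2) v]
  note IH = sep_add(3-)
  have eq: "(\<lambda>x. LINT y|torus. v y * (P x y + Q x y)) = (\<lambda>x. (LINT y|torus. v y * P x y) + (LINT y|torus. v y * Q x y))"
    using iP iQ by (simp add: distrib_left)
  have dP: "(\<lambda>x. P x y) differentiable (at x)" "(\<lambda>x. Q x y) differentiable (at x)" for x y
    using sep_section1[OF sep_add(1)] sep_section1[OF sep_add(2)] trig_periodic_partial by blast+
  have padd: "partial i (\<lambda>x. a x + b x) x = partial i a x + partial i b x"
    if "a differentiable (at x)" "b differentiable (at x)" for a b :: "real ^ 'n \<Rightarrow> real" and x
  proof -
    have "((\<lambda>x. a x + b x) has_derivative (\<lambda>h. gradient a x \<bullet> h + gradient b x \<bullet> h)) (at x)"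
      using that by (intro has_derivative_add has_derivative_gradient)
    from partial_eqI[OF this, of i] show ?thesis by (simp add: inner_axis partial_nth)
  qed
  have cont1: "integrable torus (\<lambda>x. P x y)" "integrable torus (\<lambda>x. Q x y)" for y
    by (intro torus_continuous trig_continuous sep_section1 sep_add)+
  {
    case 1 show ?case unfolding eq using IH by (intro trig.intros) auto
  next
    case 2 show ?case using IH by (simp add: padd dP distrib_left)
  next
    case 3
    have "(\<lambda>x. LINT y|torus. v y * P x y) differentiable (at x)" "(\<lambda>x. LINT y|torus. v y * Q x y) differentiable (at x)"
      using IH trig_periodic_partial by blast+
    then show ?case using IH unfolding eq by (simp add: padd dP distrib_left)
  next
    case 4
    have "integrable torus (\<lambda>x. LINT y|torus. v y * P x y)" "integrable torus (\<lambda>x. LINT y|torus. v y * Q x y)"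
      using IH by (auto intro: torus_continuous trig_continuous)
    then show ?case using IH unfolding eq by (simp add: distrib_left cont1)
  next
    case 5 then show ?case using IH by (simp add: distrib_left cont1)
  }
qed

section \<open>Kernels concentrating at the lattice points\<close>

definition bump :: "real ^ 'n \<Rightarrow> real" where
  "bump z = (\<Prod>i\<in>UNIV. (1 + cos (2 * pi * z $ i)) / 2)"

lemma bump_factor:
  fixes t :: real
  shows "0 \<le> (1 + cos t) / 2" "(1 + cos t) / 2 \<le> 1"
proof -
  show "0 \<le> (1 + cos t) / 2" using cos_ge_minus_one[of t] by argo
  show "(1 + cos t) / 2 \<le> 1" using cos_le_one[of t] by argo
qed

lemma bump_bounds: "0 \<le> bump z" "bump z \<le> 1"
  unfolding bump_def using bump_factor by (auto intro!: prod_nonneg prod_le_1)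

lemma bump_0 [simp]: "bump 0 = 1"
  by (simp add: bump_def)

lemma bump_minus [simp]: "bump (- z) = bump z"
  by (simp add: bump_def)

text \<open>Each factor is cos^2(pi z_i), which equals 1 only at integers, and |z_i| < 1 leaves 0 as
  the only integer. Powers of \<open>bump\<close> therefore concentrate at 0 within this
  range.\<close>

lemma bump_less_1:
  assumes "\<And>i. \<bar>z $ i\<bar> < 1" "z \<noteq> 0"
  shows "bump z < 1"
proof -
  obtain j where j: "z $ j \<noteq> 0" using assms(2) by (auto simp: vec_eq_iff)
  have "cos (2 * pi * z $ j) \<noteq> 1"
  proof
    assume "cos (2 * pi * z $ j) = 1"
    then obtain k :: int where "2 * pi * z $ j = of_int k * 2 * pi"
      using cos_one_2pi_int by auto
    then have "z $ j = of_int k" by simp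
    with assms(1)[of j] j show False by (simp add: of_int_eq_0_iff)
  qed
  then have "(1 + cos (2 * pi * z $ j)) / 2 < 1"
    using order.not_eq_order_implies_strict[OF _ cos_le_one[of "2 * pi * z $ j"]] by simp
  moreover have "bump z = (1 + cos (2 * pi * z $ j)) / 2 * (\<Prod>i\<in>UNIV - {j}. (1 + cos (2 * pi * z $ i)) / 2)"
    unfolding bump_def by (rule prod.remove) auto
  moreover have "\<dots> \<le> (1 + cos (2 * pi * z $ j)) / 2 * 1"
    using bump_factor by (intro mult_left_mono prod_le_1) auto
  ultimately show ?thesis by linarith
qed

lemma bump_power_trig: "(\<lambda>z :: real ^ 'n. c * bump z ^ n) \<in> trig"
proof -
  have "(\<lambda>z :: real ^ 'n. \<Prod>i\<in>S. (1 + cos (2 * pi * z $ i)) / 2) \<in> trig" if "finite S" for S :: "'n set"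
    using that
  proof (induction S rule: finite_induct)
    case (insert i S)
    have "(\<lambda>z :: real ^ 'n. (1 / 2) * (1 + cos (2 * pi * z $ i)) * (\<Prod>i\<in>S. (1 + cos (2 * pi * z $ i)) / 2)) \<in> trig"
      by (intro trig.intros insert.IH)
    then show ?case using insert by simp
  qed (simp add: trig.intros)
  then have b: "(\<lambda>z :: real ^ 'n. bump z) \<in> trig" by (simp add: bump_def)
  have "(\<lambda>z :: real ^ 'n. bump z ^ n) \<in> trig"
    by (induction n) (auto intro: trig.intros b)
  then show ?thesis by (intro trig.intros)
qed

lemma bump_continuous: "continuous_on UNIV (bump :: real ^ 'n \<Rightarrow> real)"
  using trig_continuous[OF bump_power_trig[of 1 1]] by simp

text \<open>The value is a bare real and does not determine the dimension, so the index type is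
  passed as an argument.\<close>

definition kernel_mass :: "'n :: finite itself \<Rightarrow> nat \<Rightarrow> real" where
  "kernel_mass _ n = (LINT z|torus. bump (z :: real ^ 'n) ^ n)"

definition kernel :: "nat \<Rightarrow> real ^ 'n \<Rightarrow> real" where
  "kernel n z = 1 / kernel_mass TYPE('n) n * bump z ^ n"

lemma kernel_trig: "kernel n \<in> trig"
  unfolding kernel_def by (rule bump_power_trig)

lemma kernel_mass_shift:
  "(LINT y|torus. bump (x - y :: real ^ 'n) ^ n) = kernel_mass TYPE('n) n"
proof -
  have "bump (x - y) = bump (y + - x)" for y using bump_minus[of "x - y"] by simp
  then show ?thesis
    using torus_translation[of "\<lambda>z. 1 * bump (z :: real ^ 'n) ^ n" "- x"] bump_power_trig[of 1 n]
      trig_continuous trig_periodic_partial by (fastforce simp: kernel_mass_def)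
qed

text \<open>\<open>bump\<close> exceeds \<theta> on a small ball inside the cube, and \<beta> is the
  volume of that ball. So the normalising mass decays no faster than any geometric rate below 1,
  while away from the peak the powers decay at a fixed rate.\<close>

lemma kernel_mass_lower:
  fixes x :: "real ^ 'n"
  assumes x: "x \<in> box 0 One" and \<theta>: "0 \<le> \<theta>" "\<theta> < 1"
  obtains \<beta> where "\<beta> > 0" "\<And>n. \<theta> ^ n * \<beta> \<le> kernel_mass TYPE('n) n"
proof -
  have cb: "continuous_on UNIV (\<lambda>y. bump (x - y))"
    by (intro continuous_on_compose2[OF bump_continuous] continuous_intros) auto
  define U where "U = {y. bump (x - y) > \<theta>} \<inter> box 0 One"
  have "open U" unfolding U_def by (intro open_Int open_Collect_less cb continuous_intros open_box)
  moreover have "x \<in> U" using x \<theta> by (simp add: U_def)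
  ultimately obtain d where d: "d > 0" "cball x d \<subseteq> U" using open_contains_cball by metis
  have sub: "cball x d \<subseteq> cbox 0 One" using d(2) box_subset_cbox by (fastforce simp: U_def)
  have ms: "cball x d \<in> sets torus" unfolding torus_def
    using sub by (auto simp: sets_restrict_space intro!: image_eqI[of _ _ "cball x d"])
  define \<beta> where "\<beta> = measure torus (cball x d)"
  have "\<beta> = measure lebesgue (cball x d)"
    unfolding \<beta>_def torus_def using sub by (intro measure_restrict_space) auto
  then have "\<beta> > 0" using content_cball_pos[OF d(1), of x] by simp
  moreover have "\<theta> ^ n * \<beta> \<le> kernel_mass TYPE('n) n" for n
  proof -
    have "\<theta> ^ n * \<beta> = (LINT y|torus. \<theta> ^ n * indicator (cball x d) y)"
      using ms sub by (simp add: \<beta>_def Int_absorb2)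
    also have "\<dots> \<le> (LINT y|torus. bump (x - y) ^ n)"
    proof (rule integral_mono)
      show "integrable torus (\<lambda>y. \<theta> ^ n * indicator (cball x d) y)"
        using ms by (intro integrable_mult_right integrable_real_indicator) (auto simp: torus.emeasure_finite less_top[symmetric])
      show "integrable torus (\<lambda>y. bump (x - y) ^ n)"
        by (intro torus_continuous continuous_intros cb)
      fix y show "\<theta> ^ n * indicator (cball x d) y \<le> bump (x - y) ^ n"
      proof (cases "y \<in> cball x d")
        case True
        then have "\<theta> \<le> bump (x - y)" using d(2) by (auto simp: U_def subset_iff)
        then show ?thesis using True \<theta> by (simp add: power_mono)
      qed (use bump_bounds[of "x - y"] in auto)
    qed
    also have "\<dots> = kernel_mass TYPE('n) n" by (rule kernel_mass_shift)
    finally show ?thesis .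
  qed
  ultimately show ?thesis using that by blast
qed

lemma half_in_box: "((\<chi> i. 1/2) :: real ^ 'n) \<in> box 0 One"
  by (simp only: mem_box_cart One_nth) simp

lemma kernel_mass_pos: "kernel_mass TYPE('n :: finite) n > 0"
proof -
  obtain \<beta> where "\<beta> > 0" "\<And>n. (1/2 :: real) ^ n * \<beta> \<le> kernel_mass TYPE('n) n"
    by (rule kernel_mass_lower[OF half_in_box, of "1/2"]) auto
  then have "0 < (1/2) ^ n * \<beta>" "(1/2) ^ n * \<beta> \<le> kernel_mass TYPE('n) n" by auto
  then show ?thesis by linarith
qed

lemma kernel_nonneg: "kernel n (z :: real ^ 'n) \<ge> 0"
  using kernel_mass_pos[where 'n = 'n, of n] bump_bounds(1)[of z] unfolding kernel_def by (intro mult_nonneg_nonneg zero_le_power) auto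

lemma kernel_sep: "(\<lambda>x y. kernel n (x - y)) \<in> sep"
  by (rule trig_diff_sep[OF kernel_trig])

lemma kernel_integral:
  fixes x :: "real ^ 'n"
  shows "(LINT y|torus. kernel n (x - y)) = 1" "(LINT y|torus. kernel n (y - x)) = 1"
    "integrable torus (\<lambda>y. kernel n (x - y))"
proof -
  show "(LINT y|torus. kernel n (x - y)) = 1"
    using kernel_mass_pos[where 'n = 'n, of n] by (simp add: kernel_def kernel_mass_shift)
  moreover have "kernel n (y - x) = kernel n (x - y)" for y
    using bump_minus[of "x - y"] by (simp add: kernel_def)
  ultimately show "(LINT y|torus. kernel n (y - x)) = 1" by simp
  show "integrable torus (\<lambda>y. kernel n (x - y))"
    by (intro torus_continuous trig_continuous sep_section2 kernel_sep)
qed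

definition mollify :: "nat \<Rightarrow> (real ^ 'n \<Rightarrow> real) \<Rightarrow> real ^ 'n \<Rightarrow> real" where
  "mollify n v x = (LINT y|torus. v y * kernel n (x - y))"

lemma mollify_trig: "integrable torus v \<Longrightarrow> mollify n v \<in> trig"
  unfolding mollify_def by (rule sep_integral_trig(1)[OF kernel_sep])

lemma mollify_diff:
  assumes "integrable torus v" "integrable torus w"
  shows "mollify n (\<lambda>y. v y - w y) x = mollify n v x - mollify n w x"
  unfolding mollify_def using sep_integrable[OF kernel_sep assms(1)] sep_integrable[OF kernel_sep assms(2)]
  by (simp add: left_diff_distrib)

lemma mollify_bound:
  fixes g :: "real ^ 'n \<Rightarrow> real"
  assumes "integrable torus g" "\<And>y. y \<in> cbox 0 One \<Longrightarrow> \<bar>g y\<bar> \<le> B"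
  shows "\<bar>mollify n g x\<bar> \<le> B"
proof -
  have "\<bar>mollify n g x\<bar> \<le> (LINT y|torus. \<bar>g y * kernel n (x - y)\<bar>)"
    unfolding mollify_def by (rule integral_abs_bound)
  also have "\<dots> \<le> (LINT y|torus. B * kernel n (x - y))"
    using assms kernel_nonneg kernel_integral(3)
    by (intro integral_mono integrable_abs sep_integrable[OF kernel_sep] integrable_mult_right)
      (auto simp: abs_mult abs_of_nonneg[OF kernel_nonneg] intro!: mult_right_mono)
  also have "\<dots> = B" using kernel_integral(1)[of n x] by simp
  finally show ?thesis .
qed

text \<open>For x in the open cube and y in the closed one, all entries of x - y lie in (-1,1), so
  the kernel has no second peak in the cube. The integral splits into a ball around x, where g is
  almost g x, and its complement, where the kernel tends to 0 uniformly.\<close>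

lemma mollify_tendsto:
  fixes g :: "real ^ 'n \<Rightarrow> real"
  assumes g: "continuous_on UNIV g" and x: "x \<in> box 0 One"
  shows "(\<lambda>n. mollify n g x) \<longlonglongrightarrow> g x"
proof (rule LIMSEQ_I)
  fix e :: real assume e: "e > 0"
  have x': "x \<in> cbox 0 One" using x box_subset_cbox by blast
  obtain B where B: "\<And>y. y \<in> cbox 0 One \<Longrightarrow> \<bar>g y\<bar> \<le> B"
    using continuous_bounded_on_cube[OF g] by metis
  have Bnn: "B \<ge> 0" using B[OF x'] by linarith
  obtain d where d: "d > 0" "\<And>y. dist y x < d \<Longrightarrow> \<bar>g y - g x\<bar> < e / 2"
    using g e unfolding continuous_on_iff dist_real_def by (metis UNIV_I half_gt_zero)
  have cb: "continuous_on UNIV (\<lambda>y. bump (x - y))"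
    by (intro continuous_on_compose2[OF bump_continuous] continuous_intros) auto
  define A where "A = cbox 0 One - ball x d"
  have "compact A" unfolding A_def by (intro compact_diff) auto
  have ltA: "bump (x - y) < 1" if "y \<in> A" for y
  proof (rule bump_less_1)
    show "x - y \<noteq> 0" using that d(1) by (auto simp: A_def)
    fix i
    have "0 < x $ i" "x $ i < 1" using x by (auto simp only: mem_box_cart One_nth zero_index)
    moreover have "0 \<le> y $ i" "y $ i \<le> 1" using that by (auto simp only: A_def Diff_iff mem_box_cart One_nth zero_index)
    ultimately show "\<bar>(x - y) $ i\<bar> < 1" by simp
  qed
  \<comment> \<open>The largest value of the bump away from x, below 1 by compactness; 0 serves if
    the ball covers the cube.\<close>
  obtain \<theta> where \<theta>: "0 \<le> \<theta>" "\<theta> < 1" "\<And>y. y \<in> A \<Longrightarrow> bump (x - y) \<le> \<theta>"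
  proof (cases "A = {}")
    case False
    obtain y where "y \<in> A" "\<And>z. z \<in> A \<Longrightarrow> bump (x - z) \<le> bump (x - y)"
      using continuous_attains_sup[OF \<open>compact A\<close> False, of "\<lambda>y. bump (x - y)"] cb continuous_on_subset by blast
    then show ?thesis using that ltA bump_bounds by blast
  qed (use that[of 0] in auto)
  \<comment> \<open>A number strictly between \<theta> and 1: the mass is at least of order
    \<rho>^n, so the kernel off the ball is of order (\<theta>/\<rho>)^n.\<close>
  define \<rho> where "\<rho> = (1 + \<theta>) / 2"
  have \<rho>: "0 < \<rho>" "\<rho> < 1" "\<theta> < \<rho>" using \<theta> by (auto simp: \<rho>_def)
  obtain \<beta> where \<beta>: "\<beta> > 0" "\<And>n. \<rho> ^ n * \<beta> \<le> kernel_mass TYPE('n) n"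
    using kernel_mass_lower[OF x, of \<rho>] \<rho> by auto
  have main: "\<bar>mollify n g x - g x\<bar> \<le> e / 2 + 2 * B / \<beta> * (\<theta> / \<rho>) ^ n" for n
  proof -
    define Z where "Z = kernel_mass TYPE('n) n"
    have Z: "Z > 0" unfolding Z_def by (rule kernel_mass_pos)
    have "mollify n g x - g x = (LINT y|torus. (g y - g x) * kernel n (x - y))"
      using sep_integrable[OF kernel_sep torus_continuous(1)[OF g]] kernel_integral[of n x]
      by (simp add: mollify_def left_diff_distrib)
    also have "\<bar>\<dots>\<bar> \<le> (LINT y|torus. \<bar>(g y - g x) * kernel n (x - y)\<bar>)" by (rule integral_abs_bound)
    also have "\<dots> \<le> (LINT y|torus. e / 2 * kernel n (x - y) + 2 * B * (\<theta> ^ n / Z))"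
    proof (rule integral_mono)
      show "integrable torus (\<lambda>y. \<bar>(g y - g x) * kernel n (x - y)\<bar>)"
        using g by (intro integrable_abs sep_integrable[OF kernel_sep] torus_continuous continuous_intros)
      show "integrable torus (\<lambda>y. e / 2 * kernel n (x - y) + 2 * B * (\<theta> ^ n / Z))"
        by (intro Bochner_Integration.integrable_add integrable_mult_right kernel_integral torus_continuous continuous_intros)
      fix y :: "real ^ 'n" assume y: "y \<in> space torus"
      show "\<bar>(g y - g x) * kernel n (x - y)\<bar> \<le> e / 2 * kernel n (x - y) + 2 * B * (\<theta> ^ n / Z)"
      proof (cases "y \<in> A")
        case False
        then have "dist y x < d" using y by (simp add: A_def dist_commute)
        then have "\<bar>g y - g x\<bar> * kernel n (x - y) \<le> e / 2 * kernel n (x - y)"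
          using d(2)[of y] kernel_nonneg by (intro mult_right_mono) auto
        moreover have "0 \<le> 2 * B * (\<theta> ^ n / Z)" using Bnn \<theta> Z by simp
        ultimately show ?thesis using kernel_nonneg[of n "x - y"] unfolding abs_mult by simp
      next
        case True
        have "\<bar>g y - g x\<bar> \<le> 2 * B" using B[of y] B[OF x'] y by simp
        moreover have "bump (x - y) ^ n \<le> \<theta> ^ n" using \<theta>(3)[OF True] bump_bounds by (intro power_mono) auto
        then have "kernel n (x - y) \<le> \<theta> ^ n / Z" using Z by (simp add: kernel_def Z_def divide_right_mono)
        ultimately have "\<bar>g y - g x\<bar> * kernel n (x - y) \<le> 2 * B * (\<theta> ^ n / Z)"
          using kernel_nonneg Bnn by (intro mult_mono) auto
        moreover have "0 \<le> e / 2 * kernel n (x - y)" using e kernel_nonneg by (intro mult_nonneg_nonneg) auto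
        ultimately show ?thesis using kernel_nonneg[of n "x - y"] unfolding abs_mult by simp
      qed
    qed
    also have "\<dots> = e / 2 + 2 * B * (\<theta> ^ n / Z)"
      using kernel_integral[of n x] by simp
    also have "\<dots> \<le> e / 2 + 2 * B * (\<theta> ^ n / (\<rho> ^ n * \<beta>))"
      using \<beta>(1) \<beta>(2)[of n] Z \<rho> \<theta> Bnn
      by (intro add_left_mono mult_left_mono divide_left_mono) (auto simp: Z_def)
    also have "\<dots> = e / 2 + 2 * B / \<beta> * (\<theta> / \<rho>) ^ n" by (simp add: power_divide)
    finally show ?thesis .
  qed
  have "(\<lambda>n. 2 * B / \<beta> * (\<theta> / \<rho>) ^ n) \<longlonglongrightarrow> 2 * B / \<beta> * 0"
    using \<theta> \<rho> by (intro tendsto_intros LIMSEQ_power_zero) auto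
  then have "eventually (\<lambda>n. 2 * B / \<beta> * (\<theta> / \<rho>) ^ n < e / 2) sequentially"
    using e by (intro order_tendstoD(2)) auto
  then obtain M where M: "\<And>n. n \<ge> M \<Longrightarrow> 2 * B / \<beta> * (\<theta> / \<rho>) ^ n < e / 2"
    unfolding eventually_sequentially by blast
  show "\<exists>M. \<forall>n\<ge>M. norm (mollify n g x - g x) < e"
  proof (intro exI allI impI)
    fix n assume "n \<ge> M"
    then show "norm (mollify n g x - g x) < e" using main[of n] M[of n] by simp
  qed
qed

section \<open>Mollification in the Lebesgue spaces\<close>

lemma AE_torus_box: "AE x in torus. x \<in> box 0 (One :: real ^ 'n)"
proof -
  have "cbox 0 (One :: real ^ 'n) - box 0 One \<in> null_sets lebesgue"
    using null_sets_cbox_Diff_box null_sets_completionI by blast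
  then have "AE x in lebesgue. x \<in> cbox 0 (One :: real ^ 'n) \<longrightarrow> x \<in> box 0 One"
    by (rule AE_I') auto
  then show ?thesis unfolding torus_def by (subst AE_restrict_space_iff) auto
qed

lemma powr_integrable_imp_integrable:
  fixes v :: "'a \<Rightarrow> 'b :: {banach, second_countable_topology}"
  assumes "finite_measure M" "v \<in> borel_measurable M" "integrable M (\<lambda>x. norm (v x) powr s)" "s \<ge> 1"
  shows "integrable M v"
proof (rule Bochner_Integration.integrable_bound)
  interpret finite_measure M by (rule assms(1))
  show "integrable M (\<lambda>x. 1 + norm (v x) powr s)" using assms by simp
  have "norm (v x) \<le> 1 + norm (v x) powr s" for x
    using powr_mono[of 1 s "norm (v x)"] assms(4) by (cases "norm (v x) \<le> 1") (auto simp: add_increasing2)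
  then show "AE x in M. norm (v x) \<le> norm (1 + norm (v x) powr s)"
    by (intro AE_I2) (smt (verit) real_norm_def)
qed (rule assms)

text \<open>Jensen with the probability density \<open>kernel n (x - y)\<close> in y, then Fubini
  and unit mass in x.\<close>

lemma mollify_Lp_contraction:
  fixes v :: "real ^ 'n \<Rightarrow> real"
  assumes s: "s \<ge> 1" and v: "v \<in> borel_measurable torus" "integrable torus (\<lambda>x. \<bar>v x\<bar> powr s)"
  shows "(LINT x|torus. \<bar>mollify n v x\<bar> powr s) \<le> (LINT x|torus. \<bar>v x\<bar> powr s)"
    and "integrable torus (\<lambda>x. \<bar>mollify n v x\<bar> powr s)"
proof -
  have int: "integrable torus v"
    using powr_integrable_imp_integrable[OF finite_measure_torus v(1) _ s] v(2) by simp
  note S = sep_integral_trig[OF kernel_sep v(2)]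
  show i: "integrable torus (\<lambda>x. \<bar>mollify n v x\<bar> powr s)"
    using s by (intro torus_continuous continuous_intros continuous_on_powr' trig_continuous mollify_trig int) auto
  have "(LINT x|torus. \<bar>mollify n v x\<bar> powr s) \<le> (LINT x|torus. LINT y|torus. \<bar>v y\<bar> powr s * kernel n (x - y))"
  proof (rule integral_mono[OF i])
    show "integrable torus (\<lambda>x. LINT y|torus. \<bar>v y\<bar> powr s * kernel n (x - y))"
      by (intro torus_continuous trig_continuous S(1))
    fix x :: "real ^ 'n"
    show "\<bar>mollify n v x\<bar> powr s \<le> (LINT y|torus. \<bar>v y\<bar> powr s * kernel n (x - y))"
      unfolding mollify_def
      by (rule weighted_jensen[OF s _ kernel_integral(3,1)])
        (auto simp: kernel_nonneg intro!: sep_integrable[OF kernel_sep] v int)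
  qed
  also have "\<dots> = (LINT x|torus. \<bar>v x\<bar> powr s)"
    unfolding S(4) by (simp add: kernel_integral)
  finally show "(LINT x|torus. \<bar>mollify n v x\<bar> powr s) \<le> (LINT x|torus. \<bar>v x\<bar> powr s)" .
qed

definition clip :: "real \<Rightarrow> real \<Rightarrow> real" where
  "clip N t = max (- N) (min N t)"

lemma clip_bound: "N \<ge> 0 \<Longrightarrow> \<bar>clip N t\<bar> \<le> N"
  by (auto simp: clip_def)

lemma clip_diff: "N \<ge> 0 \<Longrightarrow> \<bar>clip N t - t\<bar> \<le> \<bar>t\<bar>"
  by (auto simp: clip_def)

lemma clip_eq: "\<bar>t\<bar> \<le> N \<Longrightarrow> clip N t = t"
  by (auto simp: clip_def)

lemma continuous_on_clip: "continuous_on A f \<Longrightarrow> continuous_on A (\<lambda>x. clip N (f x))"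
  unfolding clip_def by (intro continuous_intros)

text \<open>First v is truncated at a level N; then continuous functions converging to v almost
  everywhere are truncated at the same level, so that a constant dominates.\<close>

lemma Lp_dense_continuous:
  fixes v :: "real ^ 'n \<Rightarrow> real"
  assumes s: "s \<ge> 1" and v: "v \<in> borel_measurable torus" "integrable torus (\<lambda>x. \<bar>v x\<bar> powr s)" and e: "e > 0"
  obtains g where "continuous_on UNIV g" "(LINT x|torus. \<bar>v x - g x\<bar> powr s) < e"
proof -
  note [measurable] = v(1)
  define c where "c = 2 powr s"
  have c: "c > 0" by (simp add: c_def)
  have [measurable]: "(\<lambda>x. clip N (f x)) \<in> borel_measurable torus" if "f \<in> borel_measurable torus" for N and f :: "real ^ 'n \<Rightarrow> real"
    using that unfolding clip_def by measurable
  have "(\<lambda>N. LINT x|torus. \<bar>clip (real N) (v x) - v x\<bar> powr s) \<longlonglongrightarrow> (LINT x|(torus :: (real ^ 'n) measure). 0)"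
  proof (rule integral_dominated_convergence[OF _ _ v(2)])
    show "AE x in torus. (\<lambda>N. \<bar>clip (real N) (v x) - v x\<bar> powr s) \<longlonglongrightarrow> 0"
    proof (rule AE_I2)
      fix x
      have "eventually (\<lambda>N. \<bar>clip (real N) (v x) - v x\<bar> powr s = 0) sequentially"
        using eventually_ge_at_top[of "nat \<lceil>\<bar>v x\<bar>\<rceil>"]
        by eventually_elim (simp add: clip_eq nat_le_iff ceiling_le_iff)
      then show "(\<lambda>N. \<bar>clip (real N) (v x) - v x\<bar> powr s) \<longlonglongrightarrow> 0" by (rule tendsto_eventually)
    qed
    show "AE x in torus. norm (\<bar>clip (real N) (v x) - v x\<bar> powr s) \<le> \<bar>v x\<bar> powr s" for N
      using s by (auto intro!: powr_mono2 clip_diff)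
  qed measurable
  then have "eventually (\<lambda>N. (LINT x|torus. \<bar>clip (real N) (v x) - v x\<bar> powr s) < e / (2 * c)) sequentially"
    using e c by (intro order_tendstoD(2)) auto
  then obtain N where N: "(LINT x|torus. \<bar>clip (real N) (v x) - v x\<bar> powr s) < e / (2 * c)"
    by (auto simp: eventually_sequentially)
  let ?N = "real N"
  \<comment> \<open>\<open>measurable_on\<close> is defined through almost everywhere convergence of
    continuous functions, and these are the approximants wanted.\<close>
  have "v measurable_on cbox 0 One"
    using v(1) unfolding torus_def by (subst measurable_on_iff_borel_measurable) auto
  then obtain Z g where Z: "negligible Z" and g: "\<And>n. continuous_on UNIV (g n)"
    and lim: "\<And>x. x \<notin> Z \<Longrightarrow> (\<lambda>n :: nat. g n x) \<longlonglongrightarrow> (if x \<in> cbox 0 One then v x else 0)"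
    unfolding measurable_on_def by blast
  have [measurable]: "g n \<in> borel_measurable torus" for n
    by (rule continuous_torus_measurable[OF g])
  have "AE x in lebesgue. x \<notin> Z"
    using Z by (intro AE_I'[of Z]) (auto simp: negligible_iff_null_sets)
  then have "AE x in torus. x \<notin> Z"
    unfolding torus_def by (subst AE_restrict_space_iff) (auto elim: eventually_mono)
  then have AElim: "AE x in torus. (\<lambda>n. g n x) \<longlonglongrightarrow> v x"
    using AE_space by eventually_elim (use lim in fastforce)
  have "(\<lambda>n. LINT x|torus. \<bar>clip ?N (v x) - clip ?N (g n x)\<bar> powr s) \<longlonglongrightarrow> (LINT x|(torus :: (real ^ 'n) measure). 0)"
  proof (rule integral_dominated_convergence[where w = "\<lambda>x. (2 * ?N) powr s"])
    show "AE x in torus. (\<lambda>n. \<bar>clip ?N (v x) - clip ?N (g n x)\<bar> powr s) \<longlonglongrightarrow> 0"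
      using AElim
    proof eventually_elim
      case (elim x)
      then have "(\<lambda>n. clip ?N (g n x)) \<longlonglongrightarrow> clip ?N (v x)"
        unfolding clip_def by (intro tendsto_intros)
      then have "(\<lambda>n. \<bar>clip ?N (v x) - clip ?N (g n x)\<bar> powr s) \<longlonglongrightarrow> \<bar>clip ?N (v x) - clip ?N (v x)\<bar> powr s"
        using s by (intro tendsto_powr' tendsto_intros) auto
      then show ?case by simp
    qed
    show "AE x in torus. norm (\<bar>clip ?N (v x) - clip ?N (g n x)\<bar> powr s) \<le> (2 * ?N) powr s" for n
    proof (rule AE_I2)
      fix x
      have "\<bar>clip ?N (v x) - clip ?N (g n x)\<bar> \<le> 2 * ?N"
        using clip_bound[of ?N "v x"] clip_bound[of ?N "g n x"] by simp
      then show "norm (\<bar>clip ?N (v x) - clip ?N (g n x)\<bar> powr s) \<le> (2 * ?N) powr s"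
        using s by (auto intro!: powr_mono2)
    qed
    show "integrable torus (\<lambda>x :: real ^ 'n. (2 * ?N) powr s)" by simp
  qed measurable
  then have "eventually (\<lambda>n. (LINT x|torus. \<bar>clip ?N (v x) - clip ?N (g n x)\<bar> powr s) < e / (2 * c)) sequentially"
    using e c by (intro order_tendstoD(2)) auto
  then obtain n where n: "(LINT x|torus. \<bar>clip ?N (v x) - clip ?N (g n x)\<bar> powr s) < e / (2 * c)"
    by (auto simp: eventually_sequentially)
  have i1: "integrable torus (\<lambda>x. \<bar>clip ?N (v x) - v x\<bar> powr s)"
    using s by (intro Bochner_Integration.integrable_bound[OF v(2)]) (auto intro!: powr_mono2 clip_diff)
  have i2: "integrable torus (\<lambda>x. \<bar>clip ?N (v x) - clip ?N (g n x)\<bar> powr s)"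
  proof (rule Bochner_Integration.integrable_bound[of _ "\<lambda>x. (2 * ?N) powr s"])
    show "AE x in torus. norm (\<bar>clip ?N (v x) - clip ?N (g n x)\<bar> powr s) \<le> norm ((2 * ?N) powr s)"
    proof (rule AE_I2)
      fix x
      have "\<bar>clip ?N (v x) - clip ?N (g n x)\<bar> \<le> 2 * ?N"
        using clip_bound[of ?N "v x"] clip_bound[of ?N "g n x"] by simp
      then show "norm (\<bar>clip ?N (v x) - clip ?N (g n x)\<bar> powr s) \<le> norm ((2 * ?N) powr s)"
        using s by (auto intro!: powr_mono2)
    qed
  qed (simp, measurable)
  have le: "\<bar>v x - clip ?N (g n x)\<bar> powr s \<le> c * (\<bar>clip ?N (v x) - v x\<bar> powr s + \<bar>clip ?N (v x) - clip ?N (g n x)\<bar> powr s)" for x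
    using norm_minus_powr_le[of s "clip ?N (v x) - clip ?N (g n x)" "clip ?N (v x) - v x"] s
    by (simp add: c_def add.commute)
  have "(LINT x|torus. \<bar>v x - clip ?N (g n x)\<bar> powr s)
    \<le> (LINT x|torus. c * (\<bar>clip ?N (v x) - v x\<bar> powr s + \<bar>clip ?N (v x) - clip ?N (g n x)\<bar> powr s))"
  proof (rule integral_mono)
    show "integrable torus (\<lambda>x. c * (\<bar>clip ?N (v x) - v x\<bar> powr s + \<bar>clip ?N (v x) - clip ?N (g n x)\<bar> powr s))"
      using i1 i2 by simp
    then show "integrable torus (\<lambda>x. \<bar>v x - clip ?N (g n x)\<bar> powr s)"
      by (rule Bochner_Integration.integrable_bound) (use order_trans[OF le abs_ge_self] in \<open>auto intro!: AE_I2\<close>)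
  qed (rule le)
  also have "\<dots> = c * ((LINT x|torus. \<bar>clip ?N (v x) - v x\<bar> powr s) + (LINT x|torus. \<bar>clip ?N (v x) - clip ?N (g n x)\<bar> powr s))"
    using i1 i2 by simp
  also have "\<dots> < c * (e / (2 * c) + e / (2 * c))"
    by (intro mult_strict_left_mono add_strict_mono N n c)
  also have "\<dots> = e" using c by (simp add: field_simps)
  finally show ?thesis
    using that[of "\<lambda>x. clip ?N (g n x)"] continuous_on_clip[OF g] by blast
qed

lemma Lp_diff_integrable:
  fixes v w :: "'a \<Rightarrow> 'b :: euclidean_space"
  assumes "s \<ge> 0" "v \<in> borel_measurable M" "w \<in> borel_measurable M"
    and int: "integrable M (\<lambda>x. norm (v x) powr s)" "integrable M (\<lambda>x. norm (w x) powr s)"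
  shows "integrable M (\<lambda>x. norm (v x - w x) powr s)"
proof (rule Bochner_Integration.integrable_bound)
  note [measurable] = assms(2,3)
  show "integrable M (\<lambda>x. 2 powr s * (norm (v x) powr s + norm (w x) powr s))" using int by simp
  show "AE x in M. norm (norm (v x - w x) powr s) \<le> norm (2 powr s * (norm (v x) powr s + norm (w x) powr s))"
    using norm_minus_powr_le[OF assms(1)] by (auto intro!: AE_I2 simp: abs_mult)
  show "(\<lambda>x. norm (v x - w x) powr s) \<in> borel_measurable M" by measurable
qed

text \<open>With g continuous and close to v, the error splits into the mollification of v - g, the
  mollification error of g, and g - v. Contraction controls the first, pointwise convergence under a
  constant bound the second.\<close>

lemma mollify_Lp_tendsto:
  fixes v :: "real ^ 'n \<Rightarrow> real"
  assumes s: "s \<ge> 1" and v: "v \<in> borel_measurable torus" "integrable torus (\<lambda>x. \<bar>v x\<bar> powr s)"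
  shows "(\<lambda>n. LINT x|torus. \<bar>mollify n v x - v x\<bar> powr s) \<longlonglongrightarrow> 0"
proof (rule LIMSEQ_I)
  fix e :: real assume e: "e > 0"
  define c where "c = 2 powr s"
  have c: "c > 0" by (simp add: c_def)
  have int: "integrable torus v"
    using powr_integrable_imp_integrable[OF finite_measure_torus v(1) _ s] v(2) by simp
  \<comment> \<open>Two uses of the quasi-triangle inequality with constant c produce c (\<epsilon>
    + 2 c \<epsilon>), and this choice keeps that at most e.\<close>
  define \<epsilon> where "\<epsilon> = e / (2 * (c + c * c))"
  have \<epsilon>: "\<epsilon> > 0" using e c by (simp add: \<epsilon>_def add_pos_pos)
  obtain g where g: "continuous_on UNIV g" and ge: "(LINT x|torus. \<bar>v x - g x\<bar> powr s) < \<epsilon>"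
    by (rule Lp_dense_continuous[OF s v \<epsilon>])
  note gi = torus_continuous(1)[OF g]
  have [measurable]: "v \<in> borel_measurable torus" "g \<in> borel_measurable torus"
    using v gi by auto
  have mc: "continuous_on UNIV (mollify n w)" if "integrable torus w" for n and w :: "real ^ 'n \<Rightarrow> real"
    by (intro trig_continuous mollify_trig that)
  then have [measurable]: "mollify n w \<in> borel_measurable torus" if "integrable torus w" for n and w :: "real ^ 'n \<Rightarrow> real"
    using that by (intro continuous_torus_measurable)
  have cp: "continuous_on UNIV (\<lambda>x. \<bar>w x\<bar> powr s)" if "continuous_on UNIV w" for w :: "real ^ 'n \<Rightarrow> real"
    using s that by (intro continuous_intros continuous_on_powr') auto
  have ivg: "integrable torus (\<lambda>x. \<bar>v x - g x\<bar> powr s)"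
    using Lp_diff_integrable[of s v torus g] s v torus_continuous(1)[OF cp[OF g]] by simp
  obtain B where B: "\<And>y. y \<in> cbox 0 One \<Longrightarrow> \<bar>g y\<bar> \<le> B"
    using continuous_bounded_on_cube[OF g] by metis
  have "(\<lambda>n. LINT x|torus. \<bar>mollify n g x - g x\<bar> powr s) \<longlonglongrightarrow> (LINT x|(torus :: (real ^ 'n) measure). 0)"
  proof (rule integral_dominated_convergence[where w = "\<lambda>x. (2 * B) powr s"])
    show "AE x in torus. (\<lambda>n. \<bar>mollify n g x - g x\<bar> powr s) \<longlonglongrightarrow> 0"
      using AE_torus_box
    proof eventually_elim
      case (elim x)
      from mollify_tendsto[OF g this] have "(\<lambda>n. \<bar>mollify n g x - g x\<bar> powr s) \<longlonglongrightarrow> \<bar>g x - g x\<bar> powr s"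
        using s by (intro tendsto_powr' tendsto_intros) auto
      then show ?case by simp
    qed
    show "AE x in torus. norm (\<bar>mollify n g x - g x\<bar> powr s) \<le> (2 * B) powr s" for n
    proof (rule AE_I2)
      fix x :: "real ^ 'n" assume "x \<in> space torus"
      then have "\<bar>mollify n g x - g x\<bar> \<le> 2 * B"
        using mollify_bound[OF gi B, of n x] B[of x] by simp
      then show "norm (\<bar>mollify n g x - g x\<bar> powr s) \<le> (2 * B) powr s"
        using s by (auto intro!: powr_mono2)
    qed
  qed (use gi in measurable)
  then have "eventually (\<lambda>n. (LINT x|torus. \<bar>mollify n g x - g x\<bar> powr s) < \<epsilon>) sequentially"
    using \<epsilon> by (intro order_tendstoD(2)) auto
  then obtain M where M: "\<And>n. n \<ge> M \<Longrightarrow> (LINT x|torus. \<bar>mollify n g x - g x\<bar> powr s) < \<epsilon>"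
    by (auto simp: eventually_sequentially)
  show "\<exists>M. \<forall>n\<ge>M. norm ((LINT x|torus. \<bar>mollify n v x - v x\<bar> powr s) - 0) < e"
  proof (intro exI allI impI)
    fix n assume "n \<ge> M"
    let ?a = "\<lambda>x. \<bar>mollify n (\<lambda>y. v y - g y) x\<bar> powr s"
    let ?b = "\<lambda>x. \<bar>mollify n g x - g x\<bar> powr s"
    let ?d = "\<lambda>x. \<bar>v x - g x\<bar> powr s"
    have vg: "(\<lambda>x. v x - g x) \<in> borel_measurable torus" by measurable
    note ia = mollify_Lp_contraction(2)[OF s vg ivg, of n]
    have ib: "integrable torus ?b"
      by (intro torus_continuous cp continuous_intros mc gi g)
    have le: "\<bar>mollify n v x - v x\<bar> powr s \<le> c * (?a x + c * (?b x + ?d x))" for x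
    proof -
      have "\<bar>mollify n v x - v x\<bar> powr s = norm (mollify n (\<lambda>y. v y - g y) x + ((mollify n g x - g x) - (v x - g x))) powr s"
        by (simp add: mollify_diff[OF int gi])
      also have "\<dots> \<le> c * (?a x + norm ((mollify n g x - g x) - (v x - g x)) powr s)"
        using norm_add_powr_le[of s "mollify n (\<lambda>y. v y - g y) x" "(mollify n g x - g x) - (v x - g x)"] s
        by (simp add: c_def)
      also have "\<dots> \<le> c * (?a x + c * (?b x + ?d x))"
        using norm_minus_powr_le[of s "mollify n g x - g x" "v x - g x"] s c
        by (intro mult_left_mono add_left_mono) (auto simp: c_def)
      finally show ?thesis .
    qed
    have ir: "integrable torus (\<lambda>x. c * (?a x + c * (?b x + ?d x)))"
      using ia ib ivg by simp
    have "integrable torus (\<lambda>x. \<bar>mollify n v x - v x\<bar> powr s)"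
    proof (rule Bochner_Integration.integrable_bound[OF ir])
      show "(\<lambda>x. \<bar>mollify n v x - v x\<bar> powr s) \<in> borel_measurable torus" using int by measurable
      show "AE x in torus. norm (\<bar>mollify n v x - v x\<bar> powr s) \<le> norm (c * (?a x + c * (?b x + ?d x)))"
        using order_trans[OF le abs_ge_self] by (auto intro!: AE_I2)
    qed
    then have "(LINT x|torus. \<bar>mollify n v x - v x\<bar> powr s) \<le> (LINT x|torus. c * (?a x + c * (?b x + ?d x)))"
      by (intro integral_mono ir le)
    also have "\<dots> = c * ((LINT x|torus. ?a x) + c * ((LINT x|torus. ?b x) + (LINT x|torus. ?d x)))"
      using ia ib ivg by simp
    also have "\<dots> < c * (\<epsilon> + c * (\<epsilon> + \<epsilon>))"
    proof -
      have "(LINT x|torus. ?a x) < \<epsilon>"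
        using mollify_Lp_contraction(1)[OF s vg ivg, of n] ge by simp
      moreover have "(LINT x|torus. ?b x) + (LINT x|torus. ?d x) < \<epsilon> + \<epsilon>"
        using M[OF \<open>n \<ge> M\<close>] ge by simp
      ultimately show ?thesis
        by (rule mult_strict_left_mono[OF add_strict_mono[OF _ mult_strict_left_mono[OF _ c]] c])
    qed
    also have "\<dots> \<le> \<epsilon> * (2 * (c + c * c))"
      using \<epsilon> c by (simp add: algebra_simps)
    also have "\<dots> = e" using c by (simp add: \<epsilon>_def add_pos_pos less_imp_neq[symmetric])
    finally show "norm ((LINT x|torus. \<bar>mollify n v x - v x\<bar> powr s) - 0) < e"
      by (simp add: integral_nonneg_AE)
  qed
qed

section \<open>Weak gradients\<close>

lemma torus_Lp_integrable:
  fixes v :: "real ^ 'n \<Rightarrow> 'b :: euclidean_space"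
  assumes "torus_Lp s v" "s \<ge> 1"
  shows "integrable torus v"
  using assms powr_integrable_imp_integrable[OF finite_measure_torus]
  by (auto simp: torus_Lp_def)

lemma component_integrable:
  fixes V :: "real ^ 'n \<Rightarrow> real ^ 'n"
  shows "integrable torus V \<Longrightarrow> integrable torus (\<lambda>x. V x $ i)"
  using integrable_bounded_linear[OF bounded_linear_vec_nth] by blast

text \<open>The kernel depends on x - y, so its x-derivative is minus its y-derivative. The latter
  is the derivative of a test function, which the definition of the weak gradient moves onto V; the
  two signs cancel.\<close>

lemma gradient_mollify:
  fixes \<phi> :: "real ^ 'n \<Rightarrow> real"
  assumes "weak_gradient \<phi> V"
  shows "gradient (mollify n \<phi>) x = (\<chi> i. mollify n (\<lambda>y. V y $ i) x)"
proof -
  have \<phi>: "integrable torus \<phi>" and V: "integrable torus V"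
    using assms torus_Lp_integrable by (auto simp: weak_gradient_def)
  have "partial i (mollify n \<phi>) x = mollify n (\<lambda>y. V y $ i) x" for i
  proof -
    let ?\<psi> = "\<lambda>y. kernel n (x - y)"
    have d: "(kernel n has_derivative (\<lambda>h. gradient (kernel n) z \<bullet> h)) (at z)" for z :: "real ^ 'n"
      by (intro smooth_periodicD trig_smooth_periodic kernel_trig)
    have p1: "partial i (\<lambda>x. kernel n (x - y)) x = gradient (kernel n) (x - y) $ i" for y
    proof -
      have "((\<lambda>x. x - y) has_derivative (\<lambda>h. h)) (at x)" by (auto intro!: derivative_eq_intros)
      from partial_eqI[OF has_derivative_compose[OF this d], of i] show ?thesis by (simp add: inner_axis)
    qed
    have p2: "partial i ?\<psi> y = - (gradient (kernel n) (x - y) $ i)" for y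
    proof -
      have "((\<lambda>y. x - y) has_derivative (\<lambda>h. - h)) (at y)" by (auto intro!: derivative_eq_intros)
      from partial_eqI[OF has_derivative_compose[OF this d], of i] show ?thesis by (simp add: inner_axis)
    qed
    have "(LINT y|torus. \<phi> y * partial i ?\<psi> y) = - (LINT y|torus. V y $ i * ?\<psi> y)"
      using assms trig_smooth_periodic[OF sep_section2[OF kernel_sep[of n], of x]] unfolding weak_gradient_def by blast
    moreover have "partial i (mollify n \<phi>) x = (LINT y|torus. \<phi> y * partial i (\<lambda>x. kernel n (x - y)) x)"
      unfolding mollify_def[abs_def] by (rule sep_integral_trig(3)[OF kernel_sep \<phi>])
    moreover have "\<dots> = - (LINT y|torus. \<phi> y * partial i ?\<psi> y)"
      by (simp add: p1 p2)
    ultimately show ?thesis by (simp add: mollify_def)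
  qed
  then show ?thesis by (simp add: vec_eq_iff partial_nth)
qed

text \<open>Both candidates have the same mollifications, because these are the gradient of the
  mollified potential, and mollifications converge in L^1.\<close>

lemma weak_gradient_unique:
  fixes \<phi> :: "real ^ 'n \<Rightarrow> real"
  assumes "weak_gradient \<phi> V" "weak_gradient \<phi> W"
  shows "AE x in torus. V x = W x"
proof -
  have "AE x in torus. V x $ i = W x $ i" for i
  proof -
    have int: "integrable torus (\<lambda>x. V x $ i)" "integrable torus (\<lambda>x. W x $ i)"
      using assms by (auto simp: weak_gradient_def intro: component_integrable torus_Lp_integrable)
    let ?u = "\<lambda>x. V x $ i - W x $ i"
    have iu: "integrable torus ?u" using int by simp
    have "mollify n ?u x = 0" for n x
      using gradient_mollify[OF assms(1), of n x] gradient_mollify[OF assms(2), of n x]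
      by (simp add: mollify_diff[OF int] vec_eq_iff)
    moreover have "(\<lambda>n. LINT x|torus. \<bar>mollify n ?u x - ?u x\<bar> powr 1) \<longlonglongrightarrow> 0"
      by (rule mollify_Lp_tendsto) (use iu in auto)
    ultimately have "(LINT x|torus. \<bar>?u x\<bar>) = 0"
      by (simp add: LIMSEQ_const_iff abs_minus_commute)
    then have "AE x in torus. \<bar>?u x\<bar> = 0"
      using iu by (subst (asm) integral_nonneg_eq_0_iff_AE) auto
    then show ?thesis by eventually_elim simp
  qed
  then have "AE x in torus. \<forall>i. V x $ i = W x $ i"
    by (simp add: AE_all_countable)
  then show ?thesis by eventually_elim (simp add: vec_eq_iff)
qed

lemma Lp_limit_integrable:
  fixes u :: "nat \<Rightarrow> 'a \<Rightarrow> 'b :: euclidean_space"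
  assumes "s > 0" "v \<in> borel_measurable M" "integrable M h" "AE x in M. (\<lambda>n. u n x) \<longlonglongrightarrow> v x"
    "AE x in M. \<forall>n. norm (u n x) powr s \<le> h x"
  shows "integrable M (\<lambda>x. norm (v x) powr s)"
proof (rule Bochner_Integration.integrable_bound[OF assms(3)])
  show "AE x in M. norm (norm (v x) powr s) \<le> norm (h x)"
    using assms(4,5)
  proof eventually_elim
    case (elim x)
    have "(\<lambda>n. norm (u n x) powr s) \<longlonglongrightarrow> norm (v x) powr s"
      using elim(1) assms(1) by (intro tendsto_powr' tendsto_intros) auto
    then have "norm (v x) powr s \<le> h x" using elim(2) by (intro LIMSEQ_le_const2) auto
    then show ?case by simp
  qed
qed (use assms(2) in measurable)

text \<open>Convergence implies the Cauchy property, hence a dominated subsequence. Its pointwise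
  limit is v, since dominated convergence computes their L^s distance as 0.\<close>

lemma Lp_convergent_subsequence:
  fixes u :: "nat \<Rightarrow> 'a \<Rightarrow> 'b :: euclidean_space"
  assumes s: "s \<ge> 1" and meas: "\<And>n. u n \<in> borel_measurable M" "v \<in> borel_measurable M"
    and int: "\<And>n. integrable M (\<lambda>x. norm (u n x) powr s)" "integrable M (\<lambda>x. norm (v x) powr s)"
    and lim: "(\<lambda>n. LINT x|M. norm (u n x - v x) powr s) \<longlonglongrightarrow> 0"
  obtains k h where "strict_mono (k :: nat \<Rightarrow> nat)" "integrable M (h :: 'a \<Rightarrow> real)"
    "AE x in M. (\<lambda>n. u (k n) x) \<longlonglongrightarrow> v x"
    "AE x in M. \<forall>n. norm (u (k n) x) powr s \<le> h x"
proof -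
  note [measurable] = meas
  define c where "c = 2 powr s"
  have c: "c > 0" by (simp add: c_def)
  have iv: "integrable M (\<lambda>x. norm (u n x - v x) powr s)" for n
    using s by (intro Lp_diff_integrable meas int) auto
  have cauchy: "\<exists>N. \<forall>n\<ge>N. \<forall>m\<ge>N. (LINT x|M. norm (u n x - u m x) powr s) < e" if e: "e > 0" for e
  proof -
    have "eventually (\<lambda>n. (LINT x|M. norm (u n x - v x) powr s) < e / (2 * c)) sequentially"
      using e c by (intro order_tendstoD(2)[OF lim]) auto
    then obtain N where N: "\<And>n. n \<ge> N \<Longrightarrow> (LINT x|M. norm (u n x - v x) powr s) < e / (2 * c)"
      by (auto simp: eventually_sequentially)
    have "(LINT x|M. norm (u n x - u m x) powr s) < e" if "n \<ge> N" "m \<ge> N" for n m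
    proof -
      have "(LINT x|M. norm (u n x - u m x) powr s) \<le> (LINT x|M. c * (norm (u n x - v x) powr s + norm (u m x - v x) powr s))"
      proof (rule integral_mono)
        show "norm (u n x - u m x) powr s \<le> c * (norm (u n x - v x) powr s + norm (u m x - v x) powr s)" for x
          using norm_minus_powr_le[of s "u n x - v x" "u m x - v x"] s by (simp add: c_def)
      qed (use iv s in \<open>auto intro!: Lp_diff_integrable meas int\<close>)
      also have "\<dots> = c * ((LINT x|M. norm (u n x - v x) powr s) + (LINT x|M. norm (u m x - v x) powr s))"
        using iv by simp
      also have "\<dots> < c * (e / (2 * c) + e / (2 * c))"
        by (intro mult_strict_left_mono add_strict_mono N that c)
      also have "\<dots> = e" using c by (simp add: field_simps)
      finally show ?thesis .
    qed
    then show ?thesis by blast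
  qed
  obtain k h where k: "strict_mono k" and h: "integrable M h"
    and conv: "AE x in M. (\<lambda>n. u (k n) x) \<longlonglongrightarrow> lim (\<lambda>n. u (k n) x)"
    and dom: "AE x in M. \<forall>n. norm (u (k n) x) powr s \<le> h x"
    by (rule Lp_Cauchy_subsequence[OF s meas(1) int(1) cauchy])
  let ?l = "\<lambda>x. lim (\<lambda>n. u (k n) x)"
  have "(\<lambda>n. LINT x|M. norm (u (k n) x - v x) powr s) \<longlonglongrightarrow> (LINT x|M. norm (?l x - v x) powr s)"
  proof (rule integral_dominated_convergence[where w = "\<lambda>x. c * (h x + norm (v x) powr s)"])
    show "integrable M (\<lambda>x. c * (h x + norm (v x) powr s))" using h int by simp
    show "AE x in M. (\<lambda>n. norm (u (k n) x - v x) powr s) \<longlonglongrightarrow> norm (?l x - v x) powr s"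
      using conv by eventually_elim (use s in \<open>intro tendsto_powr' tendsto_intros, auto\<close>)
    show "AE x in M. norm (norm (u (k n) x - v x) powr s) \<le> c * (h x + norm (v x) powr s)" for n
      using dom
    proof eventually_elim
      case (elim x)
      have "norm (u (k n) x - v x) powr s \<le> c * (norm (u (k n) x) powr s + norm (v x) powr s)"
        using norm_minus_powr_le[of s] s by (simp add: c_def)
      also have "\<dots> \<le> c * (h x + norm (v x) powr s)"
        using elim c by (intro mult_left_mono add_right_mono) auto
      finally show ?case by simp
    qed
  qed measurable
  moreover have "(\<lambda>n. LINT x|M. norm (u (k n) x - v x) powr s) \<longlonglongrightarrow> 0"
    using LIMSEQ_subseq_LIMSEQ[OF lim k] by (simp add: o_def)
  ultimately have "(LINT x|M. norm (?l x - v x) powr s) = 0"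
    using LIMSEQ_unique by blast
  moreover have "integrable M (\<lambda>x. norm (?l x - v x) powr s)"
    using s by (intro Lp_diff_integrable meas int Lp_limit_integrable[OF _ _ h conv dom]) auto
  ultimately have "AE x in M. norm (?l x - v x) powr s = 0"
    by (subst (asm) integral_nonneg_eq_0_iff_AE) auto
  then have "AE x in M. (\<lambda>n. u (k n) x) \<longlonglongrightarrow> v x"
    using conv by eventually_elim simp
  then show ?thesis using that k h dom by blast
qed

text \<open>The mollified potentials have gradients converging to V in L^s, component by component.
  A subsequence adds pointwise convergence and the majorant that dominated convergence asks
  for.\<close>

lemma weak_gradient_approximation:
  fixes \<phi> :: "real ^ 'n \<Rightarrow> real"
  assumes s: "s \<ge> 1" and wg: "weak_gradient \<phi> V" and V: "torus_Lp s V"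
  obtains \<psi> h where "\<And>n :: nat. smooth_periodic (\<psi> n)" "integrable torus (h :: real ^ 'n \<Rightarrow> real)"
    "AE x in torus. (\<lambda>n. gradient (\<psi> n) x) \<longlonglongrightarrow> V x"
    "AE x in torus. \<forall>n. norm (gradient (\<psi> n) x) powr s \<le> h x"
proof -
  define N where "N = real CARD('n)"
  define u where "u n = gradient (mollify n \<phi>)" for n
  have \<phi>: "integrable torus \<phi>"
    using wg torus_Lp_integrable by (auto simp: weak_gradient_def)
  have sm: "smooth_periodic (mollify n \<phi>)" for n
    by (intro trig_smooth_periodic mollify_trig \<phi>)
  have [measurable]: "V \<in> borel_measurable torus" and intV: "integrable torus (\<lambda>x. norm (V x) powr s)"
    using V by (auto simp: torus_Lp_def)
  have Vi[measurable]: "(\<lambda>x. V x $ i) \<in> borel_measurable torus" for i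
    by (rule borel_measurable_integrable[OF component_integrable[OF torus_Lp_integrable[OF V s]]])
  have intVi: "integrable torus (\<lambda>x. \<bar>V x $ i\<bar> powr s)" for i
    by (rule Bochner_Integration.integrable_bound[OF intV])
      (use s component_le_norm_cart in \<open>auto intro!: AE_I2 powr_mono2\<close>)
  have cu: "continuous_on UNIV (u n)" for n
    unfolding u_def by (intro smooth_periodicD sm)
  have um[measurable]: "u n \<in> borel_measurable torus" for n
    by (rule continuous_torus_measurable[OF cu])
  have iu: "integrable torus (\<lambda>x. norm (u n x) powr s)" for n
    using s by (intro torus_continuous continuous_intros continuous_on_powr' cu) auto
  \<comment> \<open>The norm is at most \<open>N\<close> times the largest component
    \<open>j\<close>, and the power of the largest is one of the summands.\<close>
  have comp: "norm w powr s \<le> N powr s * (\<Sum>i\<in>UNIV. \<bar>w $ i\<bar> powr s)" for w :: "real ^ 'n"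
  proof -
    have "Max (range (\<lambda>i. \<bar>w $ i\<bar>)) \<in> range (\<lambda>i. \<bar>w $ i\<bar>)" by (intro Max_in) auto
    then obtain j where "Max (range (\<lambda>i. \<bar>w $ i\<bar>)) = \<bar>w $ j\<bar>" by (rule rangeE)
    then have j: "\<bar>w $ i\<bar> \<le> \<bar>w $ j\<bar>" for i by (metis Max_ge finite finite_imageI rangeI)
    have "norm w \<le> (\<Sum>i\<in>UNIV. \<bar>w $ i\<bar>)" by (rule norm_le_l1_cart)
    also have "\<dots> \<le> (\<Sum>i\<in>(UNIV :: 'n set). \<bar>w $ j\<bar>)" by (intro sum_mono j)
    also have "\<dots> = N * \<bar>w $ j\<bar>" by (simp add: N_def)
    finally have "norm w powr s \<le> (N * \<bar>w $ j\<bar>) powr s" using s by (intro powr_mono2) auto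
    also have "\<dots> = N powr s * \<bar>w $ j\<bar> powr s" by (simp add: powr_mult N_def)
    also have "\<dots> \<le> N powr s * (\<Sum>i\<in>UNIV. \<bar>w $ i\<bar> powr s)"
      by (intro mult_left_mono member_le_sum[of j UNIV "\<lambda>i. \<bar>w $ i\<bar> powr s"]) auto
    finally show ?thesis .
  qed
  have unth: "u n x $ i = mollify n (\<lambda>y. V y $ i) x" for n x i
    using gradient_mollify[OF wg, of n x] by (simp add: u_def)
  have idiff: "integrable torus (\<lambda>x. \<bar>(u n x - V x) $ i\<bar> powr s)" for n i
  proof -
    have "integrable torus (\<lambda>x. norm (mollify n (\<lambda>y. V y $ i) x - V x $ i) powr s)"
    proof (rule Lp_diff_integrable)
      have c: "continuous_on UNIV (mollify n (\<lambda>y. V y $ i))"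
        by (intro trig_continuous mollify_trig component_integrable torus_Lp_integrable[OF V s])
      show "mollify n (\<lambda>y. V y $ i) \<in> borel_measurable torus"
        by (rule continuous_torus_measurable[OF c])
    qed (use s intVi Vi mollify_Lp_contraction(2)[OF s Vi intVi] in auto)
    then show ?thesis by (simp add: unth)
  qed
  have lim: "(\<lambda>n. LINT x|torus. norm (u n x - V x) powr s) \<longlonglongrightarrow> 0"
  proof (rule tendsto_sandwich[OF _ _ tendsto_const])
    show "\<forall>\<^sub>F n in sequentially. 0 \<le> (LINT x|torus. norm (u n x - V x) powr s)"
      by (simp add: integral_nonneg_AE)
    show "\<forall>\<^sub>F n in sequentially. (LINT x|torus. norm (u n x - V x) powr s)
      \<le> N powr s * (\<Sum>i\<in>UNIV. (LINT x|torus. \<bar>mollify n (\<lambda>y. V y $ i) x - V x $ i\<bar> powr s))"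
    proof (rule always_eventually, rule allI)
      fix n
      have "(LINT x|torus. norm (u n x - V x) powr s) \<le> (LINT x|torus. N powr s * (\<Sum>i\<in>UNIV. \<bar>(u n x - V x) $ i\<bar> powr s))"
      proof (rule integral_mono[OF _ _ comp])
        show "integrable torus (\<lambda>x. norm (u n x - V x) powr s)"
          using s iu intV by (intro Lp_diff_integrable) auto
        show "integrable torus (\<lambda>x. N powr s * (\<Sum>i\<in>UNIV. \<bar>(u n x - V x) $ i\<bar> powr s))"
          by (intro integrable_mult_right Bochner_Integration.integrable_sum idiff)
      qed
      also have "\<dots> = N powr s * (\<Sum>i\<in>UNIV. LINT x|torus. \<bar>(u n x - V x) $ i\<bar> powr s)"
        by (subst integral_mult_right_zero, subst Bochner_Integration.integral_sum) (use idiff in auto)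
      finally show "(LINT x|torus. norm (u n x - V x) powr s)
        \<le> N powr s * (\<Sum>i\<in>UNIV. (LINT x|torus. \<bar>mollify n (\<lambda>y. V y $ i) x - V x $ i\<bar> powr s))"
        by (simp add: unth)
    qed
    have "(\<lambda>n. N powr s * (\<Sum>i\<in>UNIV. (LINT x|torus. \<bar>mollify n (\<lambda>y. V y $ i) x - V x $ i\<bar> powr s)))
      \<longlonglongrightarrow> N powr s * (\<Sum>i\<in>(UNIV :: 'n set). 0)"
      by (intro tendsto_mult tendsto_const tendsto_sum mollify_Lp_tendsto s Vi intVi)
    then show "(\<lambda>n. N powr s * (\<Sum>i\<in>UNIV. (LINT x|torus. \<bar>mollify n (\<lambda>y. V y $ i) x - V x $ i\<bar> powr s)))
      \<longlonglongrightarrow> 0" by simp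
  qed
  obtain k h where "strict_mono k" "integrable torus (h :: real ^ 'n \<Rightarrow> real)"
    "AE x in torus. (\<lambda>n. u (k n) x) \<longlonglongrightarrow> V x"
    "AE x in torus. \<forall>n. norm (u (k n) x) powr s \<le> h x"
    by (rule Lp_convergent_subsequence[OF s um _ iu intV lim]) auto
  then show ?thesis
    using that[of "\<lambda>n. mollify (k n) \<phi>" h] sm by (simp add: u_def)
qed

section \<open>The data of the system\<close>

lemma convex_tangent:
  fixes F :: "real ^ 'n \<Rightarrow> real"
  assumes "convex_on UNIV F" "F differentiable (at p)"
  shows "F p + gradient F p \<bullet> u \<le> F (p + u)"
proof -
  define \<phi> where "\<phi> t = F (p + t *\<^sub>R u)" for t
  have "convex_on UNIV \<phi>"
  proof (rule convex_onI)
    fix t x y :: real assume t: "0 < t" "t < 1"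
    have "p + ((1 - t) *\<^sub>R x + t *\<^sub>R y) *\<^sub>R u = (1 - t) *\<^sub>R (p + x *\<^sub>R u) + t *\<^sub>R (p + y *\<^sub>R u)"
      by (simp add: algebra_simps)
    then show "\<phi> ((1 - t) *\<^sub>R x + t *\<^sub>R y) \<le> (1 - t) * \<phi> x + t * \<phi> y"
      using convex_onD[OF assms(1), of t "p + x *\<^sub>R u" "p + y *\<^sub>R u"] t by (simp add: \<phi>_def)
  qed simp
  moreover have "(\<phi> has_field_derivative gradient F p \<bullet> u) (at 0 within UNIV)"
  proof -
    have "((\<lambda>t. p + t *\<^sub>R u) has_derivative (\<lambda>t. t *\<^sub>R u)) (at 0)"
      by (auto intro!: derivative_eq_intros)
    from has_derivative_compose[OF this, of F "\<lambda>h. gradient F p \<bullet> h"] has_derivative_gradient[OF assms(2)]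
    have "(\<phi> has_derivative (\<lambda>t. t * (gradient F p \<bullet> u))) (at 0)" by (simp add: \<phi>_def[abs_def])
    then show ?thesis
      by (simp add: has_field_derivative_def mult.commute[of _ "gradient F p \<bullet> u"])
  qed
  ultimately have "(gradient F p \<bullet> u) * (1 - 0) \<le> \<phi> 1 - \<phi> 0"
    by (intro convex_on_imp_above_tangent) auto
  then show ?thesis by (simp add: \<phi>_def)
qed

text \<open>Young's inequality with constant 1: with M the larger of the two summands, the factors
  are at most M^(1/q) and M^((q-1)/q), and these exponents add up to 1.\<close>

lemma mult_le_powr_conjugate:
  fixes a b q :: real
  assumes "a \<ge> 0" "b \<ge> 0" "q > 1"
  shows "a * b \<le> a powr q + b powr (q / (q - 1))"
proof -
  define M where "M = max (a powr q) (b powr (q / (q - 1)))"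
  have "a = (a powr q) powr (1 / q)" using assms by (simp add: powr_powr)
  also have "\<dots> \<le> M powr (1 / q)" using assms by (intro powr_mono2) (auto simp: M_def)
  finally have a: "a \<le> M powr (1 / q)" .
  have "b = (b powr (q / (q - 1))) powr ((q - 1) / q)" using assms by (simp add: powr_powr)
  also have "\<dots> \<le> M powr ((q - 1) / q)" using assms by (intro powr_mono2) (auto simp: M_def)
  finally have b: "b \<le> M powr ((q - 1) / q)" .
  have "a * b \<le> M powr (1 / q) * M powr ((q - 1) / q)"
    using a b assms by (intro mult_mono) auto
  also have "\<dots> = M powr (1 / q + (q - 1) / q)" by (rule powr_add[symmetric])
  also have "1 / q + (q - 1) / q = 1" using assms by (simp add: field_simps)
  also have "M powr 1 = M" by (simp add: M_def le_max_iff_disj)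
  also have "M \<le> a powr q + b powr (q / (q - 1))" by (simp add: M_def)
  finally show ?thesis .
qed

lemma torus_measurable_comp:
  fixes F :: "real ^ 'n \<Rightarrow> 'c :: second_countable_topology \<Rightarrow> 'b :: topological_space"
  assumes "continuous_on UNIV (\<lambda>(x, p). F x p)" "V \<in> borel_measurable torus"
  shows "(\<lambda>x. F x (V x)) \<in> borel_measurable torus"
proof -
  have "(\<lambda>x. (x, V x)) \<in> borel_measurable torus"
    by (intro borel_measurable_Pair continuous_torus_measurable assms continuous_intros)
  from borel_measurable_continuous_on[OF assms(1) this] show ?thesis by simp
qed

locale mfg =
  fixes H :: "real ^ 'n \<Rightarrow> real ^ 'n \<Rightarrow> real" and f :: "real ^ 'n \<Rightarrow> real \<Rightarrow> real" and r q :: real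
  assumes ham: "hamiltonian r H" and coup: "coupling q f" and rq: "r > max (real CARD('n) * (q - 1)) 1"
begin

definition s :: real where "s = q / (q - 1) * r"

lemma q: "q > 1" and r: "r > 1"
  using ham coup by (auto simp: hamiltonian_def coupling_def)

text \<open>For q \<le> 2, 2 (q - 1) \<le> q \<le> q r. For q > 2 the factors are compared, 2 < q
  and q - 1 \<le> r, the latter from \<open>rq\<close> because the dimension is at least 1. This is
  the range that \<open>clarkson\<close> requires.\<close>

lemma s_ge_2: "s \<ge> 2"
proof -
  have "1 * (q - 1) \<le> real CARD('n) * (q - 1)"
    using q by (intro mult_right_mono) (auto simp: Suc_le_eq)
  then have "q - 1 \<le> r" using rq by simp
  show ?thesis
  proof (cases "q \<le> 2")
    case True
    have "q * 1 \<le> q * r" using q r by (intro mult_left_mono) auto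
    then have "2 * (q - 1) \<le> q * r" using True by simp
    then show ?thesis using q by (simp add: s_def field_simps)
  next
    case False
    have "2 * (q - 1) \<le> q * r" using False \<open>q - 1 \<le> r\<close> by (intro mult_mono) auto
    then show ?thesis using q by (simp add: s_def field_simps)
  qed
qed

lemma s_ge_1: "s \<ge> 1" and s_pos: "s > 0"
  using s_ge_2 by auto

lemma powr_r_conj: "(norm v powr r) powr (q / (q - 1)) = norm v powr s"
  by (simp add: powr_powr s_def mult.commute)

abbreviation DH where "DH x p \<equiv> gradient (H x) p"

lemma H_props:
  shows "periodic (\<lambda>x. H x p)" "continuous_on UNIV (\<lambda>(x, p). H x p)" "convex_on UNIV (H x)"
    "H x differentiable (at p)" "continuous_on UNIV (\<lambda>(x, p). DH x p)"
  using ham by (auto simp: hamiltonian_def)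

lemma H_tangent: "H x p + DH x p \<bullet> u \<le> H x (p + u)"
  by (rule convex_tangent[OF H_props(3,4)])

lemma H_growth:
  obtains C \<kappa> where "C > 0" "\<kappa> > 0" "\<And>x p. \<bar>H x p\<bar> \<le> C * (1 + norm p powr r)"
    "\<And>x p. \<kappa> * norm p powr r - C \<le> H x p"
proof -
  obtain C where C: "C > 0" and lo: "\<And>x p. 1 / (r * C) * norm p powr r - C \<le> H x p"
    and up: "\<And>x p. H x p \<le> C / r * norm p powr r + C"
    using ham unfolding hamiltonian_def by blast
  show ?thesis
  proof
    show "C > 0" "1 / (r * C) > 0" using C r by auto
    show "1 / (r * C) * norm p powr r - C \<le> H x p" for x p by (rule lo)
    show "\<bar>H x p\<bar> \<le> C * (1 + norm p powr r)" for x p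
    proof -
      have "C / r * norm p powr r \<le> C * norm p powr r"
        using C r by (intro mult_right_mono) (auto simp: field_simps)
      moreover have "0 \<le> 1 / (r * C) * norm p powr r" using C r by simp
      moreover have "0 \<le> C * norm p powr r" using C by simp
      ultimately show ?thesis using lo[of p x] up[of x p] by (simp add: algebra_simps)
    qed
  qed
qed

text \<open>The tangent inequality in the directions u and -u bounds the gradient by values of H;
  this turns the growth bound on H into one on its derivative.\<close>

lemma DH_bound: "\<bar>DH x p \<bullet> u\<bar> \<le> \<bar>H x (p + u)\<bar> + \<bar>H x (p - u)\<bar> + \<bar>H x p\<bar>"
  using H_tangent[of x p u] H_tangent[of x p "- u"] by simp

lemma DH_growth:
  obtains C where "C > 0" "\<And>x p u. \<bar>DH x p \<bullet> u\<bar> \<le> C * (1 + norm p powr r + norm u powr r)"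
proof -
  obtain C where C: "C > 0" "\<And>x p. \<bar>H x p\<bar> \<le> C * (1 + norm p powr r)"
    using H_growth by metis
  define c where "c = 2 powr r"
  have c: "c \<ge> 1" using r by (simp add: c_def ge_one_powr_ge_zero)
  have "\<bar>DH x p \<bullet> u\<bar> \<le> 3 * C * c * (1 + norm p powr r + norm u powr r)" for x p u
  proof -
    have "\<bar>H x (p + u)\<bar> \<le> C * (1 + c * (norm p powr r + norm u powr r))"
      using C norm_add_powr_le[of r p u] r by (intro order_trans[OF C(2)] mult_left_mono) (auto simp: c_def)
    moreover have "\<bar>H x (p - u)\<bar> \<le> C * (1 + c * (norm p powr r + norm u powr r))"
      using C norm_minus_powr_le[of r p u] r by (intro order_trans[OF C(2)] mult_left_mono) (auto simp: c_def)
    moreover have "\<bar>H x p\<bar> \<le> C * (1 + c * (norm p powr r + norm u powr r))"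
    proof -
      have "1 * (norm p powr r + 0) \<le> c * (norm p powr r + norm u powr r)"
        using c by (intro mult_mono) auto
      then show ?thesis using C by (intro order_trans[OF C(2)] mult_left_mono) auto
    qed
    moreover have "C * (1 + c * (norm p powr r + norm u powr r)) \<le> C * (c * (1 + norm p powr r + norm u powr r))"
      using c C by (intro mult_left_mono) (auto simp: distrib_left)
    ultimately show ?thesis using DH_bound[of x p u] by (simp add: mult.assoc)
  qed
  then show ?thesis using that[of "3 * C * c"] C c by simp
qed

lemma f_props:
  shows "\<And>m. m > 0 \<Longrightarrow> periodic (\<lambda>x. f x m)" "continuous_on (UNIV \<times> {0<..}) (\<lambda>(x, m). f x m)"
    "\<And>x a b. 0 < a \<Longrightarrow> a < b \<Longrightarrow> f x a < f x b"
  using coup by (auto simp: coupling_def strict_mono_on_def)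

lemma f_mono: "0 < a \<Longrightarrow> a \<le> b \<Longrightarrow> f x a \<le> f x b"
  using f_props(3)[of a b x] by (cases "a = b") auto

lemma coupling_ext_pos: "m > 0 \<Longrightarrow> coupling_ext f x m = ereal (f x m)"
  by (simp add: coupling_ext_def)

text \<open>By monotonicity the limit at 0+ exists and is the infimum over a > 0. This trades the
  extended real value for real inequalities.\<close>

lemma coupling_ext_nonpos:
  assumes "m \<le> 0"
  shows "ereal t \<le> coupling_ext f x m \<longleftrightarrow> (\<forall>a>0. t \<le> f x a)"
proof -
  define L where "L = (INF a\<in>{0<..}. ereal (f x a))"
  have "((\<lambda>a. ereal (f x a)) \<longlongrightarrow> L) (at_right 0)"
  proof (rule order_tendstoI)
    fix y assume y: "y < L"
    have "y < ereal (f x a)" if "a > 0" for a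
      using y INF_lower[of a "{0<..}" "\<lambda>a. ereal (f x a)"] that unfolding L_def by (auto intro: less_le_trans)
    then show "\<forall>\<^sub>F a in at_right 0. y < ereal (f x a)"
      unfolding eventually_at_right_field by (intro exI[of _ 1]) auto
  next
    fix y assume "L < y"
    then obtain a0 where a0: "a0 > 0" "ereal (f x a0) < y"
      unfolding L_def INF_less_iff by auto
    have "ereal (f x a) < y" if "0 < a" "a < a0" for a
      using a0 f_mono[of a a0 x] that by (meson ereal_less_eq(3) le_less_trans less_imp_le)
    then show "\<forall>\<^sub>F a in at_right 0. ereal (f x a) < y"
      unfolding eventually_at_right_field using a0(1) by blast
  qed
  then have "Lim (at_right 0) (\<lambda>a. ereal (f x a)) = L"
    by (intro tendsto_Lim) auto
  then have "coupling_ext f x m = L" using assms by (simp add: coupling_ext_def)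
  then show ?thesis by (auto simp: L_def le_INF_iff)
qed

text \<open>Young's inequality twice, with conjugate exponents q and q/(q-1). It makes the products
  of a mass in L^q with H or DH along an L^s field integrable.\<close>

lemma mass_times_growth:
  assumes "m \<ge> 0"
  shows "m * (1 + norm v powr r) \<le> 2 * m powr q + 1 + norm v powr s"
proof -
  have "m * 1 \<le> m powr q + 1 powr (q / (q - 1))" using assms q by (intro mult_le_powr_conjugate) auto
  moreover have "m * norm v powr r \<le> m powr q + norm v powr s"
    using mult_le_powr_conjugate[OF assms, of "norm v powr r" q] q by (simp add: powr_r_conj)
  ultimately show ?thesis by (simp add: distrib_left)
qed

section \<open>Uniqueness\<close>

lemma mass_H_integrable:
  fixes m :: "real ^ 'n \<Rightarrow> real" and V :: "real ^ 'n \<Rightarrow> real ^ 'n"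
  assumes m: "torus_Lp q m" "AE x in torus. m x \<ge> 0" and V: "torus_Lp s V"
  shows "integrable torus (\<lambda>x. m x * H x (V x))"
proof -
  obtain C where C: "C > 0" "\<And>x p. \<bar>H x p\<bar> \<le> C * (1 + norm p powr r)"
    using H_growth by metis
  have [measurable]: "m \<in> borel_measurable torus" "V \<in> borel_measurable torus" using m V by (auto simp: torus_Lp_def)
  have im: "integrable torus (\<lambda>x. norm (m x) powr q)" and iV: "integrable torus (\<lambda>x. norm (V x) powr s)"
    using m V by (auto simp: torus_Lp_def)
  have [measurable]: "(\<lambda>x. H x (V x)) \<in> borel_measurable torus"
    by (rule torus_measurable_comp[OF H_props(2)]) measurable
  show ?thesis
  proof (rule Bochner_Integration.integrable_bound)
    show "integrable torus (\<lambda>x. C * (2 * norm (m x) powr q + 1 + norm (V x) powr s))"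
      using im iV by simp
    show "AE x in torus. norm (m x * H x (V x)) \<le> norm (C * (2 * norm (m x) powr q + 1 + norm (V x) powr s))"
      using m(2)
    proof eventually_elim
      case (elim x)
      have "\<bar>m x * H x (V x)\<bar> \<le> m x * (C * (1 + norm (V x) powr r))"
        using C elim by (auto simp: abs_mult intro!: mult_left_mono)
      also have "\<dots> = C * (m x * (1 + norm (V x) powr r))" by simp
      also have "\<dots> \<le> C * (2 * m x powr q + 1 + norm (V x) powr s)"
        using C by (intro mult_left_mono mass_times_growth elim) auto
      finally show ?case using elim C by (simp add: abs_mult)
    qed
  qed measurable
qed

text \<open>The equation is given for smooth test functions only. Smooth gradients converging to W,
  with one majorant for their s-th powers, carry it over by dominated convergence; \<open>k\<close>
  collects the Young bounds.\<close>

lemma divergence_free_weak_test: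
  fixes m \<phi> :: "real ^ 'n \<Rightarrow> real" and V W :: "real ^ 'n \<Rightarrow> real ^ 'n"
  assumes m: "torus_Lp q m" "AE x in torus. m x \<ge> 0" and V: "torus_Lp s V"
    and df: "divergence_free (\<lambda>x. m x *\<^sub>R DH x (V x))"
    and W: "weak_gradient \<phi> W" "torus_Lp s W"
  shows "integrable torus (\<lambda>x. m x * (DH x (V x) \<bullet> W x))" "(LINT x|torus. m x * (DH x (V x) \<bullet> W x)) = 0"
proof -
  obtain C where C: "C > 0" "\<And>x p u. \<bar>DH x p \<bullet> u\<bar> \<le> C * (1 + norm p powr r + norm u powr r)"
    using DH_growth by metis
  have [measurable]: "m \<in> borel_measurable torus" "V \<in> borel_measurable torus" "W \<in> borel_measurable torus"
    using m V W by (auto simp: torus_Lp_def)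
  have im: "integrable torus (\<lambda>x. norm (m x) powr q)" and iV: "integrable torus (\<lambda>x. norm (V x) powr s)"
    and iW: "integrable torus (\<lambda>x. norm (W x) powr s)"
    using m V W by (auto simp: torus_Lp_def)
  have [measurable]: "(\<lambda>x. DH x (V x)) \<in> borel_measurable torus"
    by (rule torus_measurable_comp[OF H_props(5)]) measurable
  obtain \<psi> h where \<psi>: "\<And>n :: nat. smooth_periodic (\<psi> n)" and h: "integrable torus (h :: real ^ 'n \<Rightarrow> real)"
    and lim: "AE x in torus. (\<lambda>n. gradient (\<psi> n) x) \<longlonglongrightarrow> W x"
    and dom: "AE x in torus. \<forall>n. norm (gradient (\<psi> n) x) powr s \<le> h x"
    using weak_gradient_approximation[OF s_ge_1 W] by blast
  define k where "k x = C * (4 * norm (m x) powr q + 2 + norm (V x) powr s + norm (W x) powr s + \<bar>h x\<bar>)" for x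
  have ik: "integrable torus k" unfolding k_def using im iV iW h by simp
  have bound: "\<bar>m x * (DH x (V x) \<bullet> u)\<bar> \<le> C * (4 * norm (m x) powr q + 2 + norm (V x) powr s + norm u powr s)"
    if "m x \<ge> 0" for x u
  proof -
    have "\<bar>m x * (DH x (V x) \<bullet> u)\<bar> \<le> m x * (C * (1 + norm (V x) powr r + norm u powr r))"
      using C that by (auto simp: abs_mult intro!: mult_left_mono)
    also have "\<dots> = C * (m x * (1 + norm (V x) powr r + norm u powr r))" by simp
    also have "\<dots> \<le> C * (m x * (1 + norm (V x) powr r) + m x * (1 + norm u powr r))"
      using C that by (intro mult_left_mono) (auto simp: distrib_left)
    also have "\<dots> \<le> C * ((2 * m x powr q + 1 + norm (V x) powr s) + (2 * m x powr q + 1 + norm u powr s))"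
      using C by (intro mult_left_mono add_mono mass_times_growth that) auto
    finally show ?thesis using that by (simp add: algebra_simps)
  qed
  show "integrable torus (\<lambda>x. m x * (DH x (V x) \<bullet> W x))"
  proof (rule Bochner_Integration.integrable_bound[OF ik])
    show "AE x in torus. norm (m x * (DH x (V x) \<bullet> W x)) \<le> norm (k x)"
      using m(2)
    proof eventually_elim
      case (elim x)
      have "C * (4 * norm (m x) powr q + 2 + norm (V x) powr s + norm (W x) powr s) \<le> k x"
        unfolding k_def using C by (intro mult_left_mono) auto
      then show ?case using bound[OF elim, of "W x"] by simp
    qed
  qed measurable
  have meas\<psi>: "gradient (\<psi> n) \<in> borel_measurable torus" for n
    by (intro continuous_torus_measurable smooth_periodicD \<psi>)
  have "(\<lambda>n. LINT x|torus. m x * (DH x (V x) \<bullet> gradient (\<psi> n) x)) \<longlonglongrightarrow> (LINT x|torus. m x * (DH x (V x) \<bullet> W x))"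
  proof (rule integral_dominated_convergence[OF _ _ ik])
    show "AE x in torus. (\<lambda>n. m x * (DH x (V x) \<bullet> gradient (\<psi> n) x)) \<longlonglongrightarrow> m x * (DH x (V x) \<bullet> W x)"
      using lim by eventually_elim (intro tendsto_intros)
    show "AE x in torus. norm (m x * (DH x (V x) \<bullet> gradient (\<psi> n) x)) \<le> k x" for n
      using m(2) dom
    proof eventually_elim
      case (elim x)
      have "norm (gradient (\<psi> n) x) powr s \<le> norm (W x) powr s + \<bar>h x\<bar>"
        using elim(2) by (smt (verit) powr_ge_zero)
      then have "C * (4 * norm (m x) powr q + 2 + norm (V x) powr s + norm (gradient (\<psi> n) x) powr s) \<le> k x"
        unfolding k_def using C by (intro mult_left_mono) auto
      then show ?case using bound[OF elim(1), of "gradient (\<psi> n) x"] by simp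
    qed
  qed (use meas\<psi> in measurable)
  moreover have "(LINT x|torus. m x * (DH x (V x) \<bullet> gradient (\<psi> n) x)) = 0" for n
    using df \<psi>[of n] by (simp add: divergence_free_def)
  ultimately show "(LINT x|torus. m x * (DH x (V x) \<bullet> W x)) = 0"
    by (simp add: LIMSEQ_const_iff)
qed

text \<open>In \<open>weak_solution\<close> the exponent belongs to some weak gradient, while the
  equations use a possibly different representative. Almost everywhere uniqueness transfers the
  exponent to the latter.\<close>

lemma weak_solutionD:
  assumes "weak_solution r q H f c \<phi> m"
  obtains V where "weak_gradient \<phi> V" "torus_Lp s V" "torus_Lp q m" "AE x in torus. m x \<ge> 0"
    "(LINT x|torus. m x) = 1" "divergence_free (\<lambda>x. m x *\<^sub>R DH x (V x))"
    "AE x in torus. m x > 0 \<longrightarrow> c + H x (V x) = f x (m x)"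
    "AE x in torus. m x \<le> 0 \<longrightarrow> (\<forall>a>0. c + H x (V x) \<le> f x a)"
proof -
  obtain V where V: "weak_gradient \<phi> V" "AE x in torus. m x \<ge> 0"
    "(LINT x|torus. m x) = 1" "divergence_free (\<lambda>x. m x *\<^sub>R DH x (V x))"
    "AE x in torus. m x > 0 \<longrightarrow> ereal (c + H x (V x)) = coupling_ext f x (m x)"
    "AE x in torus. ereal (c + H x (V x)) \<le> coupling_ext f x (m x)"
    and m: "torus_Lp q m" and W1p: "torus_W1p s \<phi>"
    using assms by (auto simp: weak_solution_def s_def)
  obtain W where W: "weak_gradient \<phi> W" "torus_Lp s W"
    using W1p by (auto simp: torus_W1p_def)
  have eq: "AE x in torus. V x = W x" by (rule weak_gradient_unique[OF V(1) W(1)])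
  have Vmeas: "V \<in> borel_measurable torus" "periodic V" using V(1) by (auto simp: weak_gradient_def torus_Lp_def)
  have "integrable torus (\<lambda>x. norm (V x) powr s)"
  proof (rule Bochner_Integration.integrable_bound)
    show "integrable torus (\<lambda>x. norm (W x) powr s)" using W(2) by (simp add: torus_Lp_def)
    show "(\<lambda>x. norm (V x) powr s) \<in> borel_measurable torus" using Vmeas(1) by measurable
  qed (use eq in \<open>auto elim: eventually_mono\<close>)
  then have "torus_Lp s V" using Vmeas by (simp add: torus_Lp_def)
  moreover have "AE x in torus. m x > 0 \<longrightarrow> c + H x (V x) = f x (m x)"
    using V(5) by eventually_elim (simp add: coupling_ext_pos)
  moreover have "AE x in torus. m x \<le> 0 \<longrightarrow> (\<forall>a>0. c + H x (V x) \<le> f x a)"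
    using V(6) by eventually_elim (use coupling_ext_nonpos in blast)
  ultimately show ?thesis using that V(1-4) m by blast
qed

lemma weak_solution_unique:
  assumes "weak_solution r q H f c1 \<phi>1 m1" "weak_solution r q H f c2 \<phi>2 m2"
  shows "c1 = c2 \<and> (AE x in torus. m1 x = m2 x)"
proof -
  obtain V1 where 1: "weak_gradient \<phi>1 V1" "torus_Lp s V1" "torus_Lp q m1" "AE x in torus. m1 x \<ge> 0"
    "(LINT x|torus. m1 x) = 1" "divergence_free (\<lambda>x. m1 x *\<^sub>R DH x (V1 x))"
    "AE x in torus. m1 x > 0 \<longrightarrow> c1 + H x (V1 x) = f x (m1 x)"
    "AE x in torus. m1 x \<le> 0 \<longrightarrow> (\<forall>a>0. c1 + H x (V1 x) \<le> f x a)"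
    by (rule weak_solutionD[OF assms(1)])
  obtain V2 where 2: "weak_gradient \<phi>2 V2" "torus_Lp s V2" "torus_Lp q m2" "AE x in torus. m2 x \<ge> 0"
    "(LINT x|torus. m2 x) = 1" "divergence_free (\<lambda>x. m2 x *\<^sub>R DH x (V2 x))"
    "AE x in torus. m2 x > 0 \<longrightarrow> c2 + H x (V2 x) = f x (m2 x)"
    "AE x in torus. m2 x \<le> 0 \<longrightarrow> (\<forall>a>0. c2 + H x (V2 x) \<le> f x a)"
    by (rule weak_solutionD[OF assms(2)])
  define \<Delta> where "\<Delta> x = H x (V2 x) - H x (V1 x)" for x
  have im: "integrable torus m1" "integrable torus m2"
    using torus_Lp_integrable[OF 1(3)] torus_Lp_integrable[OF 2(3)] q by auto
  have i\<Delta>: "integrable torus (\<lambda>x. m1 x * \<Delta> x)" "integrable torus (\<lambda>x. m2 x * \<Delta> x)"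
    using mass_H_integrable[OF 1(3,4,2)] mass_H_integrable[OF 1(3,4) 2(2)]
      mass_H_integrable[OF 2(3,4,2)] mass_H_integrable[OF 2(3,4) 1(2)]
    by (simp_all add: \<Delta>_def right_diff_distrib)
  \<comment> \<open>Both V and W are admissible test gradients, so the linear term of the tangent
    inequality for H at V, weighted by m, integrates to 0.\<close>
  have conv: "(LINT x|torus. m x * (H x (W x) - H x (V x))) \<ge> 0"
    if "torus_Lp q m" "AE x in torus. m x \<ge> 0" "torus_Lp s V" "divergence_free (\<lambda>x. m x *\<^sub>R DH x (V x))"
      "weak_gradient \<phi> V" "weak_gradient \<eta> W" "torus_Lp s W" for m V W \<phi> \<eta>
  proof -
    note tV = divergence_free_weak_test[OF that(1-4) that(5,3)]
    note tW = divergence_free_weak_test[OF that(1-4) that(6,7)]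
    have "0 = (LINT x|torus. m x * (DH x (V x) \<bullet> W x) - m x * (DH x (V x) \<bullet> V x))"
      using tV tW by simp
    also have "\<dots> \<le> (LINT x|torus. m x * (H x (W x) - H x (V x)))"
    proof (rule integral_mono_AE)
      show "integrable torus (\<lambda>x. m x * (H x (W x) - H x (V x)))"
        using mass_H_integrable[OF that(1,2,3)] mass_H_integrable[OF that(1,2,7)] by (simp add: right_diff_distrib)
      show "AE x in torus. m x * (DH x (V x) \<bullet> W x) - m x * (DH x (V x) \<bullet> V x) \<le> m x * (H x (W x) - H x (V x))"
        using that(2)
      proof eventually_elim
        case (elim x)
        have "DH x (V x) \<bullet> (W x - V x) \<le> H x (W x) - H x (V x)"
          using H_tangent[of x "V x" "W x - V x"] by simp
        from mult_left_mono[OF this elim] show ?case by (simp add: inner_diff_right right_diff_distrib)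
      qed
    qed (use tV tW in simp)
    finally show ?thesis .
  qed
  have E1: "(LINT x|torus. m1 x * \<Delta> x) \<ge> 0"
    using conv[OF 1(3,4,2,6,1) 2(1,2)] by (simp add: \<Delta>_def)
  have "(LINT x|torus. - (m2 x * \<Delta> x)) \<ge> 0"
    using conv[OF 2(3,4,2,6,1) 1(1,2)] by (simp add: \<Delta>_def right_diff_distrib)
  then have E2: "(LINT x|torus. m2 x * \<Delta> x) \<le> 0" by simp
  \<comment> \<open>The Lasry-Lions integrand: the difference of the masses times the difference of
    the values c + H, which increase with the mass.\<close>
  define X where "X x = (m2 x - m1 x) * (\<Delta> x + (c2 - c1))" for x
  \<comment> \<open>At mass 0 only a \<le> f(x,z) for all z > 0 is known; z = \<nu>/2 recovers the
    strict inequality.\<close>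
  have strict: "a < b"
    if "\<mu> < \<nu>" "\<mu> \<ge> 0" "\<mu> > 0 \<longrightarrow> a = f x \<mu>" "\<mu> \<le> 0 \<longrightarrow> (\<forall>z>0. a \<le> f x z)" "b = f x \<nu>"
    for \<mu> \<nu> a b x
  proof (cases "\<mu> > 0")
    case True
    then show ?thesis using that f_props(3)[of \<mu> \<nu> x] by auto
  next
    case False
    then have "a \<le> f x (\<nu> / 2)" using that by auto
    also have "\<dots> < f x \<nu>" using that by (intro f_props(3)) auto
    finally show ?thesis using that by simp
  qed
  have X: "AE x in torus. X x \<ge> 0 \<and> (X x = 0 \<longrightarrow> m1 x = m2 x)"
    using 1(4,7,8) 2(4,7,8)
  proof eventually_elim
    case (elim x)
    define a where "a = c1 + H x (V1 x)"
    define b where "b = c2 + H x (V2 x)"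
    have X_eq: "X x = (m2 x - m1 x) * (b - a)" by (simp add: X_def \<Delta>_def a_def b_def)
    have lt: "a < b" if "m1 x < m2 x"
      by (rule strict[of "m1 x" "m2 x" _ x]) (use elim that in \<open>auto simp: a_def b_def\<close>)
    have gt: "b < a" if "m2 x < m1 x"
      by (rule strict[of "m2 x" "m1 x" _ x]) (use elim that in \<open>auto simp: a_def b_def\<close>)
    consider "m1 x < m2 x" | "m1 x = m2 x" | "m2 x < m1 x" by linarith
    then show ?case
    proof cases
      case 1
      then have "X x > 0" using lt unfolding X_eq by (intro mult_pos_pos) auto
      then show ?thesis by auto
    next
      case 3
      then have "X x > 0" using gt unfolding X_eq by (intro mult_neg_neg) auto
      then show ?thesis by auto
    qed (simp add: X_eq)
  qed
  have X_eq: "X = (\<lambda>x. m2 x * \<Delta> x - m1 x * \<Delta> x + (c2 - c1) * m2 x - (c2 - c1) * m1 x)"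
    by (rule ext) (simp add: X_def algebra_simps)
  have iX: "integrable torus X" unfolding X_eq using i\<Delta> im by simp
  have "(LINT x|torus. X x) = (LINT x|torus. m2 x * \<Delta> x) - (LINT x|torus. m1 x * \<Delta> x)"
    unfolding X_eq using i\<Delta> im 1(5) 2(5) by simp
  then have "(LINT x|torus. X x) \<le> 0" using E1 E2 by simp
  moreover have "(LINT x|torus. X x) \<ge> 0" using X by (intro integral_nonneg_AE) (auto elim: eventually_mono)
  ultimately have "(LINT x|torus. X x) = 0" by simp
  then have "AE x in torus. X x = 0"
    using integral_nonneg_eq_0_iff_AE[OF iX] X by (auto elim: eventually_mono)
  with X have eq: "AE x in torus. m1 x = m2 x" by eventually_elim simp
  \<comment> \<open>Where the common mass is positive both equations hold with the same right side,
    so \<Delta> is the constant c1 - c2. The opposite signs \<open>E1\<close> and \<open>E2\<close>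
    then force it to vanish.\<close>
  have "AE x in torus. m1 x * \<Delta> x = m1 x * (c1 - c2) \<and> m2 x * \<Delta> x = m2 x * (c1 - c2)"
    using eq 1(4,7) 2(7)
  proof eventually_elim
    case (elim x)
    then show ?case by (cases "m1 x > 0") (auto simp: \<Delta>_def)
  qed
  then have "AE x in torus. m1 x * \<Delta> x = m1 x * (c1 - c2)" "AE x in torus. m2 x * \<Delta> x = m2 x * (c1 - c2)"
    by (auto elim: eventually_mono)
  note ae = this
  have "(LINT x|torus. m1 x * \<Delta> x) = (LINT x|torus. m1 x * (c1 - c2))"
    by (intro integral_cong_AE ae borel_measurable_integrable i\<Delta> integrable_mult_left im)
  moreover have "(LINT x|torus. m2 x * \<Delta> x) = (LINT x|torus. m2 x * (c1 - c2))"
    by (intro integral_cong_AE ae borel_measurable_integrable i\<Delta> integrable_mult_left im)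
  ultimately have "c1 - c2 \<ge> 0" "c1 - c2 \<le> 0" using E1 E2 1(5) 2(5) by auto
  with eq show ?thesis by simp
qed

end

lemma periodic_continuous_bounded:
  fixes v :: "real ^ 'n \<Rightarrow> real"
  assumes "continuous_on UNIV v" "periodic v"
  obtains B where "B \<ge> 0" "\<And>x. \<bar>v x\<bar> \<le> B"
proof -
  obtain B where B: "\<And>y. y \<in> cbox 0 One \<Longrightarrow> \<bar>v y\<bar> \<le> B"
    using continuous_bounded_on_cube[OF assms(1)] by metis
  have "\<bar>v x\<bar> \<le> B" for x
  proof -
    define e :: "real ^ 'n" where "e = (\<chi> i. frac (x $ i))"
    have "\<forall>i. (x - e) $ i \<in> \<int>" by (simp add: e_def frac_def)
    then have "v (e + (x - e)) = v e" using assms(2) unfolding periodic_def by blast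
    moreover have "e \<in> cbox 0 One"
      unfolding mem_box_cart One_nth by (auto simp: e_def less_imp_le[OF frac_lt_1])
    ultimately show ?thesis using B[of e] by simp
  qed
  then show ?thesis using that[of "max 0 B"] by (simp add: le_max_iff_disj)
qed

text \<open>Suited to a generalised inverse, whose level sets are explicit while its modulus of
  continuity is not.\<close>

lemma continuous_on_UNIV_open_rays:
  fixes F :: "'a :: t2_space \<Rightarrow> real"
  assumes "\<And>a. open {z. F z < a}" "\<And>a. open {z. a < F z}"
  shows "continuous_on UNIV F"
proof -
  have "isCont F z" for z
    unfolding continuous_within
    by (rule order_tendstoI; unfold eventually_at_topological) (use assms in blast)+
  then show ?thesis by (simp add: continuous_at_imp_continuous_on)
qed

lemma continuous_on_compose_curried:
  assumes "continuous_on UNIV (\<lambda>(x, a). F x a)" "continuous_on A u" "continuous_on A w"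
  shows "continuous_on A (\<lambda>z. F (u z) (w z))"
  using continuous_on_compose2[OF assms(1) continuous_on_Pair[OF assms(2,3)]] by simp

context mfg
begin

section \<open>The convex conjugate of the potential of f\<close>

abbreviation p where "p \<equiv> q / (q - 1)"
abbreviation t where "t \<equiv> 1 / (q - 1)"

lemma p_t: "p = 1 + t" "t > 0" "p > 1" "t * q = p" "t * (q - 1) = 1"
  using q by (auto simp: field_simps)

text \<open>The generalised inverse of f(x, .), and the derivative of F*. The element 0 supplies its
  value where a is at or below the limit of f at 0+.\<close>

definition g :: "real ^ 'n \<Rightarrow> real \<Rightarrow> real" where
  "g x a = Sup ({0} \<union> {m. m > 0 \<and> f x m \<le> a})"

lemma f_growth:
  obtains C where "C > 0" "\<And>x m. m \<ge> 1 \<Longrightarrow> 1 / C * m powr (q - 1) - C \<le> f x m"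
    "\<And>x m. m \<ge> 1 \<Longrightarrow> f x m \<le> C * m powr (q - 1) + C"
  using coup unfolding coupling_def by blast

text \<open>The lower growth bound makes m^(q-1) at most affine in |a|, and \<open>t\<close> is the
  inverse exponent. Masses below 1, outside the range of the growth bound, are covered by
  \<open>K \<ge> 1\<close>.\<close>

lemma f_sublevel_bound:
  obtains C where "C > 0" "\<And>x a m. m > 0 \<Longrightarrow> f x m \<le> a \<Longrightarrow> m \<le> C * (1 + \<bar>a\<bar> powr t)"
proof -
  obtain C where C: "C > 0" "\<And>x m. m \<ge> 1 \<Longrightarrow> 1 / C * m powr (q - 1) - C \<le> f x m"
    using f_growth by metis
  define K where "K = 1 + 2 powr t * (C powr t + (C * C) powr t)"
  have K: "K \<ge> 1" by (simp add: K_def)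
  have "m \<le> K * (1 + \<bar>a\<bar> powr t)" if m: "m > 0" "f x m \<le> a" for x a m
  proof (cases "m \<ge> 1")
    case False
    have "1 * 1 \<le> K * (1 + \<bar>a\<bar> powr t)" using K by (intro mult_mono) auto
    then show ?thesis using False by simp
  next
    case True
    have "1 / C * m powr (q - 1) \<le> \<bar>a\<bar> + C" using C(2)[OF True, of x] m(2) by simp
    then have "m powr (q - 1) \<le> C * \<bar>a\<bar> + C * C" using C(1) by (simp add: field_simps)
    then have "(m powr (q - 1)) powr t \<le> (C * \<bar>a\<bar> + C * C) powr t"
      using p_t by (intro powr_mono2) auto
    also have "(m powr (q - 1)) powr t = m" using m q by (simp add: powr_powr)
    also have "(C * \<bar>a\<bar> + C * C) powr t \<le> 2 powr t * ((C * \<bar>a\<bar>) powr t + (C * C) powr t)"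
      using C p_t by (intro powr_sum_le_max) auto
    also have "\<dots> = 2 powr t * (C powr t * \<bar>a\<bar> powr t + (C * C) powr t * 1)"
      using C by (simp add: powr_mult)
    also have "\<dots> \<le> 2 powr t * (C powr t * (1 + \<bar>a\<bar> powr t) + (C * C) powr t * (1 + \<bar>a\<bar> powr t))"
      by (intro mult_left_mono add_mono) auto
    also have "\<dots> = (2 powr t * (C powr t + (C * C) powr t)) * (1 + \<bar>a\<bar> powr t)"
      by (simp add: algebra_simps)
    also have "\<dots> \<le> K * (1 + \<bar>a\<bar> powr t)"
      by (intro mult_right_mono) (auto simp: K_def)
    finally show ?thesis .
  qed
  then show ?thesis using that[of K] K by simp
qed

lemma g_bdd: "bdd_above ({0} \<union> {m. m > 0 \<and> f x m \<le> a})"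
proof -
  obtain C where C: "C > 0" "\<And>x a m. m > 0 \<Longrightarrow> f x m \<le> a \<Longrightarrow> m \<le> C * (1 + \<bar>a\<bar> powr t)"
    using f_sublevel_bound by metis
  then show ?thesis by (intro bdd_aboveI[of _ "C * (1 + \<bar>a\<bar> powr t)"]) auto
qed

lemma g_nonneg: "g x a \<ge> 0"
  unfolding g_def by (rule cSup_upper[OF _ g_bdd]) simp

lemma g_growth:
  obtains C where "C > 0" "\<And>x a. g x a \<le> C * (1 + \<bar>a\<bar> powr t)"
proof -
  obtain C where C: "C > 0" "\<And>x a m. m > 0 \<Longrightarrow> f x m \<le> a \<Longrightarrow> m \<le> C * (1 + \<bar>a\<bar> powr t)"
    using f_sublevel_bound by metis
  then show ?thesis
    using that[of C] unfolding g_def by (force intro!: cSup_least)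
qed

lemma continuous_f_slice: "m > 0 \<Longrightarrow> continuous_on UNIV (\<lambda>x. f x m)" "continuous_on {0<..} (f x)"
proof -
  show "continuous_on UNIV (\<lambda>x. f x m)" if "m > 0"
    using continuous_on_compose2[OF f_props(2) continuous_on_Pair[OF continuous_on_id continuous_on_const[of UNIV m]]] that
    by auto
  show "continuous_on {0<..} (f x)"
    using continuous_on_compose2[OF f_props(2) continuous_on_Pair[OF continuous_on_const[of "{0<..}" x] continuous_on_id]]
    by auto
qed

text \<open>The Galois connection behind the inverse relations and the continuity of g. It holds
  since the supremum is attained: if f(x,m) > a, left continuity gives the same slightly below m,
  which caps g strictly below m.\<close>

lemma g_ge_iff:
  assumes "m > 0"
  shows "m \<le> g x a \<longleftrightarrow> f x m \<le> a"
proof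
  assume "f x m \<le> a"
  then show "m \<le> g x a" unfolding g_def using assms by (intro cSup_upper[OF _ g_bdd]) auto
next
  assume le: "m \<le> g x a"
  show "f x m \<le> a"
  proof (rule ccontr)
    assume "\<not> f x m \<le> a"
    then have "a < f x m" by simp
    have "isCont (f x) m"
      using continuous_f_slice(2)[of x] assms by (simp add: continuous_on_eq_continuous_at)
    then have "(f x \<longlongrightarrow> f x m) (at_left m)"
      unfolding isCont_def by (rule tendsto_mono[OF at_le, rotated]) simp
    then have "eventually (\<lambda>m'. a < f x m') (at_left m)"
      using \<open>a < f x m\<close> by (rule order_tendstoD)
    moreover have "eventually (\<lambda>m'. m' > 0 \<and> m' < m) (at_left m)"
      using eventually_at_left_real[OF assms] by (auto elim: eventually_mono)
    ultimately have "eventually (\<lambda>m'. a < f x m' \<and> m' > 0 \<and> m' < m) (at_left m)"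
      by eventually_elim simp
    then obtain m' where m': "a < f x m'" "m' > 0" "m' < m"
      using eventually_happens[of _ "at_left m"] by auto
    have "g x a \<le> m'"
      unfolding g_def
    proof (rule cSup_least)
      fix y assume "y \<in> {0} \<union> {m. m > 0 \<and> f x m \<le> a}"
      then show "y \<le> m'"
        using m' f_mono[of m' y x] by (cases "y \<le> m'") auto
    qed simp
    with le m'(3) show False by simp
  qed
qed

lemma g_mono: "a \<le> b \<Longrightarrow> g x a \<le> g x b"
  unfolding g_def by (rule cSup_subset_mono) (auto intro: g_bdd[simplified])

lemma g_f: "m > 0 \<Longrightarrow> g x (f x m) = m"
proof -
  assume m: "m > 0"
  have "m \<le> g x (f x m)" using g_ge_iff[OF m] by simp
  moreover have "\<not> m < g x (f x m)"
  proof
    assume "m < g x (f x m)"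
    then have "f x (g x (f x m)) \<le> f x m" using g_ge_iff[of "g x (f x m)" x "f x m"] m by simp
    moreover have "f x m < f x (g x (f x m))" using m \<open>m < g x (f x m)\<close> by (intro f_props(3))
    ultimately show False by simp
  qed
  ultimately show ?thesis by simp
qed

text \<open>If f(x, g x a) were less than a, right continuity would admit a slightly larger mass to
  the sublevel set.\<close>

lemma f_g: "g x a > 0 \<Longrightarrow> f x (g x a) = a"
proof (rule antisym)
  assume pos: "g x a > 0"
  show "f x (g x a) \<le> a" using g_ge_iff[OF pos, of x a] by simp
  show "a \<le> f x (g x a)"
  proof (rule ccontr)
    assume "\<not> a \<le> f x (g x a)"
    then have lt: "f x (g x a) < a" by simp
    have "isCont (f x) (g x a)"
      using continuous_f_slice(2)[of x] pos by (simp add: continuous_on_eq_continuous_at)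
    then have "(f x \<longlongrightarrow> f x (g x a)) (at_right (g x a))"
      unfolding isCont_def by (rule tendsto_mono[OF at_le, rotated]) simp
    then have "eventually (\<lambda>m'. f x m' < a) (at_right (g x a))"
      using lt by (rule order_tendstoD)
    moreover have "eventually (\<lambda>m'. g x a < m') (at_right (g x a))"
      by (rule eventually_at_right_less)
    ultimately have "eventually (\<lambda>m'. f x m' < a \<and> g x a < m') (at_right (g x a))"
      by eventually_elim simp
    then obtain m' where m': "f x m' < a" "g x a < m'"
      using eventually_happens[of _ "at_right (g x a)"] by auto
    then show False using g_ge_iff[of m' x a] pos by simp
  qed
qed

lemma g_periodic: "periodic (\<lambda>x. g x a)"
  unfolding periodic_def
proof (intro allI impI)
  fix x k :: "real ^ 'n" assume k: "\<forall>i. k $ i \<in> \<int>"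
  have "{m. m > 0 \<and> f (x + k) m \<le> a} = {m. m > 0 \<and> f x m \<le> a}"
    using f_props(1) k unfolding periodic_def by auto
  then show "g (x + k) a = g x a" by (simp add: g_def)
qed

text \<open>By the Galois connection, strict sub- and superlevel sets of g are given by strict
  inequalities for f at fixed masses, which are open jointly in x and a.\<close>

lemma g_continuous: "continuous_on UNIV (\<lambda>(x, a). g x a)"
proof (rule continuous_on_UNIV_open_rays)
  have cf: "continuous_on UNIV (\<lambda>z. f (fst z) m)" if "m > 0" for m
    by (rule continuous_on_compose2[OF continuous_f_slice(1)[OF that]]) (auto intro: continuous_intros)
  fix m :: real
  show "open {z. (case z of (x, a) \<Rightarrow> g x a) < m}"
  proof (cases "m > 0")
    case True
    have "{z. (case z of (x, a) \<Rightarrow> g x a) < m} = {z. snd z < f (fst z) m}"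
      using g_ge_iff[OF True] by (auto simp: not_le[symmetric])
    then show ?thesis by (simp add: open_Collect_less cf[OF True] continuous_on_snd continuous_on_id)
  next
    case False
    have "\<not> g x a < m" for x a using g_nonneg[of x a] False by simp
    then have "{z. (case z of (x, a) \<Rightarrow> g x a) < m} = {}" by auto
    then show ?thesis by (simp only: open_empty)
  qed
  show "open {z. m < (case z of (x, a) \<Rightarrow> g x a)}"
  proof (cases "m \<ge> 0")
    case True
    have eq: "m < g x a \<longleftrightarrow> (\<exists>m'>m. f x m' < a)" for x a
    proof
      assume lt: "m < g x a"
      obtain m' where m': "m < m'" "m' < g x a" using dense lt by blast
      then have "f x m' < f x (g x a)" using True by (intro f_props(3)) auto
      also have "\<dots> = a" using True lt by (intro f_g) auto
      finally show "\<exists>m'>m. f x m' < a" using m' by blast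
    next
      assume "\<exists>m'>m. f x m' < a"
      then obtain m' where "m' > m" "f x m' < a" by blast
      then show "m < g x a" using g_ge_iff[of m' x a] True by auto
    qed
    have "{z. m < (case z of (x, a) \<Rightarrow> g x a)} = (\<Union>m'\<in>{m<..}. {z. f (fst z) m' < snd z})"
      using eq by auto
    then show ?thesis
      using True by (auto intro!: open_UN open_Collect_less cf continuous_on_snd continuous_on_id)
  next
    case False
    have "m < g x a" for x a using g_nonneg[of x a] False by simp
    then have "{z. m < (case z of (x, a) \<Rightarrow> g x a)} = UNIV" by auto
    then show ?thesis by (simp only: open_UNIV)
  qed
qed

lemma g_continuous_slice: "continuous_on A (g x)"
  by (rule continuous_on_compose_curried[OF g_continuous]) (intro continuous_intros)+

text \<open>The antiderivative of g(x, .) vanishing at 0, that is, F* up to a function of x.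
  Rescaling to [0,1] covers both signs of a and reduces joint continuity to a parameter integral
  over a fixed interval.\<close>

definition G :: "real ^ 'n \<Rightarrow> real \<Rightarrow> real" where
  "G x a = a * integral {0..1} (\<lambda>u. g x (a * u))"

lemma G_continuous: "continuous_on UNIV (\<lambda>(x, a). G x a)"
proof -
  have "continuous_on (UNIV \<times> cbox 0 1) (\<lambda>(z, u). g (fst z) (snd z * u))"
    unfolding case_prod_unfold
    by (intro continuous_on_compose_curried[OF g_continuous] continuous_intros)
  then have "continuous_on UNIV (\<lambda>z. integral (cbox 0 1) (\<lambda>u. g (fst z) (snd z * u)))"
    by (rule integral_continuous_on_param)
  then show ?thesis
    unfolding G_def case_prod_unfold by (auto intro!: continuous_intros)
qed

lemma G_deriv: "(G x has_real_derivative g x a) (at a)"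
proof -
  define N where "N = \<bar>a\<bar> + 1"
  \<comment> \<open>Based at -N, which lies to the left of 0 and of all points near a, so that the
    derivative is two-sided wherever it is used.\<close>
  define P where "P b = integral {- N..b} (g x)" for b
  have P: "(P has_real_derivative g x b) (at b)" if "\<bar>b\<bar> < N" for b
  proof -
    have "((\<lambda>b. integral {- N..b} (g x)) has_real_derivative g x b) (at b within {- N..N})"
      using that by (intro integral_has_real_derivative g_continuous_slice) auto
    moreover have "at b within {- N..N} = at b"
      using that by (intro at_within_interior) auto
    ultimately show ?thesis by (simp add: P_def[abs_def])
  qed
  have eq: "G x b = P b - P 0" if b: "\<bar>b\<bar> < N" for b
  proof -
    have "((\<lambda>u. b * g x (b * u)) has_integral (P (b * 1) - P (b * 0))) {0..1}"
    proof (rule fundamental_theorem_of_calculus)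
      fix u :: real assume u: "u \<in> {0..1}"
      have "\<bar>b * u\<bar> \<le> \<bar>b\<bar> * 1" unfolding abs_mult using u by (intro mult_left_mono) auto
      then have "\<bar>b * u\<bar> < N" using b by simp
      from P[OF this] have "(P has_real_derivative g x (b * u)) (at (b * u) within (\<lambda>u. b * u) ` {0..1})"
        by (rule has_field_derivative_at_within)
      moreover have "((\<lambda>u. b * u) has_real_derivative b) (at u within {0..1})"
        by (auto intro!: derivative_eq_intros)
      ultimately have "((\<lambda>u. P (b * u)) has_real_derivative g x (b * u) * b) (at u within {0..1})"
        using DERIV_image_chain[of P "g x (b * u)" "\<lambda>u. b * u" u "{0..1}" b] by (simp add: o_def)
      then show "((\<lambda>u. P (b * u)) has_vector_derivative b * g x (b * u)) (at u within {0..1})"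
        by (simp add: has_real_derivative_iff_has_vector_derivative mult.commute)
    qed simp
    from integral_unique[OF this] show ?thesis by (simp add: G_def)
  qed
  have "((\<lambda>b. P b - P 0) has_real_derivative g x a) (at a)"
    using P[of a] by (auto intro!: derivative_eq_intros simp: N_def)
  moreover have "eventually (\<lambda>b. G x b = P b - P 0) (nhds a)"
  proof -
    have "eventually (\<lambda>b. b \<in> {- N<..<N}) (nhds a)"
      by (intro eventually_nhds_in_open) (auto simp: N_def)
    then show ?thesis by eventually_elim (auto intro!: eq)
  qed
  ultimately show ?thesis
    using DERIV_cong_ev[of a a "G x" "\<lambda>b. P b - P 0" "g x a" "g x a"] by simp
qed

lemma G_mvt: "\<exists>z. \<bar>z\<bar> \<le> max \<bar>a\<bar> \<bar>b\<bar> \<and> (a \<le> b \<longrightarrow> a \<le> z \<and> z \<le> b) \<and> (b \<le> a \<longrightarrow> b \<le> z \<and> z \<le> a) \<and> G x b - G x a = g x z * (b - a)"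
proof (cases a b rule: linorder_cases)
  case less
  from MVT2[OF less, of "G x" "g x"] G_deriv obtain z where z: "a < z" "z < b" "G x b - G x a = (b - a) * g x z"
    by blast
  then show ?thesis by (intro exI[of _ z]) (auto simp: mult.commute)
next
  case greater
  from MVT2[OF greater, of "G x" "g x"] G_deriv obtain z where z: "b < z" "z < a" "G x a - G x b = (a - b) * g x z"
    by blast
  then show ?thesis by (intro exI[of _ z]) (auto simp: algebra_simps)
qed (auto intro!: exI[of _ a])

text \<open>The mean value theorem with the nondecreasing derivative g(x, .).\<close>

lemma G_tangent: "G x a + g x a * (b - a) \<le> G x b"
proof -
  obtain z where z: "a \<le> b \<longrightarrow> a \<le> z \<and> z \<le> b" "b \<le> a \<longrightarrow> b \<le> z \<and> z \<le> a" "G x b - G x a = g x z * (b - a)"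
    using G_mvt by blast
  have "g x a * (b - a) \<le> g x z * (b - a)"
  proof (cases "a \<le> b")
    case True
    then show ?thesis using z g_mono[of a z x] by (intro mult_right_mono) auto
  next
    case False
    then show ?thesis using z g_mono[of z a x] by (intro mult_right_mono_neg) auto
  qed
  with z(3) show ?thesis by simp
qed

lemma G_mono: "a \<le> b \<Longrightarrow> G x a \<le> G x b"
proof -
  assume "a \<le> b"
  then have "0 \<le> g x a * (b - a)" using g_nonneg by simp
  then show ?thesis using G_tangent[of x a b] by simp
qed

lemma G_0: "G x 0 = 0"
  by (simp add: G_def)

lemma G_growth:
  obtains C where "C > 0" "\<And>x a. \<bar>G x a\<bar> \<le> C * (1 + \<bar>a\<bar> powr p)"
proof -
  obtain C where C: "C > 0" "\<And>x a. g x a \<le> C * (1 + \<bar>a\<bar> powr t)"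
    using g_growth by metis
  have "\<bar>G x a\<bar> \<le> 2 * C * (1 + \<bar>a\<bar> powr p)" for x a
  proof -
    obtain z where z: "\<bar>z\<bar> \<le> \<bar>a\<bar>" "G x a = g x z * a"
      using G_mvt[of 0 a x] by (auto simp: G_0)
    have "g x z \<le> g x \<bar>a\<bar>" using z by (intro g_mono) auto
    also have "\<dots> \<le> C * (1 + \<bar>a\<bar> powr t)" using C(2)[of x "\<bar>a\<bar>"] by simp
    finally have "\<bar>G x a\<bar> \<le> (C * (1 + \<bar>a\<bar> powr t)) * \<bar>a\<bar>"
      unfolding z(2) abs_mult using g_nonneg[of x z] by (intro mult_mono) auto
    also have "\<dots> = C * (\<bar>a\<bar> + \<bar>a\<bar> powr p)"
      unfolding p_t(1) by (cases "a = 0") (auto simp: powr_add algebra_simps)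
    also have "\<dots> \<le> C * (2 * (1 + \<bar>a\<bar> powr p))"
    proof (intro mult_left_mono)
      have "\<bar>a\<bar> \<le> 1 + \<bar>a\<bar> powr p"
        using powr_mono[of 1 p "\<bar>a\<bar>"] p_t(3) by (cases "\<bar>a\<bar> \<le> 1") (auto simp: add_increasing2)
      then show "\<bar>a\<bar> + \<bar>a\<bar> powr p \<le> 2 * (1 + \<bar>a\<bar> powr p)" by simp
    qed (use C in simp)
    finally show ?thesis by (simp add: algebra_simps)
  qed
  then show ?thesis using that[of "2 * C"] C by simp
qed

text \<open>The tangent at a = f(x,m), where g equals m, so every positive slope is available;
  f(x,m) is bounded in x by periodicity. Slopes on both sides of 1 later control the constant
  c.\<close>

lemma G_linear_lower:
  assumes m: "m > 0"
  obtains K where "\<And>x a. m * a - K \<le> G x a"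
proof -
  obtain B where B: "B \<ge> 0" "\<And>x. \<bar>f x m\<bar> \<le> B"
    using periodic_continuous_bounded[OF continuous_f_slice(1)[OF m] f_props(1)[OF m]] by metis
  obtain C where C: "C > 0" "\<And>x a. \<bar>G x a\<bar> \<le> C * (1 + \<bar>a\<bar> powr p)"
    using G_growth by metis
  have "m * a - (C * (1 + B powr p) + m * B) \<le> G x a" for x a
  proof -
    have "\<bar>G x (f x m)\<bar> \<le> C * (1 + B powr p)"
      using C(1) B p_t by (intro order_trans[OF C(2)] mult_left_mono add_left_mono powr_mono2) auto
    moreover have "G x (f x m) + m * (a - f x m) \<le> G x a"
      using G_tangent[of x "f x m" a] g_f[OF m] by simp
    moreover have "m * f x m \<le> m * B" using B(2)[of x] m by (intro mult_left_mono) auto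
    ultimately show ?thesis by (simp add: algebra_simps)
  qed
  then show ?thesis using that by blast
qed

text \<open>The upper growth bound on f gives a lower bound of order a^t for g, and the tangent to G
  at a/2 raises it to order a^p for G.\<close>

lemma G_power_lower:
  obtains A c where "A > 0" "c > 0" "\<And>x a. a \<ge> A \<Longrightarrow> c * a powr p \<le> G x a"
proof -
  obtain C where C: "C > 0" "\<And>x m. m \<ge> 1 \<Longrightarrow> f x m \<le> C * m powr (q - 1) + C"
    using f_growth by metis
  have gl: "(a / (2 * C)) powr t \<le> g x a" if a: "a \<ge> 2 * C" for x a
  proof -
    \<comment> \<open>The solution of C m^(q-1) + C = a, for which the upper growth bound reads
      f(x,m) \<le> a.\<close>
    define m where "m = ((a - C) / C) powr t"
    have 1: "1 \<le> (a - C) / C" using a C by (simp add: field_simps)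
    then have m1: "m \<ge> 1" using p_t by (simp add: m_def ge_one_powr_ge_zero)
    have "m powr (q - 1) = (a - C) / C" using 1 powr_one[of "(a - C) / C"] by (simp only: m_def powr_powr p_t(5))
    then have "f x m \<le> a" using C(2)[OF m1, of x] C(1) by (simp add: field_simps)
    then have "m \<le> g x a" using g_ge_iff[of m x a] m1 by simp
    moreover have "a / (2 * C) \<le> (a - C) / C" using a C by (simp add: field_simps)
    then have "(a / (2 * C)) powr t \<le> m" unfolding m_def using a C p_t by (intro powr_mono2) auto
    ultimately show ?thesis by simp
  qed
  have "(1 / 2) * (1 / (4 * C)) powr t * a powr p \<le> G x a" if a: "a \<ge> 4 * C" for x a
  proof -
    have "G x (a / 2) + g x (a / 2) * (a - a / 2) \<le> G x a" by (rule G_tangent)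
    moreover have "0 \<le> G x (a / 2)" using G_mono[of 0 "a / 2" x] a C by (simp add: G_0)
    moreover have "(a / 2 / (2 * C)) powr t * (a - a / 2) \<le> g x (a / 2) * (a - a / 2)"
      using gl[of "a / 2" x] a C by (intro mult_right_mono) auto
    moreover have "(a / 2 / (2 * C)) powr t * (a - a / 2) = (1 / 2) * (1 / (4 * C)) powr t * a powr p"
    proof -
      have "a / 2 / (2 * C) = 1 / (4 * C) * a" by simp
      then have "(a / 2 / (2 * C)) powr t = (1 / (4 * C)) powr t * a powr t"
        using a C by (simp only: powr_mult)
      then show ?thesis using a C unfolding p_t(1) by (simp add: powr_add)
    qed
    ultimately show ?thesis by linarith
  qed
  then show ?thesis using that[of "4 * C" "(1 / 2) * (1 / (4 * C)) powr t"] C by simp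
qed

section \<open>The convex functional\<close>

definition L :: "real ^ 'n \<Rightarrow> real \<Rightarrow> real ^ 'n \<Rightarrow> real" where
  "L x c v = G x (c + H x v)"

text \<open>The tangent inequalities of G and of H compose because the slope g is
  nonnegative.\<close>

lemma L_tangent:
  "L x c v + g x (c + H x v) * (\<delta> + DH x v \<bullet> \<xi>) \<le> L x (c + \<delta>) (v + \<xi>)"
proof -
  have "g x (c + H x v) * (\<delta> + DH x v \<bullet> \<xi>) \<le> g x (c + H x v) * ((c + \<delta> + H x (v + \<xi>)) - (c + H x v))"
    using H_tangent[of x v \<xi>] g_nonneg by (intro mult_left_mono) auto
  then show ?thesis
    using G_tangent[of x "c + H x v" "c + \<delta> + H x (v + \<xi>)"] by (simp add: L_def)
qed

text \<open>Tangents at the intermediate point, taken towards both ends; the weights 1 - \<theta>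
  and \<theta> cancel the slope term \<open>k\<close>.\<close>

lemma L_convex:
  assumes "0 \<le> \<theta>" "\<theta> \<le> 1"
  shows "L x (c + \<theta> * \<delta>) (v + \<theta> *\<^sub>R \<xi>) \<le> (1 - \<theta>) * L x c v + \<theta> * L x (c + \<delta>) (v + \<xi>)"
proof -
  define l where "l = L x (c + \<theta> * \<delta>) (v + \<theta> *\<^sub>R \<xi>)"
  define k where "k = g x (c + \<theta> * \<delta> + H x (v + \<theta> *\<^sub>R \<xi>)) * (\<delta> + DH x (v + \<theta> *\<^sub>R \<xi>) \<bullet> \<xi>)"
  have "l - \<theta> * k \<le> L x c v"
    using L_tangent[of x "c + \<theta> * \<delta>" "v + \<theta> *\<^sub>R \<xi>" "- \<theta> * \<delta>" "- \<theta> *\<^sub>R \<xi>"] by (simp add: l_def k_def algebra_simps)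
  moreover have "l + (1 - \<theta>) * k \<le> L x (c + \<delta>) (v + \<xi>)"
    using L_tangent[of x "c + \<theta> * \<delta>" "v + \<theta> *\<^sub>R \<xi>" "(1 - \<theta>) * \<delta>" "(1 - \<theta>) *\<^sub>R \<xi>"] by (simp add: l_def k_def algebra_simps)
  ultimately have "(1 - \<theta>) * (l - \<theta> * k) + \<theta> * (l + (1 - \<theta>) * k) \<le> (1 - \<theta>) * L x c v + \<theta> * L x (c + \<delta>) (v + \<xi>)"
    using assms by (intro add_mono mult_left_mono) auto
  then show ?thesis unfolding l_def[symmetric] by (simp add: algebra_simps)
qed

text \<open>H grows with exponent r, and r p = s.\<close>

lemma a_growth:
  obtains K where "K > 0" "\<And>x c v. \<bar>c + H x v\<bar> powr p \<le> K * (1 + \<bar>c\<bar> powr p + norm v powr s)"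
proof -
  obtain C where C: "C > 0" "\<And>x v. \<bar>H x v\<bar> \<le> C * (1 + norm v powr r)"
    using H_growth by metis
  define d where "d = 2 powr p"
  have d: "d > 0" by (simp add: d_def)
  define K where "K = d + d * (C powr p * d)"
  have "\<bar>c + H x v\<bar> powr p \<le> K * (1 + \<bar>c\<bar> powr p + norm v powr s)" for x c v
  proof -
    have "\<bar>c + H x v\<bar> powr p \<le> (\<bar>c\<bar> + C * (1 + norm v powr r)) powr p"
      using C(2)[of x v] p_t by (intro powr_mono2) auto
    also have "\<dots> \<le> d * (\<bar>c\<bar> powr p + (C * (1 + norm v powr r)) powr p)"
      unfolding d_def using C p_t by (intro powr_sum_le_max) auto
    also have "(C * (1 + norm v powr r)) powr p = C powr p * (1 + norm v powr r) powr p"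
      using C by (simp add: powr_mult)
    also have "d * (\<bar>c\<bar> powr p + \<dots>) \<le> d * (\<bar>c\<bar> powr p + C powr p * (d * (1 powr p + (norm v powr r) powr p)))"
      unfolding d_def using p_t by (intro mult_left_mono add_left_mono powr_sum_le_max) auto
    also have "\<dots> = d * \<bar>c\<bar> powr p + d * (C powr p * d) * (1 + norm v powr s)"
      by (simp add: powr_r_conj algebra_simps)
    also have "\<dots> \<le> d * (1 + \<bar>c\<bar> powr p + norm v powr s) + d * (C powr p * d) * (1 + \<bar>c\<bar> powr p + norm v powr s)"
      using d by (intro add_mono mult_left_mono) auto
    also have "\<dots> = K * (1 + \<bar>c\<bar> powr p + norm v powr s)" by (simp add: K_def distrib_right)
    finally show ?thesis .
  qed
  moreover have "K > 0" unfolding K_def using d by (simp add: add_pos_nonneg)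
  ultimately show ?thesis using that by blast
qed

lemma L_growth:
  obtains K where "K > 0" "\<And>x c v. \<bar>L x c v\<bar> \<le> K * (1 + \<bar>c\<bar> powr p + norm v powr s)"
proof -
  obtain C where C: "C > 0" "\<And>x a. \<bar>G x a\<bar> \<le> C * (1 + \<bar>a\<bar> powr p)" using G_growth by metis
  obtain K where K: "K > 0" "\<And>x c v. \<bar>c + H x v\<bar> powr p \<le> K * (1 + \<bar>c\<bar> powr p + norm v powr s)"
    using a_growth by metis
  have "\<bar>L x c v\<bar> \<le> C * (1 + K) * (1 + \<bar>c\<bar> powr p + norm v powr s)" for x c v
  proof -
    have "\<bar>L x c v\<bar> \<le> C * (1 + K * (1 + \<bar>c\<bar> powr p + norm v powr s))"
      unfolding L_def using C(1) K(2)[of c x v] by (intro order_trans[OF C(2)] mult_left_mono) auto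
    also have "\<dots> \<le> C * ((1 + K) * (1 + \<bar>c\<bar> powr p + norm v powr s))"
      using C(1) K(1) by (intro mult_left_mono) (auto simp: distrib_right)
    finally show ?thesis by simp
  qed
  then show ?thesis using that[of "C * (1 + K)"] C K by simp
qed

lemma L_linear_lower:
  assumes "m > 0"
  obtains K where "\<And>x c v. m * c - K \<le> L x c v"
proof -
  obtain K where K: "\<And>x a. m * a - K \<le> G x a" using G_linear_lower[OF assms] by metis
  obtain C \<kappa> where C: "C > 0" "\<kappa> > 0" "\<And>x v. \<kappa> * norm v powr r - C \<le> H x v"
    using H_growth by metis
  have "m * c - (K + m * C) \<le> L x c v" for x c v
  proof -
    have "0 \<le> \<kappa> * norm v powr r" using C by simp
    then have "- C \<le> H x v" using C(3)[of v x] by linarith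
    then have "m * (c - C) \<le> m * (c + H x v)" using assms by (intro mult_left_mono) auto
    then show ?thesis using K[of "c + H x v" x] unfolding L_def by (simp add: algebra_simps)
  qed
  then show ?thesis using that by blast
qed

lemma L_coercive:
  obtains K \<kappa> where "\<kappa> > 0" "\<And>x c v. \<bar>c\<bar> \<le> B \<Longrightarrow> \<kappa> * norm v powr s - K \<le> L x c v"
proof -
  obtain C \<kappa> where C: "C > 0" "\<kappa> > 0" "\<And>x v. \<kappa> * norm v powr r - C \<le> H x v"
    using H_growth by metis
  obtain A d where A: "A > 0" "d > 0" "\<And>x a. a \<ge> A \<Longrightarrow> d * a powr p \<le> G x a"
    using G_power_lower by metis
  obtain K1 where K1: "\<And>x c v. 1 * c - K1 \<le> L x c v"
    using L_linear_lower[of 1] by auto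
  define \<kappa>' where "\<kappa>' = d * (\<kappa> / 2) powr p"
  \<comment> \<open>Beyond Y one half of the growth term of H absorbs C + |B|, and the other half is
    at least A, where the power bound on G begins.\<close>
  define Y where "Y = (2 * (C + \<bar>B\<bar>) + 2 * A) / \<kappa>"
  have \<kappa>': "\<kappa>' > 0" using A C by (simp add: \<kappa>'_def)
  have "\<kappa>' * norm v powr s - (\<kappa>' * Y powr p + \<bar>K1\<bar> + \<bar>B\<bar>) \<le> L x c v" if c: "\<bar>c\<bar> \<le> B" for x c v
  proof (cases "norm v powr r \<ge> Y")
    case True
    have y: "\<kappa> * norm v powr r \<ge> 2 * (C + \<bar>B\<bar>) + 2 * A"
      using mult_left_mono[OF True, of \<kappa>] C by (simp add: Y_def)
    then have "c + H x v \<ge> \<kappa> / 2 * norm v powr r" using C(1) C(3)[of v x] c A by simp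
    then have "G x (\<kappa> / 2 * norm v powr r) \<le> L x c v" unfolding L_def by (rule G_mono)
    moreover have "d * (\<kappa> / 2 * norm v powr r) powr p \<le> G x (\<kappa> / 2 * norm v powr r)"
      using y C by (intro A(3)) simp
    moreover have "(\<kappa> / 2 * norm v powr r) powr p = (\<kappa> / 2) powr p * norm v powr s"
      using C by (simp add: powr_mult powr_r_conj powr_divide)
    ultimately have "\<kappa>' * norm v powr s \<le> L x c v" by (simp add: \<kappa>'_def mult.assoc)
    moreover have "0 \<le> \<kappa>' * Y powr p" using \<kappa>' by simp
    ultimately show ?thesis by linarith
  next
    case False
    then have "(norm v powr r) powr p \<le> Y powr p" using p_t by (intro powr_mono2) auto
    then have "\<kappa>' * norm v powr s \<le> \<kappa>' * Y powr p" using \<kappa>' unfolding powr_r_conj by (intro mult_left_mono) auto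
    then show ?thesis using K1[of c x v] c by linarith
  qed
  then show ?thesis using that \<kappa>' by blast
qed

lemma L_continuous: "continuous_on UNIV (\<lambda>(x, c, v). L x c v)"
  unfolding L_def case_prod_unfold
  by (intro continuous_on_compose_curried[OF G_continuous] continuous_on_compose_curried[OF H_props(2)] continuous_intros)

lemma L_measurable:
  assumes "V \<in> borel_measurable torus"
  shows "(\<lambda>x. L x c (V x)) \<in> borel_measurable torus"
proof (rule torus_measurable_comp[OF _ assms])
  show "continuous_on UNIV (\<lambda>(x, v). L x c v)"
    unfolding L_def case_prod_unfold
    by (intro continuous_on_compose_curried[OF G_continuous] continuous_on_compose_curried[OF H_props(2)] continuous_intros)
qed

lemma L_integrable:
  fixes V :: "real ^ 'n \<Rightarrow> real ^ 'n"
  assumes "V \<in> borel_measurable torus" "integrable torus (\<lambda>x. norm (V x) powr s)"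
  shows "integrable torus (\<lambda>x. L x c (V x))"
proof -
  obtain K where K: "K > 0" "\<And>x c v. \<bar>L x c v\<bar> \<le> K * (1 + \<bar>c\<bar> powr p + norm v powr s)"
    using L_growth by metis
  show ?thesis
  proof (rule Bochner_Integration.integrable_bound)
    show "integrable torus (\<lambda>x. K * (1 + \<bar>c\<bar> powr p + norm (V x) powr s))" using assms by simp
    show "AE x in torus. norm (L x c (V x)) \<le> norm (K * (1 + \<bar>c\<bar> powr p + norm (V x) powr s))"
      using order_trans[OF K(2) abs_ge_self] by (auto intro!: AE_I2)
  qed (rule L_measurable[OF assms(1)])
qed


section \<open>Existence\<close>

definition J :: "real \<Rightarrow> (real ^ 'n \<Rightarrow> real ^ 'n) \<Rightarrow> real" where
  "J c V = (LINT x|torus. L x c (V x)) - c"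

lemma smooth_gradient_Lp:
  assumes "smooth_periodic \<psi>"
  shows "gradient \<psi> \<in> borel_measurable torus" "integrable torus (\<lambda>x. norm (gradient \<psi> x) powr s)"
proof -
  note c = smooth_periodicD(6)[OF assms]
  show "gradient \<psi> \<in> borel_measurable torus" by (rule continuous_torus_measurable[OF c])
  show "integrable torus (\<lambda>x. norm (gradient \<psi> x) powr s)"
    using s_pos by (intro torus_continuous continuous_intros continuous_on_powr' c) auto
qed

lemma smooth_L_integrable:
  "smooth_periodic \<psi> \<Longrightarrow> integrable torus (\<lambda>x. L x c (gradient \<psi> x))"
  by (intro L_integrable smooth_gradient_Lp)

text \<open>The term -c lowers the slope by 1. So m = 2 bounds c from above, m = 1/2 bounds it from
  below, and m = 1 bounds J from below.\<close>

lemma J_linear_lower: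
  assumes "m > 0"
  obtains K where "\<And>c \<psi>. smooth_periodic \<psi> \<Longrightarrow> (m - 1) * c - K \<le> J c (gradient \<psi>)"
proof -
  obtain K where K: "\<And>x c v. m * c - K \<le> L x c v" using L_linear_lower[OF assms] by metis
  have "(m - 1) * c - K \<le> J c (gradient \<psi>)" if "smooth_periodic \<psi>" for c \<psi>
  proof -
    have "(LINT x|(torus :: (real ^ 'n) measure). m * c - K) \<le> (LINT x|torus. L x c (gradient \<psi> x))"
      by (intro integral_mono smooth_L_integrable that K) simp
    then show ?thesis by (simp add: J_def algebra_simps)
  qed
  then show ?thesis using that by blast
qed

text \<open>The constant is bounded first, because the coercivity of L in v comes with constants
  that depend on a bound for c.\<close>

lemma J_coercive:
  obtains B where "\<And>c \<psi>. smooth_periodic \<psi> \<Longrightarrow> J c (gradient \<psi>) \<le> M \<Longrightarrow>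
    c\<^sup>2 + (LINT x|torus. norm (gradient \<psi> x) powr s) \<le> B"
proof -
  obtain K1 where K1: "\<And>c \<psi>. smooth_periodic \<psi> \<Longrightarrow> (2 - 1) * c - K1 \<le> J c (gradient \<psi>)"
    using J_linear_lower[of 2] by auto
  obtain K2 where K2: "\<And>c \<psi>. smooth_periodic \<psi> \<Longrightarrow> (1/2 - 1) * c - K2 \<le> J c (gradient \<psi>)"
    using J_linear_lower[of "1/2"] by auto
  \<comment> \<open>The slopes 1 and -1/2 give c \<le> M + K1 and -c \<le> 2 (M + K2).\<close>
  define b where "b = \<bar>M\<bar> + \<bar>K1\<bar> + 2 * (\<bar>M\<bar> + \<bar>K2\<bar>)"
  obtain K \<kappa> where K: "\<kappa> > 0" "\<And>x c v. \<bar>c\<bar> \<le> b \<Longrightarrow> \<kappa> * norm v powr s - K \<le> L x c v"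
    using L_coercive[of b] by metis
  have "c\<^sup>2 + (LINT x|torus. norm (gradient \<psi> x) powr s) \<le> b\<^sup>2 + (\<bar>M\<bar> + b + \<bar>K\<bar>) / \<kappa>"
    if \<psi>: "smooth_periodic \<psi>" and J: "J c (gradient \<psi>) \<le> M" for c \<psi>
  proof -
    have c: "\<bar>c\<bar> \<le> b" using K1[OF \<psi>, of c] K2[OF \<psi>, of c] J unfolding b_def by argo
    then have "c\<^sup>2 \<le> b\<^sup>2" by (metis abs_ge_zero power2_abs power_mono)
    have "\<kappa> * (LINT x|torus. norm (gradient \<psi> x) powr s) - K = (LINT x|torus. \<kappa> * norm (gradient \<psi> x) powr s - K)"
      using smooth_gradient_Lp[OF \<psi>] by simp
    also have "\<dots> \<le> (LINT x|torus. L x c (gradient \<psi> x))"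
      using smooth_gradient_Lp[OF \<psi>] by (intro integral_mono smooth_L_integrable \<psi> K(2) c) simp
    also have "\<dots> \<le> M + c" using J by (simp add: J_def)
    finally have "(LINT x|torus. norm (gradient \<psi> x) powr s) * \<kappa> \<le> \<bar>M\<bar> + b + \<bar>K\<bar>"
      using c by (simp add: mult.commute)
    then have "(LINT x|torus. norm (gradient \<psi> x) powr s) \<le> (\<bar>M\<bar> + b + \<bar>K\<bar>) / \<kappa>"
      using K(1) by (simp add: pos_le_divide_eq)
    with \<open>c\<^sup>2 \<le> b\<^sup>2\<close> show ?thesis by simp
  qed
  then show ?thesis using that by blast
qed

text \<open>The infimum runs over gradients of smooth functions only; \<open>J_limit\<close>
  connects it with the limit field.\<close>

definition infJ :: real where
  "infJ = Inf ((\<lambda>(c, \<psi>). J c (gradient \<psi>)) ` (UNIV \<times> {\<psi>. smooth_periodic \<psi>}))"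

lemma infJ_le: "smooth_periodic \<psi> \<Longrightarrow> infJ \<le> J c (gradient \<psi>)"
proof -
  assume \<psi>: "smooth_periodic \<psi>"
  obtain K where K: "\<And>c \<psi>. smooth_periodic \<psi> \<Longrightarrow> (1 - 1) * c - K \<le> J c (gradient \<psi>)"
    using J_linear_lower[of 1] by auto
  show ?thesis
    unfolding infJ_def
  proof (rule cInf_lower)
    show "J c (gradient \<psi>) \<in> (\<lambda>(c, \<psi>). J c (gradient \<psi>)) ` (UNIV \<times> {\<psi>. smooth_periodic \<psi>})"
      using \<psi> by force
    show "bdd_below ((\<lambda>(c, \<psi>). J c (gradient \<psi>)) ` (UNIV \<times> {\<psi>. smooth_periodic \<psi>}))"
      using K by (intro bdd_belowI[of _ "- K"]) auto
  qed
qed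

text \<open>The norm functional is c^2 plus the s-th power of the L^s norm of the gradient. Its
  convexity defect is the parallelogram law in the first part and Clarkson's inequality under the
  integral in the second.\<close>

lemma minimizing_sequence:
  obtains c \<psi> where "\<forall>n :: nat. smooth_periodic (\<psi> n)" "(\<lambda>n. J (c n) (gradient (\<psi> n))) \<longlonglongrightarrow> infJ"
    "\<forall>e>0. \<exists>M. \<forall>n\<ge>M. \<forall>m\<ge>M.
      ((c n - c m) / 2)\<^sup>2 + (LINT x|torus. norm ((gradient (\<psi> n) x - gradient (\<psi> m) x) /\<^sub>R 2) powr s) < e"
proof -
  define X :: "(real \<times> (real ^ 'n \<Rightarrow> real)) set" where "X = UNIV \<times> {\<psi>. smooth_periodic \<psi>}"
  define F where "F = (\<lambda>(c, \<psi>). J c (gradient \<psi>))"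
  \<comment> \<open>The literal coefficients and the trailing 0 match the shape of
    \<open>smooth_periodic_lincomb\<close>.\<close>
  define mid :: "real \<times> (real ^ 'n \<Rightarrow> real) \<Rightarrow> real \<times> (real ^ 'n \<Rightarrow> real) \<Rightarrow> real \<times> (real ^ 'n \<Rightarrow> real)"
    where "mid = (\<lambda>(c, \<psi>) (d, \<eta>). ((c + d) / 2, \<lambda>x. (1/2) * \<psi> x + (1/2) * \<eta> x + 0))"
  define N :: "real \<times> (real ^ 'n \<Rightarrow> real) \<Rightarrow> real"
    where "N = (\<lambda>(c, \<psi>). c\<^sup>2 + (LINT x|torus. norm (gradient \<psi> x) powr s))"
  define D :: "real \<times> (real ^ 'n \<Rightarrow> real) \<Rightarrow> real \<times> (real ^ 'n \<Rightarrow> real) \<Rightarrow> real"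
    where "D = (\<lambda>(c, \<psi>) (d, \<eta>). ((c - d) / 2)\<^sup>2 + (LINT x|torus. norm ((gradient \<psi> x - gradient \<eta> x) /\<^sub>R 2) powr s))"
  have infJ: "infJ = Inf (F ` X)" by (simp add: infJ_def F_def X_def)
  obtain K where K: "\<And>c \<psi>. smooth_periodic \<psi> \<Longrightarrow> (1 - 1) * c - K \<le> J c (gradient \<psi>)"
    using J_linear_lower[of 1] by auto
  obtain B where B: "\<And>c \<psi>. smooth_periodic \<psi> \<Longrightarrow> J c (gradient \<psi>) \<le> infJ + 1 \<Longrightarrow>
    c\<^sup>2 + (LINT x|torus. norm (gradient \<psi> x) powr s) \<le> B"
    using J_coercive[of "infJ + 1"] by metis
  obtain v where v: "\<And>n. v n \<in> X" "(\<lambda>n. F (v n)) \<longlonglongrightarrow> Inf (F ` X)"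
    "\<And>e. e > 0 \<Longrightarrow> \<exists>M. \<forall>n\<ge>M. \<forall>m\<ge>M. D (v n) (v m) < e"
  proof (rule uniformly_convex_minimizing_sequence[of X mid "- K" F N B D])
    have "smooth_periodic (\<lambda>x :: real ^ 'n. 0)"
      by (rule trig_smooth_periodic[OF trig_const])
    then show "X \<noteq> {}" by (auto simp: X_def)
    fix v w assume "v \<in> X" "w \<in> X"
    then obtain c \<psi> d \<eta> where vw: "v = (c, \<psi>)" "w = (d, \<eta>)" and sm: "smooth_periodic \<psi>" "smooth_periodic \<eta>"
      by (auto simp: X_def)
    note lc = smooth_periodic_lincomb[OF sm, of "1/2" "1/2" 0]
    let ?w = "\<lambda>x. (1/2) * \<psi> x + (1/2) * \<eta> x + 0"
    show "mid v w \<in> X" using lc(1) by (simp add: vw mid_def X_def)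
    have midp: "gradient ?w x = gradient \<psi> x + (1/2) *\<^sub>R (gradient \<eta> x - gradient \<psi> x)" for x
      unfolding lc(2) by (simp add: scaleR_right_diff_distrib)
    have "(LINT x|torus. L x ((c + d) / 2) (gradient ?w x))
        \<le> (LINT x|torus. (1/2) * L x c (gradient \<psi> x) + (1/2) * L x d (gradient \<eta> x))"
    proof (rule integral_mono)
      show "integrable torus (\<lambda>x. L x ((c + d) / 2) (gradient ?w x))"
        by (rule smooth_L_integrable[OF lc(1)])
      show "integrable torus (\<lambda>x. (1/2) * L x c (gradient \<psi> x) + (1/2) * L x d (gradient \<eta> x))"
        using smooth_L_integrable sm by simp
      fix x
      have half: "c + (1/2) * (d - c) = (c + d) / 2" by (simp add: field_simps)
      show "L x ((c + d) / 2) (gradient ?w x)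
          \<le> (1/2) * L x c (gradient \<psi> x) + (1/2) * L x d (gradient \<eta> x)"
        using L_convex[of "1/2" x c "d - c" "gradient \<psi> x" "gradient \<eta> x - gradient \<psi> x"]
        unfolding midp half by simp
    qed
    then show "F (mid v w) \<le> (F v + F w) / 2"
      using smooth_L_integrable sm by (simp add: F_def mid_def vw J_def field_simps)
    have "(LINT x|torus. norm (gradient ?w x) powr s) +
        (LINT x|torus. norm ((gradient \<psi> x - gradient \<eta> x) /\<^sub>R 2) powr s)
        = (LINT x|torus. norm (gradient ?w x) powr s +
           norm ((gradient \<psi> x - gradient \<eta> x) /\<^sub>R 2) powr s)"
    proof (rule Bochner_Integration.integral_add[symmetric])
      show "integrable torus (\<lambda>x. norm (gradient ?w x) powr s)"
        by (rule smooth_gradient_Lp(2)[OF lc(1)])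
      show "integrable torus (\<lambda>x. norm ((gradient \<psi> x - gradient \<eta> x) /\<^sub>R 2) powr s)"
        using s_pos by (intro torus_continuous continuous_intros continuous_on_powr' smooth_periodicD sm) auto
    qed
    also have "\<dots> \<le> (LINT x|torus. (norm (gradient \<psi> x) powr s + norm (gradient \<eta> x) powr s) / 2)"
    proof (rule integral_mono)
      show "integrable torus (\<lambda>x. norm (gradient ?w x) powr s +
           norm ((gradient \<psi> x - gradient \<eta> x) /\<^sub>R 2) powr s)"
        using s_pos
        by (intro torus_continuous continuous_intros continuous_on_powr' smooth_periodicD(6) sm lc(1)) auto
      show "integrable torus (\<lambda>x. (norm (gradient \<psi> x) powr s + norm (gradient \<eta> x) powr s) / 2)"
        by (intro integrable_divide Bochner_Integration.integrable_add smooth_gradient_Lp sm)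
      show "norm (gradient ?w x) powr s + norm ((gradient \<psi> x - gradient \<eta> x) /\<^sub>R 2) powr s
        \<le> (norm (gradient \<psi> x) powr s + norm (gradient \<eta> x) powr s) / 2" for x
        using clarkson[OF s_ge_2, of "gradient \<psi> x" "gradient \<eta> x"] unfolding lc(2)
        by (simp add: scaleR_right_distrib)
    qed
    also have "\<dots> = ((LINT x|torus. norm (gradient \<psi> x) powr s) + (LINT x|torus. norm (gradient \<eta> x) powr s)) / 2"
      using smooth_gradient_Lp(2)[OF sm(1)] smooth_gradient_Lp(2)[OF sm(2)] by simp
    finally show "N (mid v w) + D v w \<le> (N v + N w) / 2"
      by (simp add: N_def D_def mid_def vw power2_eq_square field_simps)
  next
    fix v assume "v \<in> X"
    then obtain c \<psi> where v: "v = (c, \<psi>)" and sm: "smooth_periodic \<psi>" by (auto simp: X_def)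
    show "- K \<le> F v" using K[OF sm, of c] by (simp add: v F_def)
    show "0 \<le> N v" by (simp add: v N_def integral_nonneg_AE)
    show "N v \<le> B" if "F v \<le> Inf (F ` X) + 1" using B[OF sm, of c] that by (simp add: v F_def N_def infJ)
  qed blast
  show ?thesis
  proof (rule that[of "\<lambda>n. snd (v n)" "\<lambda>n. fst (v n)"])
    show "\<forall>n. smooth_periodic (snd (v n))" using v(1) by (auto simp: X_def mem_Times_iff)
    show "(\<lambda>n. J (fst (v n)) (gradient (snd (v n)))) \<longlonglongrightarrow> infJ"
      using v(2) by (simp add: F_def infJ case_prod_unfold)
    show "\<forall>e>0. \<exists>M. \<forall>n\<ge>M. \<forall>m\<ge>M. ((fst (v n) - fst (v m)) / 2)\<^sup>2 +
        (LINT x|torus. norm ((gradient (snd (v n)) x - gradient (snd (v m)) x) /\<^sub>R 2) powr s) < e"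
      using v(3) by (simp add: D_def case_prod_unfold)
  qed
qed

text \<open>\<open>lim\<close> depends only on the sequence, convergent or not, so periodicity
  survives at every point and not just almost everywhere, as \<open>torus_Lp\<close>
  demands.\<close>

lemma periodic_lim:
  assumes "\<And>n. periodic (u n)"
  shows "periodic (\<lambda>x. lim (\<lambda>n. u n x))"
  using assms by (simp add: periodic_def)

text \<open>The selected gradients are Cauchy in L^s. Normalising the potentials to mean zero makes
  them Cauchy as well, by the Poincare inequality. A subsequence is taken for the gradients and a
  further one for the potentials, and integration by parts passes to the limit.\<close>

lemma minimizer:
  obtains c \<phi> V \<eta> d h where "torus_Lp s V" "torus_Lp s \<phi>" "weak_gradient \<phi> V"
    "\<forall>n :: nat. smooth_periodic (\<eta> n)" "d \<longlonglongrightarrow> c" "(\<lambda>n. J (d n) (gradient (\<eta> n))) \<longlonglongrightarrow> infJ"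
    "integrable torus (h :: real ^ 'n \<Rightarrow> real)"
    "AE x in torus. (\<lambda>n. gradient (\<eta> n) x) \<longlonglongrightarrow> V x"
    "AE x in torus. \<forall>n. norm (gradient (\<eta> n) x) powr s \<le> h x"
proof -
  obtain c \<psi> where sm': "\<forall>n :: nat. smooth_periodic (\<psi> n)" and Jlim: "(\<lambda>n. J (c n) (gradient (\<psi> n))) \<longlonglongrightarrow> infJ"
    and cauchy: "\<forall>e>0. \<exists>M. \<forall>n\<ge>M. \<forall>m\<ge>M.
      ((c n - c m) / 2)\<^sup>2 + (LINT x|torus. norm ((gradient (\<psi> n) x - gradient (\<psi> m) x) /\<^sub>R 2) powr s) < e"
    by (rule minimizing_sequence)
  then have sm: "smooth_periodic (\<psi> n)" for n by simp
  have nn: "0 \<le> (LINT x|torus. norm ((gradient (\<psi> n) x - gradient (\<psi> m) x) /\<^sub>R 2) powr s)" for n m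
    by (simp add: integral_nonneg_AE)
  have "Cauchy c"
  proof (rule CauchyI)
    fix e :: real assume "e > 0"
    then obtain M where M: "\<And>n m. n \<ge> M \<Longrightarrow> m \<ge> M \<Longrightarrow>
      ((c n - c m) / 2)\<^sup>2 + (LINT x|torus. norm ((gradient (\<psi> n) x - gradient (\<psi> m) x) /\<^sub>R 2) powr s) < (e / 2)\<^sup>2"
      using cauchy[rule_format, of "(e / 2)\<^sup>2"] by auto
    have "norm (c m - c n) < e" if "m \<ge> M" "n \<ge> M" for m n
    proof -
      have "((c m - c n) / 2)\<^sup>2 < (e / 2)\<^sup>2" using M[OF that] nn[of m n] by linarith
      then have "\<bar>(c m - c n) / 2\<bar> < e / 2"
        using \<open>e > 0\<close> by (metis half_gt_zero less_imp_le power2_abs power2_less_imp_less)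
      then show ?thesis using \<open>e > 0\<close> by simp
    qed
    then show "\<exists>M. \<forall>m\<ge>M. \<forall>n\<ge>M. norm (c m - c n) < e" by blast
  qed
  then obtain cl where cl: "c \<longlonglongrightarrow> cl" using Cauchy_convergent_iff convergent_def by blast
  have gcauchy: "\<exists>M. \<forall>n\<ge>M. \<forall>m\<ge>M. (LINT x|torus. norm (gradient (\<psi> n) x - gradient (\<psi> m) x) powr s) < e" if e: "e > 0" for e
  proof -
    have half: "norm ((v :: real ^ 'n) /\<^sub>R 2) powr s = norm v powr s / 2 powr s" for v
      by (simp add: powr_divide)
    obtain M where M: "\<And>n m. n \<ge> M \<Longrightarrow> m \<ge> M \<Longrightarrow>
      ((c n - c m) / 2)\<^sup>2 + (LINT x|torus. norm ((gradient (\<psi> n) x - gradient (\<psi> m) x) /\<^sub>R 2) powr s) < e / 2 powr s"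
      using cauchy[rule_format, of "e / 2 powr s"] e by auto
    have "(LINT x|torus. norm (gradient (\<psi> n) x - gradient (\<psi> m) x) powr s) < e" if "n \<ge> M" "m \<ge> M" for n m
    proof -
      have "(LINT x|torus. norm ((gradient (\<psi> n) x - gradient (\<psi> m) x) /\<^sub>R 2) powr s) < e / 2 powr s"
        using M[OF that] zero_le_power2[of "(c n - c m) / 2"] by linarith
      then show ?thesis unfolding half by (simp add: field_simps)
    qed
    then show ?thesis by blast
  qed
  obtain k1 h1 where k1: "strict_mono (k1 :: nat \<Rightarrow> nat)" "integrable torus (h1 :: real ^ 'n \<Rightarrow> real)"
    "AE x in torus. (\<lambda>n. gradient (\<psi> (k1 n)) x) \<longlonglongrightarrow> lim (\<lambda>n. gradient (\<psi> (k1 n)) x)"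
    "AE x in torus. \<forall>n. norm (gradient (\<psi> (k1 n)) x) powr s \<le> h1 x"
    by (rule Lp_Cauchy_subsequence[of s "\<lambda>n. gradient (\<psi> n)" torus])
      (use s_ge_1 smooth_gradient_Lp[OF sm] gcauchy in auto)
  define V where "V x = lim (\<lambda>n. gradient (\<psi> (k1 n)) x)" for x
  \<comment> \<open>The potential minus its mean, written with a dummy second summand to fit
    \<open>smooth_periodic_lincomb\<close>.\<close>
  define \<xi> where "\<xi> n x = 1 * \<psi> (k1 n) x + 0 * \<psi> (k1 n) x + - (LINT y|torus. \<psi> (k1 n) y)" for n x
  have sm\<xi>: "smooth_periodic (\<xi> n)" for n
    unfolding \<xi>_def[abs_def] by (rule smooth_periodic_lincomb[OF sm sm])
  have g\<xi>: "gradient (\<xi> n) x = gradient (\<psi> (k1 n)) x" for n x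
    unfolding \<xi>_def[abs_def] smooth_periodic_lincomb(2)[OF sm sm] by simp
  have c\<xi>: "continuous_on UNIV (\<xi> n)" for n by (rule smooth_periodicD[OF sm\<xi>])
  have mean\<xi>: "(LINT x|torus. \<xi> n x) = 0" for n
    using torus_continuous(1)[OF smooth_periodicD(4)[OF sm]] by (simp add: \<xi>_def)
  define P where "P = norm (One :: real ^ 'n) powr s"
  have P: "P \<ge> 0" by (simp add: P_def)
  have pc: "(LINT x|torus. \<bar>\<xi> n x - \<xi> m x\<bar> powr s)
    \<le> P * (LINT x|torus. norm (gradient (\<psi> (k1 n)) x - gradient (\<psi> (k1 m)) x) powr s)" for n m
  proof -
    note lc = smooth_periodic_lincomb[OF sm\<xi>[of n] sm\<xi>[of m], of 1 "-1" 0]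
    have "(LINT x|torus. 1 * \<xi> n x + - 1 * \<xi> m x + 0) = 0"
      using mean\<xi> torus_continuous(1)[OF c\<xi>] by simp
    from poincare[OF lc(1) s_ge_1 this] show ?thesis
      unfolding lc(2) g\<xi> P_def by simp
  qed
  have \<xi>cauchy: "\<exists>M. \<forall>n\<ge>M. \<forall>m\<ge>M. (LINT x|torus. norm (\<xi> n x - \<xi> m x) powr s) < e" if e: "e > 0" for e
  proof -
    \<comment> \<open>Dividing by P + 1 keeps the bound positive from P \<ge> 0 alone.\<close>
    obtain M where M: "\<And>n m. n \<ge> M \<Longrightarrow> m \<ge> M \<Longrightarrow>
        (LINT x|torus. norm (gradient (\<psi> n) x - gradient (\<psi> m) x) powr s) < e / (P + 1)"
      using gcauchy[of "e / (P + 1)"] e P by auto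
    have "(LINT x|torus. norm (\<xi> n x - \<xi> m x) powr s) < e" if nm: "n \<ge> M" "m \<ge> M" for n m
    proof -
      have "k1 n \<ge> M" "k1 m \<ge> M" using nm seq_suble[OF k1(1)] order_trans by blast+
      note M[OF this]
      then have "P * (LINT x|torus. norm (gradient (\<psi> (k1 n)) x - gradient (\<psi> (k1 m)) x) powr s) \<le> P * (e / (P + 1))"
        using P by (intro mult_left_mono) auto
      also have "\<dots> < e" using P \<open>e > 0\<close> by (simp add: field_simps)
      finally show ?thesis using pc[of n m] by simp
    qed
    then show ?thesis by blast
  qed
  obtain k2 h2 where k2: "strict_mono (k2 :: nat \<Rightarrow> nat)" "integrable torus (h2 :: real ^ 'n \<Rightarrow> real)"
    "AE x in torus. (\<lambda>n. \<xi> (k2 n) x) \<longlonglongrightarrow> lim (\<lambda>n. \<xi> (k2 n) x)"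
    "AE x in torus. \<forall>n. norm (\<xi> (k2 n) x) powr s \<le> h2 x"
  proof (rule Lp_Cauchy_subsequence[of s \<xi> torus])
    show "\<xi> n \<in> borel_measurable torus" for n by (rule continuous_torus_measurable[OF c\<xi>])
    show "integrable torus (\<lambda>x. norm (\<xi> n x) powr s)" for n
      using s_pos by (intro torus_continuous continuous_intros continuous_on_powr' c\<xi>) auto
  qed (use s_ge_1 \<xi>cauchy in auto)
  define \<phi> where "\<phi> x = lim (\<lambda>n. \<xi> (k2 n) x)" for x
  define \<eta> where "\<eta> n = \<xi> (k2 n)" for n
  have sm\<eta>: "smooth_periodic (\<eta> n)" for n by (simp add: \<eta>_def sm\<xi>)
  have g\<eta>: "gradient (\<eta> n) x = gradient (\<psi> (k1 (k2 n))) x" for n x by (simp add: \<eta>_def g\<xi>)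
  have Vlim: "AE x in torus. (\<lambda>n. gradient (\<eta> n) x) \<longlonglongrightarrow> V x"
    using k1(3)
  proof eventually_elim
    case (elim x)
    from LIMSEQ_subseq_LIMSEQ[OF this k2(1)] show ?case by (simp add: o_def V_def g\<eta>)
  qed
  have dom: "AE x in torus. \<forall>n. norm (gradient (\<eta> n) x) powr s \<le> h1 x"
    using k1(4) by eventually_elim (simp add: g\<eta>)
  have \<phi>lim: "AE x in torus. (\<lambda>n. \<eta> n x) \<longlonglongrightarrow> \<phi> x" using k2(3) by (simp add: \<eta>_def \<phi>_def)
  have \<phi>dom: "AE x in torus. \<forall>n. norm (\<eta> n x) powr s \<le> h2 x" using k2(4) by (simp add: \<eta>_def)
  have perV: "periodic V"
    unfolding V_def[abs_def]
  proof (rule periodic_lim)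
    show "periodic (gradient (\<psi> (k1 n)))" for n
      using smooth_periodicD(1)[OF smooth_periodicD(3)[OF sm]] by (simp add: periodic_def gradient_def)
  qed
  have per\<phi>: "periodic \<phi>" unfolding \<phi>_def[abs_def] by (intro periodic_lim smooth_periodicD sm\<xi>)
  have mV[measurable]: "V \<in> borel_measurable torus"
    unfolding V_def[abs_def] by (intro borel_measurable_lim_metric smooth_gradient_Lp sm)
  have m\<phi>[measurable]: "\<phi> \<in> borel_measurable torus"
    unfolding \<phi>_def[abs_def] by (intro borel_measurable_lim_metric continuous_torus_measurable c\<xi>)
  have "integrable torus (\<lambda>x. norm (V x) powr s)"
    by (rule Lp_limit_integrable[OF s_pos mV k1(2) Vlim dom])
  then have LpV: "torus_Lp s V" using perV mV by (simp add: torus_Lp_def)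
  have "integrable torus (\<lambda>x. norm (\<phi> x) powr s)"
    by (rule Lp_limit_integrable[OF s_pos m\<phi> k2(2) \<phi>lim \<phi>dom])
  then have Lp\<phi>: "torus_Lp s \<phi>" using per\<phi> m\<phi> by (simp add: torus_Lp_def)
  have le1: "norm w \<le> 1 + norm w powr s" for w :: "'b :: real_normed_vector"
    using powr_mono[of 1 s "norm w"] s_ge_1 by (cases "norm w \<le> 1") (auto simp: add_increasing2)
  have "weak_gradient \<phi> V"
    unfolding weak_gradient_def
  proof (intro conjI allI impI)
    show "torus_Lp 1 \<phi>" "torus_Lp 1 V"
      using torus_Lp_integrable[OF LpV s_ge_1] torus_Lp_integrable[OF Lp\<phi> s_ge_1] LpV Lp\<phi>
      by (auto simp: torus_Lp_def)
    fix \<theta> :: "real ^ 'n \<Rightarrow> real" and i assume \<theta>: "smooth_periodic \<theta>"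
    obtain B1 where B1: "\<And>x. \<bar>\<theta> x\<bar> \<le> B1"
      using periodic_continuous_bounded[OF smooth_periodicD(4,1)[OF \<theta>]] by metis
    obtain B2 where B2: "\<And>x. \<bar>partial i \<theta> x\<bar> \<le> B2"
      using periodic_continuous_bounded[OF smooth_periodicD(5)[OF \<theta>] smooth_periodicD(1)[OF smooth_periodicD(3)[OF \<theta>]]] by metis
    have [measurable]: "\<theta> \<in> borel_measurable torus" "partial i \<theta> \<in> borel_measurable torus"
      by (intro continuous_torus_measurable smooth_periodicD \<theta>)+
    have [measurable]: "\<eta> n \<in> borel_measurable torus" "partial i (\<eta> n) \<in> borel_measurable torus" for n
      by (intro continuous_torus_measurable smooth_periodicD sm\<eta>)+
    have Vi[measurable]: "(\<lambda>x. V x $ i) \<in> borel_measurable torus"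
      by (rule borel_measurable_integrable[OF component_integrable[OF torus_Lp_integrable[OF LpV s_ge_1]]])
    have "(\<lambda>n. LINT x|torus. \<eta> n x * partial i \<theta> x) \<longlonglongrightarrow> (LINT x|torus. \<phi> x * partial i \<theta> x)"
    proof (rule integral_dominated_convergence[where w = "\<lambda>x. (1 + \<bar>h2 x\<bar>) * B2"])
      show "integrable torus (\<lambda>x. (1 + \<bar>h2 x\<bar>) * B2)" using k2(2) by simp
      show "AE x in torus. (\<lambda>n. \<eta> n x * partial i \<theta> x) \<longlonglongrightarrow> \<phi> x * partial i \<theta> x"
        using \<phi>lim by eventually_elim (intro tendsto_intros)
      show "AE x in torus. norm (\<eta> n x * partial i \<theta> x) \<le> (1 + \<bar>h2 x\<bar>) * B2" for n
        using \<phi>dom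
      proof eventually_elim
        case (elim x)
        have "norm (\<eta> n x) \<le> 1 + \<bar>h2 x\<bar>" using le1[of "\<eta> n x"] elim[rule_format, of n] by linarith
        then show ?case unfolding real_norm_def abs_mult using B2[of x] by (intro mult_mono) auto
      qed
    qed measurable
    moreover have "(\<lambda>n. - (LINT x|torus. partial i (\<eta> n) x * \<theta> x)) \<longlonglongrightarrow> - (LINT x|torus. V x $ i * \<theta> x)"
    proof (intro tendsto_minus integral_dominated_convergence[where w = "\<lambda>x. (1 + \<bar>h1 x\<bar>) * B1"])
      show "integrable torus (\<lambda>x. (1 + \<bar>h1 x\<bar>) * B1)" using k1(2) by simp
      show "AE x in torus. (\<lambda>n. partial i (\<eta> n) x * \<theta> x) \<longlonglongrightarrow> V x $ i * \<theta> x"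
        using Vlim
      proof eventually_elim
        case (elim x)
        then have "(\<lambda>n. gradient (\<eta> n) x $ i * \<theta> x) \<longlonglongrightarrow> V x $ i * \<theta> x"
          by (intro tendsto_intros)
        then show ?case by (simp add: partial_nth)
      qed
      show "AE x in torus. norm (partial i (\<eta> n) x * \<theta> x) \<le> (1 + \<bar>h1 x\<bar>) * B1" for n
        using dom
      proof eventually_elim
        case (elim x)
        have "norm (partial i (\<eta> n) x) \<le> norm (gradient (\<eta> n) x)"
          using component_le_norm_cart[of "gradient (\<eta> n) x" i] by (simp add: partial_nth)
        then have "norm (partial i (\<eta> n) x) \<le> 1 + \<bar>h1 x\<bar>"
          using le1[of "gradient (\<eta> n) x"] elim[rule_format, of n] by linarith
        then show ?case unfolding real_norm_def abs_mult using B1[of x] by (intro mult_mono) auto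
      qed
    qed measurable
    moreover have "(LINT x|torus. \<eta> n x * partial i \<theta> x) = - (LINT x|torus. partial i (\<eta> n) x * \<theta> x)" for n
      by (rule integration_by_parts[OF sm\<eta> \<theta>])
    ultimately show "(LINT x|torus. \<phi> x * partial i \<theta> x) = - (LINT x|torus. V x $ i * \<theta> x)"
      using LIMSEQ_unique by simp
  qed
  moreover have "(\<lambda>n. c (k1 (k2 n))) \<longlonglongrightarrow> cl"
    using LIMSEQ_subseq_LIMSEQ[OF LIMSEQ_subseq_LIMSEQ[OF cl k1(1)] k2(1)] by (simp add: o_def)
  moreover have "(\<lambda>n. J (c (k1 (k2 n))) (gradient (\<eta> n))) \<longlonglongrightarrow> infJ"
  proof -
    have "gradient (\<eta> n) = gradient (\<psi> (k1 (k2 n)))" for n by (rule ext) (rule g\<eta>)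
    then show ?thesis
      using LIMSEQ_subseq_LIMSEQ[OF LIMSEQ_subseq_LIMSEQ[OF Jlim k1(1)] k2(1)] by (simp add: o_def)
  qed
  ultimately show ?thesis
    using that[of V \<phi> \<eta> "\<lambda>n. c (k1 (k2 n))" cl h1] LpV Lp\<phi> sm\<eta> k1(2) Vlim dom by blast
qed

text \<open>The fixed perturbation by \<delta> and \<theta> is included so that one limit both
  identifies J(c, V) with the infimum and transfers minimality to the competitors of V.\<close>

lemma J_limit:
  assumes sm: "\<And>n :: nat. smooth_periodic (\<eta> n)" and d: "d \<longlonglongrightarrow> c" and h: "integrable torus (h :: real ^ 'n \<Rightarrow> real)"
    and lim: "AE x in torus. (\<lambda>n. gradient (\<eta> n) x) \<longlonglongrightarrow> V x"
    and dom: "AE x in torus. \<forall>n. norm (gradient (\<eta> n) x) powr s \<le> h x"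
    and V: "V \<in> borel_measurable torus" and \<theta>: "smooth_periodic \<theta>"
  shows "(\<lambda>n. J (d n + \<delta>) (\<lambda>x. gradient (\<eta> n) x + gradient \<theta> x)) \<longlonglongrightarrow> J (c + \<delta>) (\<lambda>x. V x + gradient \<theta> x)"
proof -
  obtain K where K: "K > 0" "\<And>x c v. \<bar>L x c v\<bar> \<le> K * (1 + \<bar>c\<bar> powr p + norm v powr s)"
    using L_growth by metis
  note [measurable] = V smooth_gradient_Lp(1)[OF sm] smooth_gradient_Lp(1)[OF \<theta>]
  have "Bseq (\<lambda>n. d n + \<delta>)"
    using convergent_imp_Bseq convergentI[OF tendsto_add[OF d tendsto_const[of \<delta>]]] by blast
  then obtain B where B: "\<And>n. \<bar>d n + \<delta>\<bar> \<le> B" using BseqE by (metis real_norm_def)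
  show ?thesis
    unfolding J_def
  proof (intro tendsto_diff tendsto_add d tendsto_const
      integral_dominated_convergence[where w = "\<lambda>x. K * (1 + B powr p + 2 powr s * (h x + norm (gradient \<theta> x) powr s))"])
    show "integrable torus (\<lambda>x. K * (1 + B powr p + 2 powr s * (h x + norm (gradient \<theta> x) powr s)))"
      using h smooth_gradient_Lp(2)[OF \<theta>] by simp
    show "(\<lambda>x. L x (c + \<delta>) (V x + gradient \<theta> x)) \<in> borel_measurable torus"
      by (rule L_measurable) measurable
    show "(\<lambda>x. L x (d n + \<delta>) (gradient (\<eta> n) x + gradient \<theta> x)) \<in> borel_measurable torus" for n
      by (rule L_measurable) measurable
    show "AE x in torus. (\<lambda>n. L x (d n + \<delta>) (gradient (\<eta> n) x + gradient \<theta> x)) \<longlonglongrightarrow> L x (c + \<delta>) (V x + gradient \<theta> x)"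
      using lim
    proof eventually_elim
      case (elim x)
      have "(\<lambda>n. (x, d n + \<delta>, gradient (\<eta> n) x + gradient \<theta> x)) \<longlonglongrightarrow> (x, c + \<delta>, V x + gradient \<theta> x)"
        by (intro tendsto_intros d elim)
      from continuous_on_tendsto_compose[OF L_continuous this] show ?case by simp
    qed
    show "AE x in torus. norm (L x (d n + \<delta>) (gradient (\<eta> n) x + gradient \<theta> x))
      \<le> K * (1 + B powr p + 2 powr s * (h x + norm (gradient \<theta> x) powr s))" for n
      using dom
    proof eventually_elim
      case (elim x)
      have "norm (gradient (\<eta> n) x + gradient \<theta> x) powr s \<le> 2 powr s * (norm (gradient (\<eta> n) x) powr s + norm (gradient \<theta> x) powr s)"
        using s_pos by (intro norm_add_powr_le) simp
      also have "\<dots> \<le> 2 powr s * (h x + norm (gradient \<theta> x) powr s)"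
        using elim by (intro mult_left_mono add_right_mono) auto
      finally have "norm (gradient (\<eta> n) x + gradient \<theta> x) powr s \<le> 2 powr s * (h x + norm (gradient \<theta> x) powr s)" .
      moreover have "\<bar>d n + \<delta>\<bar> powr p \<le> B powr p" using B p_t by (intro powr_mono2) auto
      ultimately show ?case
        unfolding real_norm_def using K(1) by (intro order_trans[OF K(2)] mult_left_mono add_mono) auto
    qed
  qed
qed

section \<open>First variation of the functional\<close>

lemma L_slope:
  "(\<lambda>n. (L x (c + inverse (real (Suc n)) * \<delta>) (v + inverse (real (Suc n)) *\<^sub>R \<xi>) - L x c v) / inverse (real (Suc n)))
    \<longlonglongrightarrow> g x (c + H x v) * (\<delta> + DH x v \<bullet> \<xi>)"
proof -
  define \<alpha> where "\<alpha> u = c + u * \<delta> + H x (v + u *\<^sub>R \<xi>)" for u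
  have H: "((\<lambda>u. H x (v + u *\<^sub>R \<xi>)) has_real_derivative DH x v \<bullet> \<xi>) (at 0)"
  proof -
    have "((\<lambda>u. v + u *\<^sub>R \<xi>) has_derivative (\<lambda>u. u *\<^sub>R \<xi>)) (at 0)"
      by (auto intro!: derivative_eq_intros)
    from has_derivative_compose[OF this, of "H x" "\<lambda>w. DH x v \<bullet> w"] has_derivative_gradient[OF H_props(4), of x v]
    have "((\<lambda>u. H x (v + u *\<^sub>R \<xi>)) has_derivative (\<lambda>u. u * (DH x v \<bullet> \<xi>))) (at 0)" by simp
    then show ?thesis by (simp add: has_field_derivative_def mult.commute[of _ "DH x v \<bullet> \<xi>"])
  qed
  have "(\<alpha> has_real_derivative \<delta> + DH x v \<bullet> \<xi>) (at 0)"
    unfolding \<alpha>_def[abs_def] by (auto intro!: derivative_eq_intros H)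
  moreover have "\<alpha> 0 = c + H x v" by (simp add: \<alpha>_def)
  ultimately have "((\<lambda>u. G x (\<alpha> u)) has_real_derivative g x (c + H x v) * (\<delta> + DH x v \<bullet> \<xi>)) (at 0)"
    using DERIV_chain2[of "G x" "g x (\<alpha> 0)" \<alpha> 0 "\<delta> + DH x v \<bullet> \<xi>" UNIV] G_deriv by simp
  then have "((\<lambda>u. (G x (\<alpha> u) - G x (\<alpha> 0)) / u) \<longlongrightarrow> g x (c + H x v) * (\<delta> + DH x v \<bullet> \<xi>)) (at 0)"
    by (simp add: DERIV_def)
  moreover have "filterlim (\<lambda>n. inverse (real (Suc n))) (at 0) sequentially"
    unfolding filterlim_at using LIMSEQ_inverse_real_of_nat by auto
  ultimately have "(\<lambda>n. (G x (\<alpha> (inverse (real (Suc n)))) - G x (\<alpha> 0)) / inverse (real (Suc n)))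
      \<longlonglongrightarrow> g x (c + H x v) * (\<delta> + DH x v \<bullet> \<xi>)"
    by (rule filterlim_compose)
  then show ?thesis by (simp add: \<alpha>_def L_def)
qed

text \<open>By convexity the difference quotients lie between the directional derivative
  \<open>l\<close> and the quotient with step 1, and \<open>l\<close> lies above the backward
  quotient with step 1. This yields an integrable majorant from values of L alone, with no separate
  estimate of g times DH.\<close>

lemma first_order_condition:
  fixes V \<xi> :: "real ^ 'n \<Rightarrow> real ^ 'n"
  assumes V: "V \<in> borel_measurable torus" "integrable torus (\<lambda>x. norm (V x) powr s)"
    and \<xi>: "\<xi> \<in> borel_measurable torus" "integrable torus (\<lambda>x. norm (\<xi> x) powr s)"
    and min: "\<And>u. 0 \<le> u \<Longrightarrow> J c V \<le> J (c + u * \<delta>) (\<lambda>x. V x + u *\<^sub>R \<xi> x)"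
  shows "\<delta> \<le> (LINT x|torus. g x (c + H x (V x)) * (\<delta> + DH x (V x) \<bullet> \<xi> x))"
proof -
  define \<epsilon> where "\<epsilon> n = inverse (real (Suc n))" for n
  have \<epsilon>: "0 < \<epsilon> n" "\<epsilon> n \<le> 1" for n by (auto simp: \<epsilon>_def field_simps)
  note [measurable] = V(1) \<xi>(1)
  have i0: "integrable torus (\<lambda>x. L x c (V x))" by (rule L_integrable[OF V])
  have iu: "integrable torus (\<lambda>x. L x (c + u * \<delta>) (V x + u *\<^sub>R \<xi> x))" for u
  proof (rule L_integrable)
    show "integrable torus (\<lambda>x. norm (V x + u *\<^sub>R \<xi> x) powr s)"
    proof (rule Bochner_Integration.integrable_bound)
      show "integrable torus (\<lambda>x. 2 powr s * (norm (V x) powr s + \<bar>u\<bar> powr s * norm (\<xi> x) powr s))"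
        using V \<xi> by simp
      show "AE x in torus. norm (norm (V x + u *\<^sub>R \<xi> x) powr s) \<le> norm (2 powr s * (norm (V x) powr s + \<bar>u\<bar> powr s * norm (\<xi> x) powr s))"
        using norm_add_powr_le[of s "V _" "u *\<^sub>R \<xi> _"] s_pos
        by (intro AE_I2) (simp add: powr_mult)
    qed measurable
  qed measurable
  have i1: "integrable torus (\<lambda>x. L x (c + \<delta>) (V x + \<xi> x))" using iu[of 1] by simp
  have im1: "integrable torus (\<lambda>x. L x (c - \<delta>) (V x - \<xi> x))" using iu[of "-1"] by simp
  define Q where "Q n x = (L x (c + \<epsilon> n * \<delta>) (V x + \<epsilon> n *\<^sub>R \<xi> x) - L x c (V x)) / \<epsilon> n" for n x
  define l where "l x = g x (c + H x (V x)) * (\<delta> + DH x (V x) \<bullet> \<xi> x)" for x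
  have Qlim: "(\<lambda>n. Q n x) \<longlonglongrightarrow> l x" for x
    unfolding Q_def \<epsilon>_def l_def by (rule L_slope)
  have Qup: "Q n x \<le> L x (c + \<delta>) (V x + \<xi> x) - L x c (V x)" for n x
  proof -
    have "L x (c + \<epsilon> n * \<delta>) (V x + \<epsilon> n *\<^sub>R \<xi> x) - L x c (V x) \<le> \<epsilon> n * (L x (c + \<delta>) (V x + \<xi> x) - L x c (V x))"
      using L_convex[of "\<epsilon> n" x c \<delta> "V x" "\<xi> x"] \<epsilon>[of n] by (simp add: algebra_simps)
    then show ?thesis unfolding Q_def using \<epsilon>(1)[of n] by (simp add: pos_divide_le_eq mult.commute)
  qed
  have Qlow: "l x \<le> Q n x" for n x
  proof -
    have "\<epsilon> n * l x \<le> L x (c + \<epsilon> n * \<delta>) (V x + \<epsilon> n *\<^sub>R \<xi> x) - L x c (V x)"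
      using L_tangent[of x c "V x" "\<epsilon> n * \<delta>" "\<epsilon> n *\<^sub>R \<xi> x"] by (simp add: l_def algebra_simps)
    then show ?thesis unfolding Q_def using \<epsilon>(1)[of n] by (simp add: pos_le_divide_eq mult.commute)
  qed
  have llow: "L x c (V x) - L x (c - \<delta>) (V x - \<xi> x) \<le> l x" for x
    using L_tangent[of x c "V x" "- \<delta>" "- \<xi> x"] by (simp add: l_def algebra_simps)
  define w where "w x = \<bar>L x (c + \<delta>) (V x + \<xi> x)\<bar> + \<bar>L x c (V x)\<bar> + \<bar>L x (c - \<delta>) (V x - \<xi> x)\<bar>" for x
  have iw: "integrable torus w" unfolding w_def using i0 i1 im1 by simp
  have iQ: "integrable torus (Q n)" for n unfolding Q_def using iu i0 by simp
  have ml: "l \<in> borel_measurable torus"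
    by (rule borel_measurable_LIMSEQ_metric[of Q]) (use iQ Qlim in auto)
  have "(\<lambda>n. LINT x|torus. Q n x) \<longlonglongrightarrow> (LINT x|torus. l x)"
  proof (rule integral_dominated_convergence[OF ml _ iw])
    show "Q n \<in> borel_measurable torus" for n using iQ by simp
    show "AE x in torus. norm (Q n x) \<le> w x" for n
    proof (rule AE_I2)
      fix x
      show "norm (Q n x) \<le> w x"
        using Qup[of n x] Qlow[of x n] llow[of x] unfolding w_def real_norm_def by linarith
    qed
  qed (use Qlim in simp)
  moreover have "\<delta> \<le> (LINT x|torus. Q n x)" for n
  proof -
    have "(LINT x|torus. Q n x) = ((LINT x|torus. L x (c + \<epsilon> n * \<delta>) (V x + \<epsilon> n *\<^sub>R \<xi> x)) - (LINT x|torus. L x c (V x))) / \<epsilon> n"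
      unfolding Q_def using iu i0 by simp
    moreover have "\<epsilon> n * \<delta> \<le> (LINT x|torus. L x (c + \<epsilon> n * \<delta>) (V x + \<epsilon> n *\<^sub>R \<xi> x)) - (LINT x|torus. L x c (V x))"
      using min[of "\<epsilon> n"] \<epsilon>(1)[of n] by (simp add: J_def)
    ultimately show ?thesis using \<epsilon>(1)[of n] by (simp add: pos_le_divide_eq mult.commute)
  qed
  ultimately show ?thesis unfolding l_def[symmetric] by (intro LIMSEQ_le_const) auto
qed

text \<open>The bound on directional derivatives is used in the direction of the gradient itself,
  normalised by \<open>sgn\<close>.\<close>

lemma norm_DH_growth:
  obtains C where "C > 0" "\<And>x v. norm (DH x v) \<le> C * (1 + norm v powr r)"
proof -
  obtain C where C: "C > 0" "\<And>x v u. \<bar>DH x v \<bullet> u\<bar> \<le> C * (1 + norm v powr r + norm u powr r)"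
    using DH_growth by metis
  have "norm (DH x v) \<le> 2 * C * (1 + norm v powr r)" for x v
  proof -
    have "norm (DH x v) = DH x v \<bullet> sgn (DH x v)"
      by (cases "DH x v = 0") (auto simp: sgn_div_norm dot_square_norm power2_eq_square)
    also have "\<dots> \<le> C * (1 + norm v powr r + norm (sgn (DH x v)) powr r)"
      using C(2)[of x v "sgn (DH x v)"] by linarith
    also have "\<dots> \<le> C * (1 + norm v powr r + 1)"
      using C r by (intro mult_left_mono add_left_mono) (auto simp: norm_sgn)
    also have "\<dots> \<le> C * (2 * (1 + norm v powr r))"
      using C by (intro mult_left_mono) auto
    finally show ?thesis by (simp add: mult_ac)
  qed
  then show ?thesis using that[of "2 * C"] C by simp
qed

lemma weak_solution_exists: "\<exists>c \<phi> m. weak_solution r q H f c \<phi> m"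
proof -
  obtain c \<phi> V \<eta> d h where LpV: "torus_Lp s V" and Lp\<phi>: "torus_Lp s \<phi>" and wg: "weak_gradient \<phi> V"
    and sm': "\<forall>n :: nat. smooth_periodic (\<eta> n)" and d: "d \<longlonglongrightarrow> c" and Jlim: "(\<lambda>n. J (d n) (gradient (\<eta> n))) \<longlonglongrightarrow> infJ"
    and h: "integrable torus (h :: real ^ 'n \<Rightarrow> real)"
    and lim: "AE x in torus. (\<lambda>n. gradient (\<eta> n) x) \<longlonglongrightarrow> V x"
    and dom: "AE x in torus. \<forall>n. norm (gradient (\<eta> n) x) powr s \<le> h x"
    by (rule minimizer)
  then have sm: "smooth_periodic (\<eta> n)" for n by simp
  have V: "V \<in> borel_measurable torus" "integrable torus (\<lambda>x. norm (V x) powr s)" "periodic V"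
    using LpV by (auto simp: torus_Lp_def)
  note [measurable] = V(1)
  have zero: "smooth_periodic (\<lambda>x :: real ^ 'n. 0)" "gradient (\<lambda>x :: real ^ 'n. 0) x = 0" for x :: "real ^ 'n"
    by (auto intro!: trig_smooth_periodic trig_const gradient_eqI)
  have JV: "J c V = infJ"
    using LIMSEQ_unique[OF Jlim] J_limit[OF sm d h lim dom V(1) zero(1), of 0] by (simp add: zero(2))
  \<comment> \<open>The value at a competitor of V is the limit of values at smooth gradients with
    the same perturbation, each of which is at least \<open>infJ\<close>.\<close>
  have min: "J c V \<le> J (c + u * \<delta>) (\<lambda>x. V x + u *\<^sub>R gradient \<theta> x)" if \<theta>: "smooth_periodic \<theta>" for u \<delta> \<theta>
  proof -
    note lc = smooth_periodic_lincomb[OF \<theta> \<theta>, of u 0 0]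
    have "(\<lambda>n. J (d n + u * \<delta>) (\<lambda>x. gradient (\<eta> n) x + gradient (\<lambda>x. u * \<theta> x + 0 * \<theta> x + 0) x))
        \<longlonglongrightarrow> J (c + u * \<delta>) (\<lambda>x. V x + gradient (\<lambda>x. u * \<theta> x + 0 * \<theta> x + 0) x)"
      by (rule J_limit[OF sm d h lim dom V(1) lc(1)])
    then have "(\<lambda>n. J (d n + u * \<delta>) (\<lambda>x. gradient (\<eta> n) x + u *\<^sub>R gradient \<theta> x))
        \<longlonglongrightarrow> J (c + u * \<delta>) (\<lambda>x. V x + u *\<^sub>R gradient \<theta> x)"
      unfolding lc(2) by simp
    moreover have "infJ \<le> J (d n + u * \<delta>) (\<lambda>x. gradient (\<eta> n) x + u *\<^sub>R gradient \<theta> x)" for n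
    proof -
      note lc = smooth_periodic_lincomb[OF sm[of n] \<theta>, of 1 u 0]
      have "gradient (\<lambda>x. 1 * \<eta> n x + u * \<theta> x + 0) = (\<lambda>x. gradient (\<eta> n) x + u *\<^sub>R gradient \<theta> x)"
        by (rule ext) (simp only: lc(2) scaleR_one)
      with infJ_le[OF lc(1)] show ?thesis by simp
    qed
    ultimately show ?thesis unfolding JV by (intro LIMSEQ_le_const) auto
  qed
  \<comment> \<open>The density is the multiplier that appears in the first variation; the relations
    between m and c + H are then the inverse relations of g and f.\<close>
  define m where "m x = g x (c + H x (V x))" for x
  have foc: "\<delta> \<le> (LINT x|torus. m x * (\<delta> + DH x (V x) \<bullet> gradient \<theta> x))" if \<theta>: "smooth_periodic \<theta>" for \<delta> \<theta>
    unfolding m_def by (rule first_order_condition[OF V(1,2) smooth_gradient_Lp[OF \<theta>] min[OF \<theta>]])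
  have mnn: "m x \<ge> 0" for x by (simp add: m_def g_nonneg)
  have meas: "m \<in> borel_measurable torus"
  proof -
    have "continuous_on UNIV (\<lambda>(x, v). g x (c + H x v))"
      unfolding case_prod_unfold
      by (intro continuous_on_compose_curried[OF g_continuous] continuous_on_compose_curried[OF H_props(2)] continuous_intros)
    from torus_measurable_comp[OF this V(1)] show ?thesis by (simp add: m_def[abs_def])
  qed
  have "integrable torus (\<lambda>x. norm (m x) powr q)"
  proof -
    obtain C where C: "C > 0" "\<And>x a. g x a \<le> C * (1 + \<bar>a\<bar> powr t)" using g_growth by metis
    obtain K where K: "K > 0" "\<And>x c v. \<bar>c + H x v\<bar> powr p \<le> K * (1 + \<bar>c\<bar> powr p + norm v powr s)"
      using a_growth by metis
    define b where "b x = C powr q * (2 powr q * (1 + K * (1 + \<bar>c\<bar> powr p + norm (V x) powr s)))" for x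
    have le: "norm (m x) powr q \<le> b x" for x
    proof -
      define a where "a = c + H x (V x)"
      have "norm (m x) powr q \<le> (C * (1 + \<bar>a\<bar> powr t)) powr q"
        using C(2)[of x a] mnn[of x] q by (intro powr_mono2) (auto simp: m_def a_def)
      also have "\<dots> = C powr q * (1 + \<bar>a\<bar> powr t) powr q" using C by (simp add: powr_mult)
      also have "\<dots> \<le> C powr q * (2 powr q * (1 powr q + (\<bar>a\<bar> powr t) powr q))"
        using q by (intro mult_left_mono powr_sum_le_max) auto
      also have "(\<bar>a\<bar> powr t) powr q = \<bar>a\<bar> powr p" by (simp only: powr_powr p_t(4))
      also have "C powr q * (2 powr q * (1 powr q + \<bar>a\<bar> powr p)) \<le> b x"
        unfolding b_def a_def using K(2)[of c x "V x"] by (intro mult_left_mono add_mono) auto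
      finally show ?thesis .
    qed
    show ?thesis
    proof (rule Bochner_Integration.integrable_bound)
      show "integrable torus b" unfolding b_def using V(2) by simp
      show "AE x in torus. norm (norm (m x) powr q) \<le> norm (b x)"
        using order_trans[OF le abs_ge_self] by (auto intro!: AE_I2)
    qed (use meas in measurable)
  qed
  moreover have "periodic m"
    unfolding periodic_def
  proof (intro allI impI)
    fix x k :: "real ^ 'n" assume k: "\<forall>i. k $ i \<in> \<int>"
    have "g (x + k) a = g x a" "H (x + k) v = H x v" "V (x + k) = V x" for a v
      using g_periodic H_props(1) V(3) k unfolding periodic_def by blast+
    then show "m (x + k) = m x" by (simp add: m_def)
  qed
  ultimately have Lpm: "torus_Lp q m" using meas by (simp add: torus_Lp_def)
  have im: "integrable torus m" using torus_Lp_integrable[OF Lpm] q by simp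
  \<comment> \<open>Only the constant is varied, by +1 and by -1, which turns the one-sided
    condition into an equality.\<close>
  have mass: "(LINT x|torus. m x) = 1"
    using foc[OF zero(1), of 1] foc[OF zero(1), of "-1"] by (simp add: zero(2))
  have mDH: "(\<lambda>x. DH x (V x)) \<in> borel_measurable torus"
    by (rule torus_measurable_comp[OF H_props(5) V(1)])
  have iw: "integrable torus (\<lambda>x. m x *\<^sub>R DH x (V x))"
  proof -
    obtain C where C: "C > 0" "\<And>x v. norm (DH x v) \<le> C * (1 + norm v powr r)" using norm_DH_growth by metis
    have le: "norm (m x *\<^sub>R DH x (V x)) \<le> C * (2 * norm (m x) powr q + 1 + norm (V x) powr s)" for x
    proof -
      have "norm (m x *\<^sub>R DH x (V x)) \<le> m x * (C * (1 + norm (V x) powr r))"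
        using C(2) mnn[of x] by (auto intro!: mult_left_mono)
      also have "\<dots> = C * (m x * (1 + norm (V x) powr r))" by simp
      also have "\<dots> \<le> C * (2 * m x powr q + 1 + norm (V x) powr s)"
        using C(1) by (intro mult_left_mono mass_times_growth mnn) auto
      finally show ?thesis using mnn[of x] by simp
    qed
    show ?thesis
    proof (rule Bochner_Integration.integrable_bound)
      show "integrable torus (\<lambda>x. C * (2 * norm (m x) powr q + 1 + norm (V x) powr s))"
        using Lpm V(2) by (simp add: torus_Lp_def)
      show "AE x in torus. norm (m x *\<^sub>R DH x (V x)) \<le> norm (C * (2 * norm (m x) powr q + 1 + norm (V x) powr s))"
        using order_trans[OF le abs_ge_self] by (intro AE_I2) simp
    qed (use meas mDH in measurable)
  qed
  \<comment> \<open>Only the gradient is varied, along \<theta> and -\<theta>, with \<delta> =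
    0.\<close>
  have df: "divergence_free (\<lambda>x. m x *\<^sub>R DH x (V x))"
    unfolding divergence_free_def
  proof (intro allI impI)
    fix \<theta> :: "real ^ 'n \<Rightarrow> real" assume \<theta>: "smooth_periodic \<theta>"
    note lc = smooth_periodic_lincomb[OF \<theta> \<theta>, of "-1" 0 0]
    have "0 \<le> (LINT x|torus. m x * (DH x (V x) \<bullet> gradient \<theta> x))" using foc[OF \<theta>, of 0] by simp
    moreover have "0 \<le> (LINT x|torus. - (m x * (DH x (V x) \<bullet> gradient \<theta> x)))"
      using foc[OF lc(1), of 0] unfolding lc(2) by simp
    ultimately show "(LINT x|torus. (m x *\<^sub>R DH x (V x)) \<bullet> gradient \<theta> x) = 0" by simp
  qed
  have "ereal (c + H x (V x)) = coupling_ext f x (m x)" if "m x > 0" for x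
    using f_g[of x "c + H x (V x)"] that by (simp add: coupling_ext_pos m_def)
  moreover have "ereal (c + H x (V x)) \<le> coupling_ext f x (m x)" for x
  proof (cases "m x > 0")
    case True
    then show ?thesis using f_g[of x "c + H x (V x)"] by (simp add: coupling_ext_pos m_def)
  next
    case False
    have "c + H x (V x) \<le> f x a" if "a > 0" for a
      using g_ge_iff[OF that, of x "c + H x (V x)"] False that by (simp add: m_def)
    then show ?thesis using coupling_ext_nonpos[of "m x"] False by simp
  qed
  ultimately have "weak_solution r q H f c \<phi> m"
    unfolding weak_solution_def s_def[symmetric] torus_W1p_def
    using Lp\<phi> wg LpV Lpm mnn mass iw df by (auto intro!: exI[of _ V])
  then show ?thesis by blast
qed

end

theorem theorem4p2:
  fixes H :: "real ^ 'n \<Rightarrow> real ^ 'n \<Rightarrow> real"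
    and f :: "real ^ 'n \<Rightarrow> real \<Rightarrow> real"
    and r q :: real
  assumes "hamiltonian r H"
    and "coupling q f"
    and "r > max (real CARD('n) * (q - 1)) 1"
  shows "(\<exists>c \<phi> m. weak_solution r q H f c \<phi> m) \<and>
         (\<forall>c\<^sub>1 \<phi>\<^sub>1 m\<^sub>1 c\<^sub>2 \<phi>\<^sub>2 m\<^sub>2.
            weak_solution r q H f c\<^sub>1 \<phi>\<^sub>1 m\<^sub>1 \<and> weak_solution r q H f c\<^sub>2 \<phi>\<^sub>2 m\<^sub>2 \<longrightarrow>
            c\<^sub>1 = c\<^sub>2 \<and> (AE x in torus. m\<^sub>1 x = m\<^sub>2 x))"
proof -
  interpret mfg H f r q by standard (use assms in auto)
  show ?thesis using weak_solution_exists weak_solution_unique by blast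
qed

end
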